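(* Let $\epsilon_1,\epsilon_2\in\{+,-\}$ and suppose that $m^{\epsilon_1}\not\equiv0$ and $n^{\epsilon_2}\not\equiv0$ on $[T_1,T_2]$. Write $Q=\mathbb{R}_{\epsilon_1}\times\mathbb{R}_{\epsilon_2}$. Then either (i) for every integer $k\ge1$, the intersections $C_k^>\cap Q$ and $C_k^<\cap Q$ are both nonempty, or (ii) there exists an integer $k_0\ge0$ such that $C_k^>\cap Q$ and $C_k^<\cap Q$ are both nonempty for every $1\le k\le k_0$, exactly one of the two intersections $C_{k_0+1}^>\cap Q$ and $C_{k_0+1}^<\cap Q$ is nonempty (the other one being empty), and $C_k^>\cap Q$ and $C_k^<\cap Q$ are both empty for every $k\ge k_0+2$. In particular, if both $m$ and $n$ change sign on $[T_1,T_2]$ (i.e. $m^\pm\not\equiv0$ and $n^\pm\not\equiv0$), then $\Sigma^*$ consists, in each of the four quadrants of $\mathbb{R}^2$, of a (nonzero) odd or infinite number of hyperbolic like curves $C_k^>,C_k^<$ ($k\ge1$).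
   Context: Let $T_1<T_2$ be real numbers, $p,q,m,n\in C[T_1,T_2]$ with $p(t)>0$ and $q(t)\ge 0$ on $[T_1,T_2]$, $m\not\equiv 0$, $n\not\equiv0$, and $Lu:=-[p(t)u']'+q(t)u$. For a function $w$, write $w^\pm:=\max\{\pm w,0\}$; $\mathbb{R}_+=[0,+\infty[$, $\mathbb{R}_-=\,]-\infty,0]$. Consider the problem $$Lu=a\,m(t)u^+-b\,n(t)u^-\ \text{in } ]T_1,T_2[,\qquad u'(T_1)=0=u'(T_2).\qquad(P)$$ For $k\ge0$, $C_k^>$ (resp. $C_k^<$) is the set of $(a,b)\in\mathbb{R}^2$ such that $(P)$ has a nontrivial solution with exactly $k$ zeros in $]T_1,T_2[$ and with $u(T_2)>0$ (resp. $u(T_2)<0$). Put $\Sigma^*:=\bigcup_{k\ge1}(C_k^>\cup C_k^<)$. The number of hyperbolic like curves of $\Sigma^*$ in a quadrant $Q$ is the number of nonempty sets among $C_k^>\cap Q$, $C_k^<\cap Q$, $k\ge1$; curves that coincide (double curves) are counted twice. Each such nonempty set is the graph of a strictly monotone $C^1$-diffeomorphism between two unbounded open intervals, one contained in $\mathbb{R}_{\epsilon_1}$ and the other in $\mathbb{R}_{\epsilon_2}$. *)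

theory Defs
  imports "HOL-Analysis.Analysis"
begin

datatype pm = Plus | Minus

fun pm_val :: "pm \<Rightarrow> real" where
  "pm_val Plus = 1"
| "pm_val Minus = -1"

text \<open>\<open>pm_part Plus w\<close> is $w^+$ and \<open>pm_part Minus w\<close> is $w^-$; both are nonnegative.\<close>

definition pm_part :: "pm \<Rightarrow> (real \<Rightarrow> real) \<Rightarrow> real \<Rightarrow> real" where
  "pm_part e w t = max (pm_val e * w t) 0"

definition pm_halfline :: "pm \<Rightarrow> real set" where
  "pm_halfline e = (case e of Plus \<Rightarrow> {0..} | Minus \<Rightarrow> {..0})"

definition quadrant :: "pm \<Rightarrow> pm \<Rightarrow> (real \<times> real) set" where
  "quadrant e1 e2 = pm_halfline e1 \<times> pm_halfline e2"

definition not_ident_zero :: "real \<Rightarrow> real \<Rightarrow> (real \<Rightarrow> real) \<Rightarrow> bool" where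
  "not_ident_zero T1 T2 w \<longleftrightarrow> (\<exists>t\<in>{T1..T2}. w t \<noteq> 0)"

text \<open>Classical solutions of $(P)$: since \<open>p\<close> is only continuous, \<open>u\<close> is required to be
  continuously differentiable on \<open>{T1..T2}\<close> (one-sided derivatives at the end points) with
  \<open>p u'\<close> differentiable in the open interval.  Here \<open>du\<close> is $u'$ and \<open>dv\<close> is $(pu')'$.\<close>

definition solves_P ::
  "real \<Rightarrow> real \<Rightarrow> (real \<Rightarrow> real) \<Rightarrow> (real \<Rightarrow> real) \<Rightarrow> (real \<Rightarrow> real) \<Rightarrow> (real \<Rightarrow> real)
    \<Rightarrow> real \<Rightarrow> real \<Rightarrow> (real \<Rightarrow> real) \<Rightarrow> bool" where
  "solves_P T1 T2 p q m n a b u \<longleftrightarrow>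
     (\<exists>du dv.
        (\<forall>t\<in>{T1..T2}. (u has_real_derivative du t) (at t within {T1..T2})) \<and>
        continuous_on {T1..T2} du \<and>
        (\<forall>t\<in>{T1<..<T2}. ((\<lambda>s. p s * du s) has_real_derivative dv t) (at t)) \<and>
        (\<forall>t\<in>{T1<..<T2}. - dv t + q t * u t
            = a * m t * pm_part Plus u t - b * n t * pm_part Minus u t) \<and>
        du T1 = 0 \<and> du T2 = 0)"

text \<open>\<open>C_set T1 T2 p q m n Plus k\<close> is $C_k^>$ and \<open>C_set T1 T2 p q m n Minus k\<close> is $C_k^<$.\<close>

definition C_set ::
  "real \<Rightarrow> real \<Rightarrow> (real \<Rightarrow> real) \<Rightarrow> (real \<Rightarrow> real) \<Rightarrow> (real \<Rightarrow> real) \<Rightarrow> (real \<Rightarrow> real)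
    \<Rightarrow> pm \<Rightarrow> nat \<Rightarrow> (real \<times> real) set" where
  "C_set T1 T2 p q m n s k =
     {(a, b). \<exists>u. solves_P T1 T2 p q m n a b u \<and> not_ident_zero T1 T2 u \<and>
        finite {t\<in>{T1<..<T2}. u t = 0} \<and> card {t\<in>{T1<..<T2}. u t = 0} = k \<and>
        (case s of Plus \<Rightarrow> u T2 > 0 | Minus \<Rightarrow> u T2 < 0)}"

definition Sigma_star ::
  "real \<Rightarrow> real \<Rightarrow> (real \<Rightarrow> real) \<Rightarrow> (real \<Rightarrow> real) \<Rightarrow> (real \<Rightarrow> real) \<Rightarrow> (real \<Rightarrow> real)
    \<Rightarrow> (real \<times> real) set" where
  "Sigma_star T1 T2 p q m n =
     (\<Union>k\<in>{1..}. C_set T1 T2 p q m n Plus k \<union> C_set T1 T2 p q m n Minus k)"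

text \<open>The curves are counted through their indices \<open>(s, k)\<close>, not as sets of points, so that
  coinciding curves $C_k^> \cap Q = C_k^< \cap Q$ count twice.\<close>

definition curve_indices ::
  "real \<Rightarrow> real \<Rightarrow> (real \<Rightarrow> real) \<Rightarrow> (real \<Rightarrow> real) \<Rightarrow> (real \<Rightarrow> real) \<Rightarrow> (real \<Rightarrow> real)
    \<Rightarrow> (real \<times> real) set \<Rightarrow> (pm \<times> nat) set" where
  "curve_indices T1 T2 p q m n Q = {(s, k). 1 \<le> k \<and> C_set T1 T2 p q m n s k \<inter> Q \<noteq> {}}"

definition hyperbolic_like :: "pm \<Rightarrow> pm \<Rightarrow> (real \<times> real) set \<Rightarrow> bool" where
  "hyperbolic_like e1 e2 S \<longleftrightarrow>
     (\<exists>I J \<phi>.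
        is_interval I \<and> open I \<and> \<not> bounded I \<and> I \<subseteq> pm_halfline e1 \<and>
        is_interval J \<and> open J \<and> \<not> bounded J \<and> J \<subseteq> pm_halfline e2 \<and>
        bij_betw \<phi> I J \<and>
        (strict_mono_on I \<phi> \<or> strict_antimono_on I \<phi>) \<and>
        \<phi> C1_differentiable_on I \<and> inv_into I \<phi> C1_differentiable_on J \<and>
        S = {(a, \<phi> a) |a. a \<in> I})"

end

theory Submission
  imports Defs
begin

text \<open>Changing the signs of the weights reduces the problem to the first quadrant. With the Pruefer
  angle \<open>\<theta>\<close> of the solution starting at \<open>\<theta> = pi/2\<close>, a point \<open>(a, b)\<close> lies on the curve with \<open>k\<close> zeros
  iff \<open>\<theta>(T2) = pi/2 + k pi\<close>; solutions with negative initial value are covered by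
  exchanging \<open>m\<close> and \<open>n\<close>.

  The angle can pass through a whole arch only if the weight of that arch is positive somewhere in
  between, and for large \<open>a = b\<close> a small interval with positive weight suffices to finish the arch.
  Hence the curve with \<open>k\<close> zeros is nonempty iff there are \<open>k + 1\<close> increasing points at which \<open>m\<close> and \<open>n\<close>
  are alternately positive. The longest alternating sequences starting with \<open>m\<close> and with \<open>n\<close> cannot
  have equal length, and their lengths differ by at most one: this is the dichotomy.

  The curves are smooth because \<open>\<theta>(T2)\<close> has increments \<open>(a' - a) A + (b' - b) B\<close>, where \<open>A\<close> and \<open>B\<close> are continuous,
  and on the curve \<open>a A\<close> and \<open>b B\<close> are, up to a factor, the positive energies of \<open>u\<^sup>+\<close> and \<open>u\<^sup>-\<close>.\<close>

section \<open>Scalar differential inequalities and equations\<close>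

text \<open>The angle counts zeros because it can pass a multiple of \<open>pi\<close> only upwards:
  there its speed is \<open>1 / p t\<close>, whatever the weights are. A solution with
  \<open>k\<close> zeros therefore ends with the sign \<open>(- 1) ^ k\<close> relative to its
  initial sign, so the parity of \<open>k\<close> decides which of the two curves with
  \<open>k\<close> zeros belongs to the order \<open>m, n\<close> and which to \<open>n, m\<close>.

  The obstacle to smoothness is that the positive part is only Lipschitz. In the angle equation it
  occurs as the square of \<open>max 0 (sin \<theta>)\<close>, which is C1. The difference of two
  angles then solves a linear equation whose coefficient, a divided difference, depends continuously
  on both parameter points; variation of constants turns this into the increment formula.

  The weights may change sign, so the signs of \<open>A\<close> and \<open>B\<close> cannot be read
  off their integrands. They come from the energies of the two parts of \<open>u\<close>, which are
  positive because each part is nonconstant as soon as \<open>u\<close> has an interior zero. This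
  is where \<open>k \<ge> 1\<close> enters. Monotonicity of the final angle is thus known only at
  the points of a curve, and the zero set is analysed from this information and the signs on the
  axes.\<close>

lemma DERIV_max0_power2:
  "((\<lambda>x::real. (max 0 x)\<^sup>2) has_real_derivative 2 * max 0 x) (at x)"
proof (cases "x = 0")
  case True
  have "((\<lambda>h. (max 0 h)\<^sup>2 / h) \<longlongrightarrow> 0) (at (0::real))"
  proof (rule Lim_null_comparison)
    show "\<forall>\<^sub>F h in at (0::real). norm ((max 0 h)\<^sup>2 / h) \<le> \<bar>h\<bar>"
      by (auto simp: eventually_at_filter max_def power2_eq_square)
    show "((\<lambda>h. \<bar>h\<bar>) \<longlongrightarrow> 0) (at (0::real))"
      by (intro tendsto_eq_intros) auto
  qed
  then show ?thesis
    using True by (simp add: DERIV_def)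
next
  case False
  show ?thesis
  proof (cases "x > 0")
    case True
    have "((\<lambda>x::real. x\<^sup>2) has_real_derivative 2 * max 0 x) (at x)"
      using True by (auto intro!: derivative_eq_intros)
    then show ?thesis
      by (rule has_field_derivative_transform_within_open[where S="{0<..}"]) (use True in auto)
  next
    case False
    with \<open>x \<noteq> 0\<close> have "x < 0" by simp
    have "((\<lambda>x::real. 0) has_real_derivative 2 * max 0 x) (at x)"
      using \<open>x < 0\<close> by (auto intro!: derivative_eq_intros)
    then show ?thesis
      by (rule has_field_derivative_transform_within_open[where S="{..<0}"]) (use \<open>x < 0\<close> in auto)
  qed
qed

text \<open>The integrating factor is at most 1, so after multiplication the derivative is bounded
  by \<open>c\<close> itself. Only derivatives in the open interval enter, because the equation of
  the problem holds there.\<close>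

lemma gronwall_le:
  fixes y y' :: "real \<Rightarrow> real"
  assumes ab: "a \<le> b" and cont: "continuous_on {a..b} y"
    and der: "\<And>t. a < t \<Longrightarrow> t < b \<Longrightarrow> (y has_real_derivative y' t) (at t)"
    and le: "\<And>t. a < t \<Longrightarrow> t < b \<Longrightarrow> y' t \<le> K * y t + c"
    and K: "0 \<le> K" and c: "0 \<le> c"
  shows "y b \<le> (y a + c * (b - a)) * exp (K * (b - a))"
proof -
  define w where "w = (\<lambda>t. exp (- (K * (t - a))) * y t - c * (t - a))"
  have "w b \<le> w a"
  proof (rule DERIV_nonpos_imp_decreasing_open[OF ab])
    fix t assume t: "a < t" "t < b"
    have d: "(w has_real_derivative exp (- (K * (t - a))) * (y' t - K * y t) - c) (at t)"
      unfolding w_def by (rule derivative_eq_intros der[OF t] refl | simp add: algebra_simps)+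
    have "exp (- (K * (t - a))) * (y' t - K * y t) \<le> exp (- (K * (t - a))) * c"
      using le[OF t] by (intro mult_left_mono) auto
    also have "\<dots> \<le> 1 * c"
      using K t c by (intro mult_right_mono) auto
    finally show "\<exists>v. (w has_real_derivative v) (at t) \<and> v \<le> 0"
      using d by auto
  next
    show "continuous_on {a..b} w"
      unfolding w_def by (intro continuous_intros cont)
  qed
  then have "exp (- (K * (b - a))) * y b \<le> y a + c * (b - a)"
    by (simp add: w_def)
  then have "y b / exp (K * (b - a)) \<le> y a + c * (b - a)"
    by (simp add: exp_minus divide_inverse mult.commute)
  then show ?thesis
    by (simp add: pos_divide_le_eq)
qed

text \<open>The square of the negative part of \<open>z\<close> is differentiable despite the
  corner, starts at 0 and satisfies a homogeneous Gronwall inequality.\<close>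

lemma nonneg_persistent:
  fixes z z' :: "real \<Rightarrow> real"
  assumes ab: "a \<le> b" and cont: "continuous_on {a..b} z"
    and der: "\<And>t. a < t \<Longrightarrow> t < b \<Longrightarrow> (z has_real_derivative z' t) (at t)"
    and ge: "\<And>t. a < t \<Longrightarrow> t < b \<Longrightarrow> z' t \<ge> - (K * \<bar>z t\<bar>)"
    and K: "0 \<le> K" and z0: "z a \<ge> 0"
  shows "z b \<ge> 0"
proof -
  define y where "y = (\<lambda>t. (max 0 (- z t))\<^sup>2)"
  have "y b \<le> (y a + 0 * (b - a)) * exp ((2 * K) * (b - a))"
  proof (rule gronwall_le[where y' = "\<lambda>t. 2 * max 0 (- z t) * (- z' t)"])
    show "continuous_on {a..b} y"
      unfolding y_def by (intro continuous_intros cont)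
    fix t assume t: "a < t" "t < b"
    show "(y has_real_derivative 2 * max 0 (- z t) * (- z' t)) (at t)"
      unfolding y_def
      by (rule DERIV_chain2[OF DERIV_max0_power2]) (intro DERIV_minus der t)
    show "2 * max 0 (- z t) * (- z' t) \<le> 2 * K * y t + 0"
    proof (cases "z t < 0")
      case True
      have "(- z t) * (- z' t) \<le> (- z t) * (K * (- z t))"
        using ge[OF t] True by (intro mult_left_mono) auto
      then show ?thesis
        using True by (simp add: y_def power2_eq_square)
    next
      case False
      then show ?thesis
        using K by (simp add: y_def)
    qed
  qed (use K ab in auto)
  moreover have "y a = 0"
    using z0 by (simp add: y_def)
  ultimately have "y b \<le> 0" by simp
  then have "max 0 (- z b) = 0"
    by (simp add: y_def power2_less_eq_zero_iff)
  then show ?thesis by simp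
qed

text \<open>Once \<open>z\<close> is known to be nonnegative, the absolute value disappears and
  \<open>exp (K * (t - a)) * z t\<close> is nondecreasing.\<close>

lemma pos_persistent:
  fixes z z' :: "real \<Rightarrow> real"
  assumes ab: "a \<le> b" and cont: "continuous_on {a..b} z"
    and der: "\<And>t. a < t \<Longrightarrow> t < b \<Longrightarrow> (z has_real_derivative z' t) (at t)"
    and ge: "\<And>t. a < t \<Longrightarrow> t < b \<Longrightarrow> z' t \<ge> - (K * \<bar>z t\<bar>)"
    and K: "0 \<le> K" and z0: "z a > 0"
  shows "z b > 0"
proof -
  have nn: "z t \<ge> 0" if "t \<in> {a..b}" for t
    by (rule nonneg_persistent[where a=a and z'=z' and K=K])
      (use that K z0 in \<open>auto intro!: der ge intro: continuous_on_subset[OF cont]\<close>)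
  have "exp (K * (a - a)) * z a \<le> exp (K * (b - a)) * z b"
  proof (rule DERIV_nonneg_imp_increasing_open[OF ab])
    fix t assume t: "a < t" "t < b"
    have "((\<lambda>t. exp (K * (t - a)) * z t) has_real_derivative exp (K * (t - a)) * (z' t + K * z t)) (at t)"
      by (rule derivative_eq_intros der[OF t] refl | simp add: algebra_simps)+
    moreover have "z' t + K * z t \<ge> 0"
      using ge[OF t] nn[of t] t by simp
    ultimately show "\<exists>v. ((\<lambda>t. exp (K * (t - a)) * z t) has_real_derivative v) (at t) \<and> v \<ge> 0"
      by (meson exp_ge_zero mult_nonneg_nonneg)
  qed (intro continuous_intros cont)
  then have "0 < exp (K * (b - a)) * z b"
    using z0 by simp
  then show ?thesis
    by (simp add: zero_less_mult_iff)
qed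

text \<open>With the strict inequality the exponentially weighted function is strictly increasing,
  so \<open>z\<close> leaves the value 0 at once. This is the situation of an angle starting exactly
  at a multiple of \<open>pi\<close>.\<close>

lemma pos_persistent_strict:
  fixes z z' :: "real \<Rightarrow> real"
  assumes ab: "a < b" and cont: "continuous_on {a..b} z"
    and der: "\<And>t. a < t \<Longrightarrow> t < b \<Longrightarrow> (z has_real_derivative z' t) (at t)"
    and gt: "\<And>t. a < t \<Longrightarrow> t < b \<Longrightarrow> z' t > - (K * \<bar>z t\<bar>)"
    and K: "0 \<le> K" and z0: "z a \<ge> 0"
  shows "z b > 0"
proof -
  have nn: "z t \<ge> 0" if "t \<in> {a..b}" for t
    by (rule nonneg_persistent[where a=a and z'=z' and K=K])
      (use that K z0 in \<open>auto intro!: der less_imp_le[OF gt] intro: continuous_on_subset[OF cont]\<close>)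
  have "exp (K * (a - a)) * z a < exp (K * (b - a)) * z b"
  proof (rule DERIV_pos_imp_increasing_open[OF ab])
    fix t assume t: "a < t" "t < b"
    have "((\<lambda>t. exp (K * (t - a)) * z t) has_real_derivative exp (K * (t - a)) * (z' t + K * z t)) (at t)"
      by (rule derivative_eq_intros der[OF t] refl | simp add: algebra_simps)+
    moreover have "z' t + K * z t > 0"
      using gt[OF t] nn[of t] t by simp
    ultimately show "\<exists>v. ((\<lambda>t. exp (K * (t - a)) * z t) has_real_derivative v) (at t) \<and> v > 0"
      by (meson exp_gt_zero mult_pos_pos)
  qed (intro continuous_intros cont)
  then have "0 < exp (K * (b - a)) * z b"
    using z0 by simp
  then show ?thesis
    by (simp add: zero_less_mult_iff)
qed

text \<open>Banach's fixed point theorem on the whole interval at once: the unknown \<open>z\<close>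
  is the solution divided by \<open>exp (L * (s - T1))\<close> (Bielecki's weight), which makes the
  Picard operator a contraction whatever the length of the interval.\<close>

lemma ode_solution_exists:
  fixes h :: "real \<Rightarrow> real \<Rightarrow> real"
  assumes T: "T1 < T2"
    and cont: "continuous_on ({T1..T2} \<times> UNIV) (\<lambda>(t, x). h t x)"
    and lip: "\<And>t x y. t \<in> {T1..T2} \<Longrightarrow> \<bar>h t x - h t y\<bar> \<le> K * \<bar>x - y\<bar>"
  shows "\<exists>\<theta>. \<theta> T1 = x0 \<and>
    (\<forall>t\<in>{T1..T2}. (\<theta> has_real_derivative h t (\<theta> t)) (at t within {T1..T2}))"
proof -
  \<comment> \<open>\<open>M\<close> is positive even if \<open>K\<close> is not, and
    \<open>L = 2 * M\<close> makes the contraction factor \<open>M / L\<close> equal to 1/2.\<close>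
  define M where "M = max K 1"
  define L where "L = 2 * M"
  have M: "M > 0" and L: "L > 0" by (auto simp: M_def L_def)
  have lipM: "\<bar>h t x - h t y\<bar> \<le> M * \<bar>x - y\<bar>" if "t \<in> {T1..T2}" for t x y
    using lip[OF that, of x y] mult_right_mono[of K M "\<bar>x - y\<bar>"] by (simp add: M_def)
  \<comment> \<open>The complete space at hand consists of bounded continuous functions on the whole
    line; clamping the argument extends functions on \<open>{T1..T2}\<close> to it by
    constants.\<close>
  define cl where "cl = (\<lambda>t. max T1 (min T2 t))"
  have cl_in: "cl t \<in> {T1..T2}" for t using T by (auto simp: cl_def)
  have cl_cont: "continuous_on UNIV cl" unfolding cl_def by (intro continuous_intros)
  have hc: "continuous_on {T1..T2} (\<lambda>s. h s (y s))" if "continuous_on {T1..T2} y" for y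
  proof -
    have "continuous_on {T1..T2} (\<lambda>s. case (s, y s) of (t, x) \<Rightarrow> h t x)"
      by (rule continuous_on_compose2[OF cont]) (use that in \<open>auto intro!: continuous_intros\<close>)
    then show ?thesis by simp
  qed
  define I where "I = (\<lambda>(z::real \<Rightarrow>\<^sub>C real) s. h s (exp (L * (s - T1)) * z s))"
  have Ic: "continuous_on {T1..T2} (I z)" for z
    unfolding I_def by (intro hc continuous_intros) auto
  have Iint: "I z integrable_on {T1..t}" if "t \<in> {T1..T2}" for z t
    by (rule integrable_continuous_real) (use that in \<open>auto intro: continuous_on_subset[OF Ic]\<close>)
  define H where "H = (\<lambda>z t. exp (- (L * (t - T1))) * (x0 + integral {T1..t} (I z)))"
  have Hc: "continuous_on {T1..T2} (H z)" for z
    unfolding H_def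
    by (intro continuous_intros indefinite_integral_continuous_1 Iint) (use T in auto)
  define P where "P = (\<lambda>z. Bcontfun (\<lambda>t. H z (cl t)))"
  have Pb: "(\<lambda>t. H z (cl t)) \<in> bcontfun" for z
    unfolding bcontfun_def
  proof (intro CollectI conjI)
    show "continuous_on UNIV (\<lambda>t. H z (cl t))"
      by (rule continuous_on_compose2[OF Hc cl_cont]) (use cl_in in auto)
    have "compact (H z ` {T1..T2})" by (intro compact_continuous_image Hc) auto
    then have "bounded (H z ` {T1..T2})" by (rule compact_imp_bounded)
    then show "bounded (range (\<lambda>t. H z (cl t)))"
      by (rule bounded_subset) (use cl_in in auto)
  qed
  have Pap: "apply_bcontfun (P z) t = H z (cl t)" for z t
    unfolding P_def by (simp add: Bcontfun_inverse[OF Pb])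
  have contr: "dist (P z) (P w) \<le> (1/2) * dist z w" for z w
  proof (rule dist_bound)
    fix u
    define t where "t = cl u"
    have t: "t \<in> {T1..T2}" unfolding t_def by (rule cl_in)
    have expint: "((\<lambda>s. M * dist z w * exp (L * (s - T1))) has_integral
        (M * dist z w * exp (L * (t - T1)) / L - M * dist z w * exp (L * (T1 - T1)) / L)) {T1..t}"
      using t L by (intro fundamental_theorem_of_calculus)
        (auto intro!: derivative_eq_intros simp: has_real_derivative_iff_has_vector_derivative[symmetric])
    have "norm (integral {T1..t} (\<lambda>s. I z s - I w s)) \<le> integral {T1..t} (\<lambda>s. M * dist z w * exp (L * (s - T1)))"
    proof (rule integral_norm_bound_integral)
      show "(\<lambda>s. I z s - I w s) integrable_on {T1..t}" by (intro integrable_diff Iint t)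
      show "(\<lambda>s. M * dist z w * exp (L * (s - T1))) integrable_on {T1..t}"
        using expint by blast
      fix s assume s: "s \<in> {T1..t}"
      have "\<bar>I z s - I w s\<bar> \<le> M * \<bar>exp (L * (s - T1)) * z s - exp (L * (s - T1)) * w s\<bar>"
        unfolding I_def using s t by (intro lipM) auto
      also have "\<dots> = M * exp (L * (s - T1)) * dist (z s) (w s)"
        by (simp add: dist_real_def abs_mult flip: right_diff_distrib)
      also have "\<dots> \<le> M * exp (L * (s - T1)) * dist z w"
        using M by (intro mult_left_mono dist_bounded) auto
      finally show "norm (I z s - I w s) \<le> M * dist z w * exp (L * (s - T1))"
        by (simp add: mult_ac)
    qed
    also have "\<dots> \<le> M * dist z w * exp (L * (t - T1)) / L"
      using integral_unique[OF expint] L M by simp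
    finally have b: "\<bar>integral {T1..t} (I z) - integral {T1..t} (I w)\<bar> \<le> (1/2) * dist z w * exp (L * (t - T1))"
      using M by (simp add: integral_diff[OF Iint[OF t] Iint[OF t], symmetric] L_def field_simps)
    have "dist (H z t) (H w t) = exp (- (L * (t - T1))) * \<bar>integral {T1..t} (I z) - integral {T1..t} (I w)\<bar>"
      by (simp add: H_def dist_real_def abs_mult flip: right_diff_distrib)
    also have "\<dots> \<le> exp (- (L * (t - T1))) * ((1/2) * dist z w * exp (L * (t - T1)))"
      using b by (intro mult_left_mono) auto
    also have "\<dots> = (1/2) * dist z w" by (simp add: exp_minus)
    finally show "dist (P z u) (P w u) \<le> (1/2) * dist z w"
      by (simp add: Pap t_def)
  qed
  obtain z where z: "P z = z"
    using banach_fix_type[of "1/2" P] contr by auto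
  define \<theta> where "\<theta> = (\<lambda>t. exp (L * (t - T1)) * z t)"
  have \<theta>: "\<theta> t = x0 + integral {T1..t} (\<lambda>s. h s (\<theta> s))" if "t \<in> {T1..T2}" for t
  proof -
    have "cl t = t" using that by (auto simp: cl_def)
    then have "z t = H z t" using Pap[of z t] z by simp
    then show ?thesis by (simp add: \<theta>_def H_def I_def exp_minus)
  qed
  have c: "continuous_on {T1..T2} (\<lambda>s. h s (\<theta> s))"
    unfolding \<theta>_def by (intro hc continuous_intros) auto
  have "(\<theta> has_real_derivative h t (\<theta> t)) (at t within {T1..T2})" if t: "t \<in> {T1..T2}" for t
  proof -
    have "((\<lambda>t. x0 + integral {T1..t} (\<lambda>s. h s (\<theta> s))) has_real_derivative h t (\<theta> t)) (at t within {T1..T2})"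
      by (rule derivative_eq_intros integral_has_real_derivative[OF c t] refl | simp)+
    then show ?thesis
      by (rule has_field_derivative_transform_within[where d = 1]) (use t \<theta> in auto)
  qed
  then show ?thesis using \<theta>[of T1] T by auto
qed

section \<open>The angle equation\<close>

text \<open>In polar coordinates this is the square of the positive part of \<open>u\<close> divided
  by r^2; at \<open>- x\<close> it is that of the negative part.\<close>

definition spos :: "real \<Rightarrow> real" where
  "spos x = (max 0 (sin x))\<^sup>2"

definition dspos :: "real \<Rightarrow> real" where
  "dspos x = 2 * max 0 (sin x) * cos x"

lemma DERIV_spos: "(spos has_real_derivative dspos x) (at x)"
  unfolding spos_def [abs_def] dspos_def
  by (rule DERIV_chain2[OF DERIV_max0_power2]) (rule DERIV_sin)

lemma continuous_on_spos [continuous_intros]: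
  fixes f :: "'a::t2_space \<Rightarrow> real"
  shows "continuous_on S f \<Longrightarrow> continuous_on S (\<lambda>x. spos (f x))"
  unfolding spos_def by (intro continuous_intros continuous_on_sin) auto

lemma continuous_on_dspos [continuous_intros]:
  fixes f :: "'a::t2_space \<Rightarrow> real"
  shows "continuous_on S f \<Longrightarrow> continuous_on S (\<lambda>x. dspos (f x))"
  unfolding dspos_def by (intro continuous_intros) auto

lemma spos_nonneg: "0 \<le> spos x"
  and spos_le_1: "spos x \<le> 1"
  unfolding spos_def by (auto simp: max_def power2_eq_square mult_le_one abs_square_le_1)

lemma spos_minus_pi: "spos (x - pi) = spos (- x)" "spos (- (x - pi)) = spos x"
  by (simp_all add: spos_def)

lemma spos_add_spos_minus: "spos x + spos (- x) = (sin x)\<^sup>2"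
  by (simp add: spos_def max_def)

lemma abs_dspos_le: "\<bar>dspos x\<bar> \<le> 2"
proof -
  have "\<bar>max 0 (sin x)\<bar> * \<bar>cos x\<bar> \<le> 1 * 1"
    by (intro mult_mono) (auto simp: max_def)
  then show ?thesis by (simp add: dspos_def abs_mult)
qed

text \<open>Written as an integral, the divided difference is continuous also on the diagonal.\<close>

definition dd_spos :: "real \<Rightarrow> real \<Rightarrow> real" where
  "dd_spos x y = integral {0..1} (\<lambda>\<tau>. dspos (x + \<tau> * (y - x)))"

lemma spos_diff: "spos y - spos x = (y - x) * dd_spos x y"
proof -
  have "((\<lambda>\<tau>. (y - x) * dspos (x + \<tau> * (y - x))) has_integral
      (spos (x + 1 * (y - x)) - spos (x + 0 * (y - x)))) {0..1}"
  proof (rule fundamental_theorem_of_calculus)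
    fix \<tau> :: real
    have "((\<lambda>\<tau>. spos (x + \<tau> * (y - x))) has_real_derivative dspos (x + \<tau> * (y - x)) * (y - x)) (at \<tau> within {0..1})"
      by (rule DERIV_chain2[OF DERIV_spos]) (auto intro!: derivative_eq_intros)
    then show "((\<lambda>\<tau>. spos (x + \<tau> * (y - x))) has_vector_derivative (y - x) * dspos (x + \<tau> * (y - x))) (at \<tau> within {0..1})"
      by (simp add: has_real_derivative_iff_has_vector_derivative mult.commute)
  qed simp
  then show ?thesis
    unfolding dd_spos_def by (simp add: integral_unique flip: integral_mult_right)
qed

lemma dd_spos_same [simp]: "dd_spos x x = dspos x"
  by (simp add: dd_spos_def)

lemma abs_dd_spos_le: "\<bar>dd_spos x y\<bar> \<le> 2"
proof -
  have "norm (dd_spos x y) \<le> 2 * (1 - 0)"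
    unfolding dd_spos_def
    by (rule integral_bound) (auto intro!: continuous_intros simp: abs_dspos_le)
  then show ?thesis by simp
qed

lemma continuous_on_dd_spos_UNIV: "continuous_on UNIV (\<lambda>z. dd_spos (fst z) (snd z))"
proof -
  have "continuous_on UNIV (\<lambda>z::real\<times>real. integral (cbox 0 1) ((\<lambda>z \<tau>. dspos (fst z + \<tau> * (snd z - fst z))) z))"
    by (rule integral_continuous_on_param) (simp add: case_prod_unfold, intro continuous_intros)
  then show ?thesis by (simp add: dd_spos_def)
qed

lemma continuous_on_dd_spos [continuous_intros]:
  fixes f :: "'a::t2_space \<Rightarrow> real"
  shows "continuous_on S f \<Longrightarrow> continuous_on S g \<Longrightarrow> continuous_on S (\<lambda>x. dd_spos (f x) (g x))"
  using continuous_on_compose2[OF continuous_on_dd_spos_UNIV, of S "\<lambda>x. (f x, g x)"]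
  by (simp add: continuous_on_Pair)

locale neumann_data =
  fixes T1 T2 :: real and p q :: "real \<Rightarrow> real"
  assumes T: "T1 < T2"
    and p_cont: "continuous_on {T1..T2} p" and q_cont: "continuous_on {T1..T2} q"
    and p_pos: "\<And>t. t \<in> {T1..T2} \<Longrightarrow> p t > 0"
    and q_nonneg: "\<And>t. t \<in> {T1..T2} \<Longrightarrow> q t \<ge> 0"
begin

text \<open>Pruefer angle: \<open>u = r sin \<theta>\<close> and \<open>p u' = r cos \<theta>\<close> turn
  \<open>-(p u')' + q u = f u\<^sup>+ - g u\<^sup>-\<close> into \<open>\<theta>' = rhs f g t \<theta>\<close>.\<close>

definition rhs :: "(real \<Rightarrow> real) \<Rightarrow> (real \<Rightarrow> real) \<Rightarrow> real \<Rightarrow> real \<Rightarrow> real" where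
  "rhs f g t x = (cos x)\<^sup>2 / p t - q t * (sin x)\<^sup>2 + f t * spos x + g t * spos (- x)"

text \<open>Eliminating the squares of cosine and sine in favour of \<open>spos\<close> isolates
  \<open>1 / p t\<close>, the speed at multiples of \<open>pi\<close>, and leaves only terms that
  admit divided differences.\<close>

lemma rhs_alt:
  assumes "t \<in> {T1..T2}"
  shows "rhs f g t x = 1 / p t + (f t - q t - 1 / p t) * spos x + (g t - q t - 1 / p t) * spos (- x)"
  unfolding rhs_def cos_squared_eq spos_add_spos_minus[of x, symmetric] diff_divide_distrib add_divide_distrib
  by (simp add: algebra_simps)

text \<open>The factor \<open>y - x\<close> splits off exactly, so the difference of two angles
  satisfies a linear equation. The minus sign comes from \<open>(- y) - (- x)\<close>.\<close>

lemma rhs_diff: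
  assumes "t \<in> {T1..T2}"
  shows "rhs f g t y - rhs f g t x =
    ((f t - q t - 1 / p t) * dd_spos x y - (g t - q t - 1 / p t) * dd_spos (- x) (- y)) * (y - x)"
proof -
  have "rhs f g t y - rhs f g t x = (f t - q t - 1 / p t) * (spos y - spos x)
      + (g t - q t - 1 / p t) * (spos (- y) - spos (- x))"
    unfolding rhs_alt[OF assms] right_diff_distrib by simp
  then show ?thesis
    unfolding spos_diff[of y x] spos_diff[of "- y" "- x"] by (simp add: algebra_simps diff_divide_distrib)
qed

lemma inv_p_cont: "continuous_on {T1..T2} (\<lambda>t. 1 / p t)"
  by (intro continuous_intros p_cont) (metis less_irrefl p_pos)

lemma rhs_cont:
  fixes h k :: "'a::t2_space \<Rightarrow> real"
  assumes "continuous_on {T1..T2} f" "continuous_on {T1..T2} g" "continuous_on S h" "continuous_on S k" "h ` S \<subseteq> {T1..T2}"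
  shows "continuous_on S (\<lambda>z. rhs f g (h z) (k z))"
proof -
  have c: "continuous_on S (\<lambda>z. w (h z))" if "continuous_on {T1..T2} w" for w
    by (rule continuous_on_compose2[OF that assms(3,5)])
  have "p (h z) \<noteq> 0" if "z \<in> S" for z
    using p_pos[of "h z"] assms(5) that by fastforce
  then show ?thesis
    unfolding rhs_def
    by (intro continuous_intros c assms p_cont q_cont) auto
qed

text \<open>Stated for the divided difference rather than for \<open>rhs\<close>: the bound serves
  both as a Lipschitz constant and as a bound for the coefficient of the linear equation between two
  angles.\<close>

lemma rhs_lipschitz:
  assumes f: "continuous_on {T1..T2} f" and g: "continuous_on {T1..T2} g"
  obtains K where "K \<ge> 0" "\<And>t x y. t \<in> {T1..T2} \<Longrightarrow>
     \<bar>(f t - q t - 1 / p t) * dd_spos x y - (g t - q t - 1 / p t) * dd_spos (- x) (- y)\<bar> \<le> K"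
proof -
  have "bounded ((\<lambda>t. \<bar>f t - q t - 1 / p t\<bar> + \<bar>g t - q t - 1 / p t\<bar>) ` {T1..T2})"
    by (intro compact_imp_bounded compact_continuous_image continuous_on_add continuous_on_rabs
      continuous_on_diff f g q_cont inv_p_cont) auto
  then obtain M where M: "\<And>t. t \<in> {T1..T2} \<Longrightarrow> \<bar>f t - q t - 1 / p t\<bar> + \<bar>g t - q t - 1 / p t\<bar> \<le> M"
    unfolding bounded_iff by fastforce
  have "M \<ge> 0" using M[of T1] T by force
  moreover have "\<bar>(f t - q t - 1 / p t) * dd_spos x y - (g t - q t - 1 / p t) * dd_spos (- x) (- y)\<bar> \<le> 2 * M"
    if t: "t \<in> {T1..T2}" for t x y
  proof -
    have "\<bar>(f t - q t - 1 / p t) * dd_spos x y - (g t - q t - 1 / p t) * dd_spos (- x) (- y)\<bar>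
      \<le> \<bar>f t - q t - 1 / p t\<bar> * \<bar>dd_spos x y\<bar> + \<bar>g t - q t - 1 / p t\<bar> * \<bar>dd_spos (- x) (- y)\<bar>"
      by (metis abs_mult abs_triangle_ineq4)
    also have "\<dots> \<le> \<bar>f t - q t - 1 / p t\<bar> * 2 + \<bar>g t - q t - 1 / p t\<bar> * 2"
      by (intro add_mono mult_left_mono abs_dd_spos_le) auto
    finally show ?thesis using M[OF t] by simp
  qed
  ultimately show ?thesis by (intro that[of "2 * M"]) auto
qed

definition angle_sol :: "(real \<Rightarrow> real) \<Rightarrow> (real \<Rightarrow> real) \<Rightarrow> (real \<Rightarrow> real) \<Rightarrow> bool" where
  "angle_sol f g \<theta> \<longleftrightarrow> (\<forall>t\<in>{T1..T2}. (\<theta> has_real_derivative rhs f g t (\<theta> t)) (at t within {T1..T2}))"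

lemma angle_solD_at:
  assumes "angle_sol f g \<theta>" "T1 < t" "t < T2"
  shows "(\<theta> has_real_derivative rhs f g t (\<theta> t)) (at t)"
  using assms at_within_Icc_at[of T1 t T2] by (metis angle_sol_def atLeastAtMost_iff less_imp_le)

lemma angle_sol_cont:
  assumes "angle_sol f g \<theta>" shows "continuous_on {T1..T2} \<theta>"
  using assms unfolding angle_sol_def
  by (meson DERIV_continuous continuous_on_eq_continuous_within)

lemma angle_sol_cont_sub:
  assumes "angle_sol f g \<theta>" "T1 \<le> c" "d \<le> T2" shows "continuous_on {c..d} \<theta>"
  by (rule continuous_on_subset[OF angle_sol_cont[OF assms(1)]]) (use assms in auto)

text \<open>A half turn replaces \<open>u\<close> by \<open>- u\<close> and so exchanges the two
  weights. Arguments about a single arch can thereby be iterated along the angle.\<close>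

lemma angle_sol_shift_pi:
  assumes "angle_sol f g \<theta>"
  shows "angle_sol g f (\<lambda>t. \<theta> t - pi)"
proof -
  have "rhs g f t (x - pi) = rhs f g t x" for t x
    by (simp add: rhs_def spos_def)
  then show ?thesis
    using assms unfolding angle_sol_def
    by (auto intro!: derivative_eq_intros)
qed

lemma angle_sol_exists:
  assumes f: "continuous_on {T1..T2} f" and g: "continuous_on {T1..T2} g"
  shows "\<exists>\<theta>. \<theta> T1 = x0 \<and> angle_sol f g \<theta>"
proof -
  obtain K where K: "\<And>t x y. t \<in> {T1..T2} \<Longrightarrow>
     \<bar>(f t - q t - 1 / p t) * dd_spos x y - (g t - q t - 1 / p t) * dd_spos (- x) (- y)\<bar> \<le> K"
    using rhs_lipschitz[OF f g] by metis
  show ?thesis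
    unfolding angle_sol_def
  proof (rule ode_solution_exists[OF T, where K = K])
    show "continuous_on ({T1..T2} \<times> UNIV) (\<lambda>(t, x). rhs f g t x)"
      unfolding case_prod_unfold
      by (intro rhs_cont f g continuous_intros) auto
    show "\<bar>rhs f g t x - rhs f g t y\<bar> \<le> K * \<bar>x - y\<bar>" if "t \<in> {T1..T2}" for t x y
      using K[OF that, of y x] by (simp add: rhs_diff[OF that] abs_mult mult_right_mono)
  qed
qed

definition angle :: "(real \<Rightarrow> real) \<Rightarrow> (real \<Rightarrow> real) \<Rightarrow> real \<Rightarrow> real" where
  "angle f g = (SOME \<theta>. \<theta> T1 = pi / 2 \<and> angle_sol f g \<theta>)"

lemma
  assumes "continuous_on {T1..T2} f" and "continuous_on {T1..T2} g"
  shows angle_T1: "angle f g T1 = pi / 2"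
    and angle_sol_angle: "angle_sol f g (angle f g)"
  using someI_ex[OF angle_sol_exists[OF assms, of "pi / 2"]] unfolding angle_def by auto

text \<open>At \<open>i * pi\<close> the right-hand side equals \<open>1 / p t > 0\<close>, and
  nearby it differs from this by at most \<open>K\<close> times the distance. The distance thus
  satisfies the hypothesis of \<open>pos_persistent_strict\<close>.\<close>

lemma angle_above_multiple_pi:
  fixes i :: int
  assumes f: "continuous_on {T1..T2} f" and g: "continuous_on {T1..T2} g"
    and sol: "angle_sol f g \<theta>" and c: "T1 \<le> c" "c < d" "d \<le> T2"
    and ge: "\<theta> c \<ge> i * pi"
  shows "\<theta> d > i * pi"
proof -
  obtain K where K: "K \<ge> 0" "\<And>t x y. t \<in> {T1..T2} \<Longrightarrow>
     \<bar>(f t - q t - 1 / p t) * dd_spos x y - (g t - q t - 1 / p t) * dd_spos (- x) (- y)\<bar> \<le> K"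
    using rhs_lipschitz[OF f g] by metis
  have s: "sin (i * pi) = 0" by (simp add: sin_zero_iff_int2)
  have "\<theta> d - i * pi > 0"
  proof (rule pos_persistent_strict[where K = K and a = c and b = d and z = "\<lambda>t. \<theta> t - i * pi"
        and z' = "\<lambda>t. rhs f g t (\<theta> t)"])
    show "continuous_on {c..d} (\<lambda>t. \<theta> t - i * pi)"
      by (intro continuous_intros angle_sol_cont_sub[OF sol]) (use c in auto)
    fix t assume t: "c < t" "t < d"
    then have tin: "t \<in> {T1..T2}" using c by auto
    show "((\<lambda>t. \<theta> t - i * pi) has_real_derivative rhs f g t (\<theta> t)) (at t)"
      using angle_solD_at[OF sol, of t] t c by (auto intro!: derivative_eq_intros)
    have "rhs f g t (i * pi) = 1 / p t"
      using s by (simp add: rhs_alt[OF tin] spos_def)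
    then have "rhs f g t (\<theta> t) = 1 / p t + (rhs f g t (\<theta> t) - rhs f g t (i * pi))" by simp
    moreover have "\<bar>rhs f g t (\<theta> t) - rhs f g t (i * pi)\<bar> \<le> K * \<bar>\<theta> t - i * pi\<bar>"
      using K(2)[OF tin] by (simp add: rhs_diff[OF tin] abs_mult mult_right_mono)
    moreover have "1 / p t > 0" using p_pos[OF tin] by simp
    ultimately show "rhs f g t (\<theta> t) > - (K * \<bar>\<theta> t - i * pi\<bar>)" by linarith
  qed (use K ge c in auto)
  then show ?thesis by simp
qed

end

section \<open>Alternating points of positivity\<close>

text \<open>The recursion removes the leftmost point and exchanges the weights, which mirrors the
  passage from one arch to the next, where the solution changes sign. All points lie strictly
  between \<open>c\<close> and \<open>T\<close>.\<close>

fun alternates :: "real \<Rightarrow> (real \<Rightarrow> real) \<Rightarrow> (real \<Rightarrow> real) \<Rightarrow> nat \<Rightarrow> real \<Rightarrow> bool" where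
  "alternates T w w' 0 c \<longleftrightarrow> True"
| "alternates T w w' (Suc n) c \<longleftrightarrow> (\<exists>x>c. x < T \<and> w x > 0 \<and> alternates T w' w n x)"

lemma alternates_mono:
  assumes "alternates T w w' n d" "c \<le> d"
  shows "alternates T w w' n c"
proof (cases n)
  case 0
  show ?thesis unfolding 0 by (rule alternates.simps(1)[THEN iffD2, OF TrueI])
next
  case (Suc k)
  from assms(1) obtain x where x: "x > d" "x < T" "w x > 0" "alternates T w' w k x"
    unfolding Suc alternates.simps by blast
  have "c < x" using assms(2) x(1) by linarith
  show ?thesis
    unfolding Suc alternates.simps(2)
    by (intro exI[of _ x] conjI \<open>c < x\<close> x)
qed

text \<open>Strips the parameters from the weights: a nonnegative factor cannot create
  positivity.\<close>

lemma alternates_scaleD: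
  fixes a b :: real
  assumes "a \<ge> 0" "b \<ge> 0" "alternates T (\<lambda>t. a * w t) (\<lambda>t. b * w' t) n c"
  shows "alternates T w w' n c"
  using assms
proof (induction n arbitrary: a b w w' c)
  case (Suc n)
  from Suc.prems(3) obtain x where x: "x > c" "x < T" "a * w x > 0" "alternates T (\<lambda>t. b * w' t) (\<lambda>t. a * w t) n x"
    unfolding alternates.simps by blast
  then have "w x > 0" using Suc.prems(1) by (simp add: zero_less_mult_iff)
  moreover have "alternates T w' w n x"
    by (rule Suc.IH[OF Suc.prems(2,1) x(4)])
  ultimately show ?case using x(1,2) unfolding alternates.simps by blast
qed simp

section \<open>Growth of the angle and alternating points\<close>

context neumann_data
begin

lemma angle_ge_multiple_pi:
  fixes i :: int
  assumes "continuous_on {T1..T2} f" "continuous_on {T1..T2} g"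
    and "angle_sol f g \<theta>" "T1 \<le> c" "c \<le> d" "d \<le> T2" "\<theta> c \<ge> i * pi"
  shows "\<theta> d \<ge> i * pi"
  using angle_above_multiple_pi[OF assms(1-4) _ assms(6,7)] assms(5,7) by (cases "c = d") auto

lemma angle_le_multiple_pi:
  fixes i :: int
  assumes "continuous_on {T1..T2} f" "continuous_on {T1..T2} g"
    and "angle_sol f g \<theta>" "T1 \<le> c" "c \<le> d" "d \<le> T2" "\<theta> d \<le> i * pi"
  shows "\<theta> c \<le> i * pi"
  using angle_above_multiple_pi[OF assms(1-4) _ assms(6), of i] assms(5,7)
  by (cases "c = d"; cases "\<theta> c \<ge> i * pi") auto

text \<open>The function \<open>arctan (cot \<theta> / k)\<close> takes values in an interval of length \<open>pi\<close>, while its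
  derivative is at most \<open>- k / P\<close>.\<close>

lemma angle_exits:
  assumes f: "continuous_on {T1..T2} f" and g: "continuous_on {T1..T2} g"
    and sol: "angle_sol f g \<theta>" and c: "T1 \<le> c" "c < d" "d \<le> T2"
    and ge: "\<theta> c \<ge> 0" and P: "P > 0" "\<And>t. t \<in> {c..d} \<Longrightarrow> p t \<le> P"
    and k: "k > 0" "\<And>t. t \<in> {c..d} \<Longrightarrow> k\<^sup>2 \<le> P * (f t - q t)"
    and long: "(d - c) * k / P > pi"
  shows "\<theta> d \<ge> pi"
proof (rule ccontr)
  assume "\<not> \<theta> d \<ge> pi"
  then have less: "\<theta> d < pi" by simp
  have up: "\<theta> t < pi" if "c \<le> t" "t \<le> d" for t
    using angle_above_multiple_pi[OF f g sol, of t d 1] that c less by force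
  have pos: "\<theta> t > 0" if "c < t" "t \<le> d" for t
    using angle_above_multiple_pi[OF f g sol, of c t 0] that c ge by force
  \<comment> \<open>At \<open>c\<close> the angle may be 0 and its cotangent undefined. Moving
    inside to \<open>c'\<close> spends half of the surplus of \<open>(d - c) * k / P\<close> over
    \<open>pi\<close>, so the remaining interval is still long enough.\<close>
  define c' where "c' = c + ((d - c) * k / P - pi) * P / (2 * k)"
  have c': "c < c'"
    using long P k by (simp add: c'_def)
  have d1: "(d - c') * k / P > pi"
  proof -
    have "(d - c') * k / P = (d - c) * k / P - ((d - c) * k / P - pi) / 2"
      using P(1) k(1) by (simp add: c'_def algebra_simps diff_divide_distrib add_divide_distrib)
    moreover have "u - (u - pi) / 2 > pi" if "u > pi" for u :: real
      using that by (simp add: field_simps)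
    ultimately show ?thesis using long by simp
  qed
  then have c'd: "c' < d"
    using P k by (smt (verit) divide_nonpos_pos mult_nonpos_nonneg pi_gt_zero)
  define y where "y = (\<lambda>t. arctan (cos (\<theta> t) / sin (\<theta> t) / k) + (k / P) * t)"
  have sp: "sin (\<theta> t) > 0" if "c' \<le> t" "t \<le> d" for t
    using up[of t] pos[of t] that c' by (intro sin_gt_zero) auto
  have cont: "continuous_on {c'..d} \<theta>"
    by (rule angle_sol_cont_sub[OF sol]) (use c c' in auto)
  have "y d \<le> y c'"
  proof (rule DERIV_nonpos_imp_decreasing_open[where f = y and a = c' and b = d])
    fix t assume t: "c' < t" "t < d"
    then have tin: "t \<in> {T1..T2}" "t \<in> {c..d}" using c c' by auto
    define r where "r = rhs f g t (\<theta> t)"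
    define s e where "s = sin (\<theta> t)" and "e = cos (\<theta> t)"
    have s: "s > 0" using sp[of t] t by (simp add: s_def)
    have se: "s\<^sup>2 + e\<^sup>2 = 1" by (simp add: s_def e_def)
    have dth: "(\<theta> has_real_derivative r) (at t)"
      unfolding r_def by (rule angle_solD_at[OF sol]) (use t c c' in auto)
    have "((\<lambda>t. cos (\<theta> t) / sin (\<theta> t) / k) has_real_derivative - r / s\<^sup>2 / k) (at t)"
    proof -
      have "((\<lambda>t. cos (\<theta> t) / sin (\<theta> t) / k) has_real_derivative
         ((- s * r) * s - e * (e * r)) / (s * s) / k) (at t)"
        unfolding s_def e_def using s[unfolded s_def]
        by (intro DERIV_cdivide DERIV_divide) (auto intro!: derivative_eq_intros dth simp: mult_ac)
      moreover have "(- s * r) * s - e * (e * r) = - r"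
      proof -
        have "(- s * r) * s - e * (e * r) = - r * (s\<^sup>2 + e\<^sup>2)"
          by (simp add: power2_eq_square algebra_simps)
        then show ?thesis using se by simp
      qed
      ultimately show ?thesis by (simp add: power2_eq_square)
    qed
    then have dcot: "((\<lambda>t. arctan (cos (\<theta> t) / sin (\<theta> t) / k)) has_real_derivative
        inverse (1 + (e / s / k)\<^sup>2) * (- r / s\<^sup>2 / k)) (at t)"
      unfolding s_def e_def by (rule DERIV_chain2[OF DERIV_arctan])
    have dy: "(y has_real_derivative (- r / s\<^sup>2 / k) / (1 + (e / s / k)\<^sup>2) + k / P) (at t)"
      unfolding y_def using DERIV_add[OF dcot DERIV_cmult_Id[of "k / P"]]
      by (simp add: divide_inverse mult.commute)
    have "r = e\<^sup>2 / p t + (f t - q t) * s\<^sup>2"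
      using s unfolding r_def rhs_def s_def e_def by (simp add: spos_def algebra_simps)
    moreover have "e\<^sup>2 / P \<le> e\<^sup>2 / p t"
      using P(2)[OF tin(2)] p_pos[OF tin(1)] by (intro divide_left_mono) auto
    moreover have "k\<^sup>2 / P * s\<^sup>2 \<le> (f t - q t) * s\<^sup>2"
      using k(2)[OF tin(2)] P(1) by (intro mult_right_mono) (auto simp: field_simps)
    ultimately have r: "(e\<^sup>2 + k\<^sup>2 * s\<^sup>2) / P \<le> r"
      by (simp add: add_divide_distrib)
    have pos': "e\<^sup>2 + k\<^sup>2 * s\<^sup>2 > 0" using s k by (simp add: add_nonneg_pos)
    have "(- r / s\<^sup>2 / k) / (1 + (e / s / k)\<^sup>2) = - (r * k / (e\<^sup>2 + k\<^sup>2 * s\<^sup>2))"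
      using s k pos' by (simp add: divide_simps power2_eq_square)
    moreover have "k / P \<le> r * k / (e\<^sup>2 + k\<^sup>2 * s\<^sup>2)"
      using mult_right_mono[OF r, of k] k(1) pos' P by (simp add: pos_le_divide_eq mult.commute)
    ultimately show "\<exists>v. (y has_real_derivative v) (at t) \<and> v \<le> 0"
      using dy by force
  next
    show "continuous_on {c'..d} y"
      unfolding y_def using sp k
      by (intro continuous_intros cont) (auto simp: less_imp_neq[symmetric])
  qed (use c'd in auto)
  moreover have "\<bar>arctan u\<bar> < pi / 2" for u
    using arctan_bounded[of u] by (auto simp: abs_if)
  ultimately have "k / P * d - k / P * c' < pi"
    unfolding y_def by (smt (verit) field_sum_of_halves)
  then show False using d1 by (simp add: algebra_simps diff_divide_distrib)
qed

text \<open>Each point carries an interval to its left on which its weight is bounded below; for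
  large \<open>L\<close> the arch is finished there by \<open>angle_exits\<close>, and the other
  points follow by induction for the angle shifted by \<open>pi\<close>. The bound holds for all
  \<open>L \<ge> L0\<close> and all starting angles \<open>\<theta> c \<ge> 0\<close> so that the
  thresholds of the arches can be combined by a maximum and an arch may end beyond
  \<open>pi\<close>.\<close>

lemma large_weights_angle:
  assumes w: "continuous_on {T1..T2} w" and w': "continuous_on {T1..T2} w'"
    and "alternates T2 w w' n c" "T1 \<le> c" "c \<le> T2"
  shows "\<exists>L0\<ge>0. \<forall>L\<ge>L0. \<forall>\<theta>. angle_sol (\<lambda>t. L * w t) (\<lambda>t. L * w' t) \<theta> \<and> \<theta> c \<ge> 0 \<longrightarrow> \<theta> T2 \<ge> n * pi"
  using assms
proof (induction n arbitrary: w w' c)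
  case 0
  have "\<theta> T2 \<ge> 0" if "angle_sol (\<lambda>t. L * w t) (\<lambda>t. L * w' t) \<theta>" "\<theta> c \<ge> 0" for L \<theta>
  proof -
    have cw: "continuous_on {T1..T2} (\<lambda>t. L * w t)" "continuous_on {T1..T2} (\<lambda>t. L * w' t)"
      by (intro continuous_intros 0)+
    show ?thesis
      using angle_ge_multiple_pi[OF cw that(1), of c T2 0] 0(4,5) that(2) by simp
  qed
  then show ?case unfolding of_nat_0 mult_zero_left by blast
next
  case (Suc n)
  obtain x where x: "x > c" "x < T2" "w x > 0" and alt: "alternates T2 w' w n x"
    using Suc.prems by auto
  obtain L1 where L1: "L1 \<ge> 0" "\<And>L \<theta>. L \<ge> L1 \<Longrightarrow> angle_sol (\<lambda>t. L * w' t) (\<lambda>t. L * w t) \<theta> \<Longrightarrow> \<theta> x \<ge> 0 \<Longrightarrow> \<theta> T2 \<ge> n * pi"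
    using Suc.IH[OF Suc.prems(2,1) alt] x Suc.prems(4) by (auto simp del: alternates.simps)
  have "continuous (at x within {T1..T2}) w"
    using Suc.prems(1) x Suc.prems(4) by (auto simp: continuous_on_eq_continuous_within)
  then obtain d0 where d0: "d0 > 0" "\<And>t. t \<in> {T1..T2} \<Longrightarrow> \<bar>t - x\<bar> < d0 \<Longrightarrow> \<bar>w t - w x\<bar> < w x / 2"
    unfolding continuous_within_eps_delta dist_real_def using half_gt_zero[OF x(3)] by blast
  \<comment> \<open>Clipping at \<open>c\<close> keeps this interval to the right of the point
    belonging to the previous arch.\<close>
  define x' where "x' = max c (x - d0 / 2)"
  have x': "c \<le> x'" "x' < x" using d0 x by (auto simp: x'_def)
  have wge: "w t \<ge> w x / 2" if "t \<in> {x'..x}" for t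
  proof -
    have "t \<in> {T1..T2}" "\<bar>t - x\<bar> < d0"
      using d0(1) that Suc.prems(4,5) x x' by (auto simp: x'_def)
    from d0(2)[OF this] show ?thesis by (simp add: abs_if split: if_splits)
  qed
  obtain P where P: "P > 0" "\<And>t. t \<in> {T1..T2} \<Longrightarrow> p t \<le> P"
  proof -
    have "bounded (p ` {T1..T2})" by (intro compact_imp_bounded compact_continuous_image p_cont) auto
    then obtain P where "\<And>t. t \<in> {T1..T2} \<Longrightarrow> \<bar>p t\<bar> \<le> P"
      by (metis bounded_iff imageI real_norm_def)
    then show thesis by (intro that[of "max P 1"]) (auto simp: abs_le_iff le_max_iff_disj)
  qed
  obtain M where M: "\<And>t. t \<in> {T1..T2} \<Longrightarrow> q t \<le> M"
  proof -
    have "bounded (q ` {T1..T2})" by (intro compact_imp_bounded compact_continuous_image q_cont) auto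
    then obtain M where "\<And>t. t \<in> {T1..T2} \<Longrightarrow> \<bar>q t\<bar> \<le> M"
      by (metis bounded_iff imageI real_norm_def)
    then show thesis by (intro that[of M]) (auto simp: abs_le_iff)
  qed
  \<comment> \<open>With this choice \<open>(x - x') * k / P\<close> is \<open>2 * pi\<close>, which
    exceeds the \<open>pi\<close> required by \<open>angle_exits\<close>.\<close>
  define k where "k = 2 * pi * P / (x - x')"
  have k: "k > 0" "(x - x') * k / P > pi" using P x' by (auto simp: k_def)
  \<comment> \<open>The second entry makes \<open>L * (w x / 2)\<close> at least
    \<open>k\<^sup>2 / P + M\<close>, which absorbs the potential \<open>q \<le> M\<close>.\<close>
  define L0 where "L0 = max L1 ((k\<^sup>2 / P + M) * 2 / w x)"
  have "\<theta> T2 \<ge> Suc n * pi"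
    if L: "L \<ge> L0" and sol: "angle_sol (\<lambda>t. L * w t) (\<lambda>t. L * w' t) \<theta>" and c: "\<theta> c \<ge> 0" for L \<theta>
  proof -
    have cw: "continuous_on {T1..T2} (\<lambda>t. L * w t)" "continuous_on {T1..T2} (\<lambda>t. L * w' t)"
      by (intro continuous_intros Suc.prems)+
    have "L \<ge> 0" using L L1 by (auto simp: L0_def)
    have "\<theta> x' \<ge> 0"
      using angle_ge_multiple_pi[OF cw sol, of c x' 0] c x' Suc.prems(4) x by simp
    have "\<theta> x \<ge> pi"
    proof (rule angle_exits[OF cw sol, where c = x' and P = P and k = k])
      fix t assume t: "t \<in> {x'..x}"
      then have tin: "t \<in> {T1..T2}" using x(2) x'(1) Suc.prems(4) by auto
      have "(k\<^sup>2 / P + M) * 2 / w x \<le> L" using L by (simp add: L0_def)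
      then have "k\<^sup>2 / P + M \<le> L * (w x / 2)" using x by (simp add: field_simps)
      also have "\<dots> \<le> L * w t" using wge[OF t] \<open>L \<ge> 0\<close> by (intro mult_left_mono)
      finally have "k\<^sup>2 / P \<le> L * w t - q t" using M[OF tin] by linarith
      then show "k\<^sup>2 \<le> P * (L * w t - q t)" using P(1) by (simp add: pos_divide_le_eq mult.commute)
      show "p t \<le> P" using P tin by auto
    qed (use x x' Suc.prems(4) P k \<open>\<theta> x' \<ge> 0\<close> in auto)
    then have "\<theta> T2 - pi \<ge> n * pi"
      by (intro L1(2)[of L "\<lambda>t. \<theta> t - pi"] angle_sol_shift_pi[OF sol]) (use L in \<open>auto simp: L0_def\<close>)
    then show ?thesis by (simp add: algebra_simps)
  qed
  then show ?case using L1(1) by (intro exI[of _ L0]) (auto simp: L0_def)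
qed

text \<open>In this range \<open>(cos \<theta>)' \<ge> - (cos \<theta>)\<^sup>2 / p\<close>, so that \<open>cos \<theta>\<close> cannot change sign downwards.\<close>

lemma angle_barrier:
  assumes sol: "angle_sol f g \<theta>" and c: "T1 \<le> c" "c \<le> d" "d \<le> T2"
    and range: "\<And>t. t \<in> {c..d} \<Longrightarrow> 0 \<le> \<theta> t \<and> \<theta> t \<le> pi"
    and f: "\<And>t. c < t \<Longrightarrow> t < d \<Longrightarrow> f t \<le> 0"
  shows "cos (\<theta> c) \<ge> 0 \<Longrightarrow> cos (\<theta> d) \<ge> 0" and "cos (\<theta> c) > 0 \<Longrightarrow> cos (\<theta> d) > 0"
proof -
  have "bounded ((\<lambda>t. 1 / p t) ` {T1..T2})"
    by (intro compact_imp_bounded compact_continuous_image inv_p_cont) auto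
  then obtain K where K: "\<And>t. t \<in> {T1..T2} \<Longrightarrow> \<bar>1 / p t\<bar> \<le> K"
    by (metis bounded_iff imageI real_norm_def)
  have K0: "0 \<le> K" using K[of T1] T by (meson abs_ge_zero atLeastAtMost_iff less_imp_le order_refl order_trans)
  have cont: "continuous_on {c..d} (\<lambda>t. cos (\<theta> t))"
    by (intro continuous_intros angle_sol_cont_sub[OF sol]) (use c in auto)
  have der: "((\<lambda>t. cos (\<theta> t)) has_real_derivative - sin (\<theta> t) * rhs f g t (\<theta> t)) (at t)"
    if "c < t" "t < d" for t
    using angle_solD_at[OF sol, of t] that c by (auto intro!: derivative_eq_intros)
  have ge: "- sin (\<theta> t) * rhs f g t (\<theta> t) \<ge> - (K * \<bar>cos (\<theta> t)\<bar>)" if t: "c < t" "t < d" for t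
  proof -
    have tin: "t \<in> {T1..T2}" using t c by auto
    define s e where "s = sin (\<theta> t)" and "e = cos (\<theta> t)"
    have s: "s \<ge> 0" "s \<le> 1" using range[of t] t by (auto simp: s_def intro: sin_ge_zero)
    have "rhs f g t (\<theta> t) = e\<^sup>2 / p t + (f t - q t) * s\<^sup>2"
      using s unfolding rhs_def s_def e_def by (simp add: spos_def algebra_simps)
    also have "\<dots> \<le> e\<^sup>2 * (1 / p t)"
      using f[OF t] q_nonneg[OF tin] by (simp add: mult_nonpos_nonneg)
    also have "\<dots> \<le> e\<^sup>2 * K"
      by (rule mult_left_mono[OF order_trans[OF abs_ge_self K[OF tin]]]) simp
    \<comment> \<open>Weakening the square to the absolute value produces the linear inequality of
      the persistence lemmas.\<close>
    also have "\<dots> \<le> \<bar>e\<bar> * K"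
    proof (rule mult_right_mono[OF _ K0])
      have "\<bar>e\<bar> * \<bar>e\<bar> \<le> 1 * \<bar>e\<bar>" by (intro mult_right_mono) (auto simp: e_def)
      then show "e\<^sup>2 \<le> \<bar>e\<bar>" by (simp add: power2_eq_square)
    qed
    finally have "s * rhs f g t (\<theta> t) \<le> s * (\<bar>e\<bar> * K)" using s by (intro mult_left_mono)
    also have "\<dots> \<le> 1 * (\<bar>e\<bar> * K)" using s K0 by (intro mult_right_mono) auto
    finally show ?thesis by (simp add: s_def e_def mult.commute)
  qed
  show "cos (\<theta> c) \<ge> 0 \<Longrightarrow> cos (\<theta> d) \<ge> 0"
    using nonneg_persistent[OF c(2) cont der ge K0] by auto
  show "cos (\<theta> c) > 0 \<Longrightarrow> cos (\<theta> d) > 0"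
    using pos_persistent[OF c(2) cont der ge K0] by auto
qed

text \<open>If \<open>f\<close> were nonpositive throughout an arch, \<open>angle_barrier\<close>
  would keep the cosine from reaching its value at the end of the arch. The base case is the final
  half arch from 0 to \<open>pi / 2\<close>; the step treats a passage from somewhere in
  \<open>[0, pi / 2]\<close> to \<open>pi\<close>, which covers the initial half arch as well. The
  alternative \<open>\<theta> c = 0 \<or> n \<ge> 1\<close> excludes a start at
  \<open>pi / 2\<close> with nothing left to traverse.\<close>

lemma alternates_of_angle:
  assumes "continuous_on {T1..T2} f" "continuous_on {T1..T2} g"
    and "angle_sol f g \<theta>" "T1 \<le> c" "c \<le> T2" "0 \<le> \<theta> c" "\<theta> c \<le> pi / 2"
    and "\<theta> c = 0 \<or> n \<ge> 1" "\<theta> T2 \<ge> n * pi + pi / 2"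
  shows "alternates T2 f g (Suc n) c"
  using assms
proof (induction n arbitrary: f g \<theta> c)
  case 0
  note f = 0(1) and g = 0(2) and sol = 0(3)
  have th: "\<theta> c = 0" "\<theta> T2 \<ge> pi / 2" using 0 by auto
  have "\<exists>d. c \<le> d \<and> d \<le> T2 \<and> \<theta> d = pi / 2"
    by (rule IVT') (use 0 th in \<open>auto intro!: angle_sol_cont_sub[OF sol]\<close>)
  then obtain d where d: "c \<le> d" "d \<le> T2" "\<theta> d = pi / 2" by auto
  have "\<exists>x>c. x < d \<and> f x > 0"
  proof (rule ccontr)
    assume "\<not> ?thesis"
    then have neg: "f x \<le> 0" if "c < x" "x < d" for x using that by (meson not_le)
    \<comment> \<open>The strict barrier is used because this half arch ends where the cosine is 0;
      for a passage up to \<open>pi\<close> the weak one already contradicts the value -1.\<close>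
    have "cos (\<theta> d) > 0"
    proof (rule angle_barrier(2)[OF sol, of c d])
      fix t assume t: "t \<in> {c..d}"
      have "\<theta> t \<ge> 0"
        using angle_ge_multiple_pi[OF f g sol, of c t 0] t 0 d by auto
      moreover have "\<theta> t \<le> pi"
        using angle_le_multiple_pi[OF f g sol, of t d 1] t 0 d pi_half_le_two by auto
      ultimately show "0 \<le> \<theta> t \<and> \<theta> t \<le> pi" by simp
    qed (use 0 d th neg in auto)
    then show False using d by simp
  qed
  then show ?case using d by auto
next
  case (Suc n)
  note f = Suc.prems(1) and g = Suc.prems(2) and sol = Suc.prems(3)
  have big: "\<theta> T2 \<ge> pi + (n * pi + pi / 2)" using Suc.prems by (simp add: algebra_simps)
  have "\<exists>d. c \<le> d \<and> d \<le> T2 \<and> \<theta> d = pi"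
  proof (rule IVT')
    show "\<theta> c \<le> pi" using Suc.prems(7) pi_gt_zero by linarith
    have "0 \<le> n * pi + pi / 2" by simp
    then show "pi \<le> \<theta> T2" using big by linarith
  qed (use Suc.prems(4,5) in \<open>auto intro!: angle_sol_cont_sub[OF sol]\<close>)
  then obtain d where d: "c \<le> d" "d \<le> T2" "\<theta> d = pi" by auto
  have "\<exists>x>c. x < d \<and> f x > 0"
  proof (rule ccontr)
    assume "\<not> ?thesis"
    then have neg: "f x \<le> 0" if "c < x" "x < d" for x using that by (meson not_le)
    have "cos (\<theta> d) \<ge> 0"
    proof (rule angle_barrier(1)[OF sol, of c d])
      fix t assume t: "t \<in> {c..d}"
      have "\<theta> t \<ge> 0"
        using angle_ge_multiple_pi[OF f g sol, of c t 0] t Suc.prems(4,6) d by auto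
      moreover have "\<theta> t \<le> pi"
        using angle_le_multiple_pi[OF f g sol, of t d 1] t Suc.prems(4) d by auto
      ultimately show "0 \<le> \<theta> t \<and> \<theta> t \<le> pi" by simp
    next
      show "0 \<le> cos (\<theta> c)" using Suc.prems(6,7) by (intro cos_ge_zero) auto
    qed (use Suc.prems(4) d neg in auto)
    then show False using d by simp
  qed
  then obtain x where x: "x > c" "x < d" "f x > 0" by auto
  have "alternates T2 g f (Suc n) d"
    by (rule Suc.IH[OF g f angle_sol_shift_pi[OF sol]]) (use Suc.prems(4) d big in auto)
  then have "alternates T2 g f (Suc n) x"
    by (rule alternates_mono) (use x in auto)
  then show ?case
    using x(1,3) less_le_trans[OF x(2) d(2)] unfolding alternates.simps(2)[of T2 f g "Suc n" c] by blast
qed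

end

section \<open>Zero sets of functions with an increment form\<close>

text \<open>This form of the increments replaces continuous differentiability of \<open>F\<close>: dividing by
  \<open>a' - a\<close> along the zero set shows that it is the graph of a decreasing function with
  derivative \<open>- A / B\<close>.\<close>

locale increment_form =
  fixes F :: "real \<Rightarrow> real \<Rightarrow> real"
    and A B :: "(real \<times> real) \<times> (real \<times> real) \<Rightarrow> real"
  assumes incr: "\<And>a b a' b'. F a' b' - F a b = (a' - a) * A ((a, b), (a', b')) + (b' - b) * B ((a, b), (a', b'))"
    and A_cont: "continuous_on UNIV A" and B_cont: "continuous_on UNIV B"
    and A_pos: "\<And>a b. a \<ge> 0 \<Longrightarrow> b \<ge> 0 \<Longrightarrow> F a b = 0 \<Longrightarrow> A ((a, b), (a, b)) > 0"
    and B_pos: "\<And>a b. a \<ge> 0 \<Longrightarrow> b \<ge> 0 \<Longrightarrow> F a b = 0 \<Longrightarrow> B ((a, b), (a, b)) > 0"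
    and axis_a: "\<And>a. a \<ge> 0 \<Longrightarrow> F a 0 < 0" and axis_b: "\<And>b. b \<ge> 0 \<Longrightarrow> F 0 b < 0"
begin

text \<open>The assumptions are symmetric in the two variables; rows give columns, and the branch
  over the second variable is the inverse of the branch over the first.\<close>

lemma swap: "increment_form (\<lambda>a b. F b a)
    (\<lambda>((a, b), (a', b')). B ((b, a), (b', a'))) (\<lambda>((a, b), (a', b')). A ((b, a), (b', a')))"
proof
  have c: "continuous_on UNIV (\<lambda>((a, b), (a', b')). C ((b, a), (b', a')))"
    if "continuous_on UNIV C" for C :: "(real \<times> real) \<times> (real \<times> real) \<Rightarrow> real"
    unfolding case_prod_unfold
    by (rule continuous_on_compose2[OF that]) (intro continuous_intros subset_UNIV)+
  show "continuous_on UNIV (\<lambda>((a, b), (a', b')). B ((b, a), (b', a')))" by (rule c[OF B_cont])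
  show "continuous_on UNIV (\<lambda>((a, b), (a', b')). A ((b, a), (b', a')))" by (rule c[OF A_cont])
  have "F b' a' - F b a = (a' - a) * B ((b, a), (b', a')) + (b' - b) * A ((b, a), (b', a'))" for a b a' b'
    using incr[of b' a' b a] by simp
  then show "F b' a' - F b a =
      (a' - a) * (\<lambda>((a, b), (a', b')). B ((b, a), (b', a'))) ((a, b), (a', b'))
      + (b' - b) * (\<lambda>((a, b), (a', b')). A ((b, a), (b', a'))) ((a, b), (a', b'))" for a b a' b'
    by simp
qed (use A_pos B_pos axis_a axis_b in auto)

lemma A_isCont: "isCont A z" and B_isCont: "isCont B z"
  using A_cont B_cont continuous_on_eq_continuous_at[OF open_UNIV] by blast+

lemma F_cont: "continuous_on S (\<lambda>z. F (fst z) (snd z))"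
proof -
  have "isCont (\<lambda>z. F (fst z) (snd z)) x" for x
  proof -
    have "(\<lambda>z. F (fst z) (snd z)) = (\<lambda>z. F (fst x) (snd x) + (fst z - fst x) * A (x, z) + (snd z - snd x) * B (x, z))"
    proof
      fix z show "F (fst z) (snd z) = F (fst x) (snd x) + (fst z - fst x) * A (x, z) + (snd z - snd x) * B (x, z)"
        using incr[of "fst z" "snd z" "fst x" "snd x"] by simp
    qed
    moreover have "isCont (\<lambda>z. A (x, z)) x" "isCont (\<lambda>z. B (x, z)) x"
      by (rule isCont_o2[OF _ A_isCont] isCont_o2[OF _ B_isCont], intro continuous_intros)+
    ultimately show ?thesis by (auto intro!: continuous_intros)
  qed
  then show ?thesis by (simp add: continuous_at_imp_continuous_on)
qed

lemma F_cont_row: "continuous_on S (\<lambda>a. F a b)" and F_cont_col: "continuous_on S (F a)"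
  using continuous_on_compose2[OF F_cont, of S "\<lambda>a. (a, b)" UNIV]
    continuous_on_compose2[OF F_cont, of S "\<lambda>b. (a, b)" UNIV]
  by (auto simp: continuous_on_Pair continuous_on_const continuous_on_id)

text \<open>Along a row the increment is \<open>(a' - a) * A\<close>, and \<open>A\<close> stays
  positive near the diagonal point by continuity. So zeros of a row are crossed upwards.\<close>

lemma row_increasing_at_zero:
  assumes "a \<ge> 0" "b \<ge> 0" "F a b = 0"
  shows "\<exists>d>0. \<forall>h. 0 < h \<and> h < d \<longrightarrow> F (a + h) b > 0 \<and> F (a - h) b < 0"
proof -
  have "isCont (\<lambda>x. A ((a, b), (x, b))) a"
    by (rule isCont_o2[OF _ A_isCont]) (intro continuous_intros)
  from order_tendstoD(1)[OF this[unfolded isCont_def] A_pos[OF assms]]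
  obtain d where d: "d > 0" "\<And>x. x \<noteq> a \<Longrightarrow> \<bar>x - a\<bar> < d \<Longrightarrow> A ((a, b), (x, b)) > 0"
    unfolding eventually_at dist_real_def by blast
  have "F (a + h) b > 0 \<and> F (a - h) b < 0" if h: "0 < h" "h < d" for h
  proof -
    have "h * A ((a, b), (a + h, b)) > 0" "h * A ((a, b), (a - h, b)) > 0"
      using d(2)[of "a + h"] d(2)[of "a - h"] h by auto
    then show ?thesis
      using incr[of "a + h" b a b] incr[of "a - h" b a b] assms(3) by simp
  qed
  then show ?thesis using d(1) by blast
qed

text \<open>A first zero after a point of positivity is impossible, since \<open>F\<close> would
  have to be negative just before it.\<close>

lemma row_sign_persists:
  assumes "a \<ge> 0" "b \<ge> 0" "F a b \<ge> 0" "a < a'"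
  shows "F a' b > 0"
proof (rule ccontr)
  assume neg: "\<not> F a' b > 0"
  obtain c where c: "a \<le> c" "c < a'" "F c b > 0"
  proof (cases "F a b = 0")
    case True
    obtain d where "d > 0" "\<And>h. 0 < h \<Longrightarrow> h < d \<Longrightarrow> F (a + h) b > 0"
      using row_increasing_at_zero[OF assms(1,2) True] by blast
    then have "F (a + min (d / 2) ((a' - a) / 2)) b > 0" using assms(4) by auto
    then show thesis
      using that[of "a + min (d / 2) ((a' - a) / 2)"] \<open>d > 0\<close> assms(4) by (auto simp: min_def field_simps)
  next
    case False
    then show thesis using assms that[of a] by simp
  qed
  define z where "z = Inf {x \<in> {c..a'}. F x b \<le> 0}"
  have cl: "closed {x \<in> {c..a'}. F x b \<le> 0}"
  proof -
    have "{x \<in> {c..a'}. F x b \<le> 0} = {c..a'} \<inter> {x. F x b \<le> 0}" by auto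
    then show ?thesis
      by (simp add: closed_Int closed_Collect_le F_cont_row continuous_on_const)
  qed
  have z: "z \<in> {x \<in> {c..a'}. F x b \<le> 0}"
    unfolding z_def by (rule closed_contains_Inf[OF _ _ cl]) (use neg c in \<open>auto intro!: bdd_belowI[of _ c]\<close>)
  have min: "F x b > 0" if "c \<le> x" "x < z" for x
  proof (rule ccontr)
    assume "\<not> F x b > 0"
    then have "z \<le> x" unfolding z_def using that z by (intro cInf_lower) (auto intro!: bdd_belowI[of _ c])
    then show False using that by simp
  qed
  have cz: "c < z" using z c(3) by (metis (mono_tags, lifting) atLeastAtMost_iff le_less mem_Collect_eq not_less)
  have "F z b = 0"
  proof (rule ccontr)
    assume "F z b \<noteq> 0"
    then have "F z b < 0" using z by auto
    then have "\<exists>x. c \<le> x \<and> x \<le> z \<and> F x b = 0"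
      using c cz by (intro IVT2') (auto intro!: F_cont_row)
    then show False using min \<open>F z b \<noteq> 0\<close> by (metis le_less less_irrefl)
  qed
  then obtain d where d: "d > 0" "\<And>h. 0 < h \<Longrightarrow> h < d \<Longrightarrow> F (z - h) b < 0"
    using row_increasing_at_zero[of z b] assms c cz by auto
  \<comment> \<open>The point \<open>z - h\<close> is close enough to \<open>z\<close> for
    \<open>F\<close> to be negative there, yet still in \<open>[c, z[\<close>, where
    \<open>F\<close> is positive.\<close>
  define h where "h = min (d / 2) ((z - c) / 2)"
  have "0 < h" "h < d" "c \<le> z - h" "z - h < z" using d(1) cz by (auto simp: h_def min_def field_simps)
  then show False using d(2)[of h] min[of "z - h"] by simp
qed

lemma col_sign_persists:
  assumes "a \<ge> 0" "b \<ge> 0" "F a b \<ge> 0" "b < b'"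
  shows "F a b' > 0"
  using increment_form.row_sign_persists[OF swap, of b a b'] assms by simp

definition "dom_a = {a. a \<ge> 0 \<and> (\<exists>b\<ge>0. F a b = 0)}"
definition "branch a = (THE b. b \<ge> 0 \<and> F a b = 0)"

lemma zero_unique: "a \<ge> 0 \<Longrightarrow> b \<ge> 0 \<Longrightarrow> b' \<ge> 0 \<Longrightarrow> F a b = 0 \<Longrightarrow> F a b' = 0 \<Longrightarrow> b = b'"
  using col_sign_persists[of a b b'] col_sign_persists[of a b' b] by (cases b b' rule: linorder_cases) auto

lemma branch_eq: "a \<ge> 0 \<Longrightarrow> b \<ge> 0 \<Longrightarrow> F a b = 0 \<Longrightarrow> branch a = b"
  unfolding branch_def using zero_unique by blast

lemma branch_zero: "a \<in> dom_a \<Longrightarrow> branch a \<ge> 0 \<and> F a (branch a) = 0"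
  unfolding dom_a_def using branch_eq by auto

lemma zero_pos: "a \<ge> 0 \<Longrightarrow> b \<ge> 0 \<Longrightarrow> F a b = 0 \<Longrightarrow> a > 0 \<and> b > 0"
  using axis_a[of a] axis_b[of b] by (auto simp: less_le)

text \<open>Membership expressed by positivity instead of vanishing is an open condition and is
  inherited by larger \<open>a\<close>. The zero is recovered by the intermediate value theorem,
  starting from the negative value on the axis.\<close>

lemma dom_a_alt: "dom_a = {a. a > 0 \<and> (\<exists>b>0. F a b > 0)}"
proof (intro set_eqI iffI)
  fix a assume "a \<in> dom_a"
  then obtain b where b: "a \<ge> 0" "b \<ge> 0" "F a b = 0" by (auto simp: dom_a_def)
  have "F a (b + 1) > 0" using col_sign_persists[of a b "b + 1"] b by simp
  then show "a \<in> {a. a > 0 \<and> (\<exists>b>0. F a b > 0)}"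
    using zero_pos[OF b] by (auto intro!: exI[of _ "b + 1"])
next
  fix a assume "a \<in> {a. a > 0 \<and> (\<exists>b>0. F a b > 0)}"
  then obtain b where b: "a > 0" "b > 0" "F a b > 0" by auto
  have "\<exists>x. 0 \<le> x \<and> x \<le> b \<and> F a x = 0"
    using b axis_a[of a] by (intro IVT') (auto intro!: F_cont_col)
  then show "a \<in> dom_a" using b by (auto simp: dom_a_def)
qed

lemma dom_a_up: "a \<in> dom_a \<Longrightarrow> a < a' \<Longrightarrow> a' \<in> dom_a"
  unfolding dom_a_alt using row_sign_persists[of a _ a'] by force

lemma open_dom_a: "open dom_a"
proof -
  have "dom_a = {0<..} \<inter> (\<Union>b\<in>{0<..}. {a. 0 < F a b})"
    by (auto simp: dom_a_alt)
  moreover have "open {a. 0 < F a b}" for b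
    by (rule open_Collect_less) (auto intro!: F_cont_row continuous_intros)
  ultimately show ?thesis by (auto intro!: open_Int open_UN)
qed

lemma interval_dom_a: "is_interval dom_a"
  unfolding is_interval_1 using dom_a_up by (metis le_less)

lemma unbounded_dom_a:
  assumes "dom_a \<noteq> {}" shows "\<not> bounded dom_a"
proof
  assume "bounded dom_a"
  then obtain M where M: "\<And>x. x \<in> dom_a \<Longrightarrow> \<bar>x\<bar> \<le> M" by (auto simp: bounded_iff)
  obtain a where "a \<in> dom_a" using assms by auto
  then have "max (a + 1) (M + 1) \<in> dom_a" by (rule dom_a_up) auto
  from M[OF this] show False by auto
qed

lemma branch_decreasing:
  assumes "a \<in> dom_a" "a' \<in> dom_a" "a < a'"
  shows "branch a' < branch a"
proof (rule ccontr)
  assume "\<not> branch a' < branch a"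
  then have le: "branch a \<le> branch a'" by simp
  have a: "a \<ge> 0" using assms by (auto simp: dom_a_def)
  note z = branch_zero[OF assms(1)] branch_zero[OF assms(2)]
  have "F a' (branch a) > 0" using row_sign_persists[of a "branch a" a'] a z assms by simp
  then have "F a' (branch a') > 0"
    using col_sign_persists[of a' "branch a" "branch a'"] le a assms z by (cases "branch a = branch a'") auto
  then show False using z by simp
qed

lemma branch_less:
  assumes "a \<in> dom_a" "b \<ge> 0" "F a b > 0" shows "branch a < b"
proof (rule ccontr)
  assume "\<not> branch a < b"
  then have "branch a = b \<or> b < branch a" by auto
  then show False
    using col_sign_persists[of a b "branch a"] branch_zero[OF assms(1)] assms by (auto simp: dom_a_def)
qed

lemma less_branch:
  assumes "a \<in> dom_a" "b \<ge> 0" "F a b < 0" shows "b < branch a"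
proof (rule ccontr)
  assume "\<not> b < branch a"
  then have "branch a = b \<or> branch a < b" by auto
  then show False
    using col_sign_persists[of a "branch a" b] branch_zero[OF assms(1)] assms by (auto simp: dom_a_def)
qed

text \<open>The signs of \<open>F\<close> slightly above and slightly below \<open>branch a\<close>
  persist for nearby \<open>x\<close> and enclose \<open>branch x\<close>.\<close>

lemma branch_isCont:
  assumes "a \<in> dom_a" shows "isCont branch a"
proof -
  have a: "a > 0" "branch a > 0" "F a (branch a) = 0"
    using branch_zero[OF assms] zero_pos[of a "branch a"] assms by (auto simp: dom_a_def)
  have "\<forall>\<^sub>F x in nhds a. \<bar>branch x - branch a\<bar> < e" if "e > 0" for e
  proof -
    \<comment> \<open>The bound by \<open>branch a / 2\<close> keeps the lower comparison point
      inside the quadrant.\<close>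
    define e' where "e' = min (e / 2) (branch a / 2)"
    have e': "e' > 0" "e' < e" "e' < branch a" using that a by (auto simp: e'_def)
    have up: "F a (branch a + e') > 0" using col_sign_persists[of a "branch a" "branch a + e'"] a e' by simp
    have lo: "F a (branch a - e') < 0"
      using col_sign_persists[of a "branch a - e'" "branch a"] a e' by (cases "F a (branch a - e') < 0") auto
    have ic: "((\<lambda>x. F x b) \<longlongrightarrow> F a b) (nhds a)" for b
    proof -
      have "isCont (\<lambda>x. F x b) a"
        using F_cont_row[of UNIV b] by (simp add: continuous_on_eq_continuous_at)
      then show ?thesis
        unfolding isCont_def by (rule tendsto_at_iff_tendsto_nhds[of "\<lambda>x. F x b" a, THEN iffD1])
    qed
    have "\<forall>\<^sub>F x in nhds a. F x (branch a + e') > 0"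
      using order_tendstoD(1)[OF ic up] .
    moreover have "\<forall>\<^sub>F x in nhds a. F x (branch a - e') < 0"
      using order_tendstoD(2)[OF ic lo] .
    moreover have "\<forall>\<^sub>F x in nhds a. x \<in> dom_a"
      using open_dom_a assms by (rule eventually_nhds_in_open)
    ultimately show ?thesis
    proof eventually_elim
      case (elim x)
      have "branch x < branch a + e'"
        by (rule branch_less[OF elim(3)]) (use a e' elim(1) in auto)
      moreover have "branch a - e' < branch x"
        by (rule less_branch[OF elim(3)]) (use a e' elim(2) in auto)
      ultimately show ?case using e' by auto
    qed
  qed
  then have "(branch \<longlongrightarrow> branch a) (nhds a)"
    by (intro tendstoI) (simp only: dist_real_def)
  then show ?thesis
    unfolding isCont_def by (rule filterlim_mono) (simp_all add: at_within_le_nhds)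
qed

definition "slope a = - (A ((a, branch a), (a, branch a)) / B ((a, branch a), (a, branch a)))"

lemma branch_DERIV:
  assumes "a \<in> dom_a" shows "(branch has_real_derivative slope a) (at a)"
proof -
  have a: "a > 0" "branch a > 0" "F a (branch a) = 0"
    using branch_zero[OF assms] zero_pos[of a "branch a"] assms by (auto simp: dom_a_def)
  have c: "isCont (\<lambda>x. C ((a, branch a), (x, branch x))) a" if "\<And>z. isCont C z" for C :: "(real \<times> real) \<times> (real \<times> real) \<Rightarrow> real"
    by (rule isCont_o2[OF _ that]) (intro continuous_intros branch_isCont[OF assms])
  have Bp: "B ((a, branch a), (a, branch a)) > 0" using B_pos a by auto
  have lim: "((\<lambda>x. - (A ((a, branch a), (x, branch x)) / B ((a, branch a), (x, branch x)))) \<longlongrightarrow> slope a) (at a)"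
    unfolding slope_def using c[OF A_isCont] c[OF B_isCont] Bp
    by (intro tendsto_intros) (auto simp: isCont_def)
  have "\<forall>\<^sub>F x in at a. B ((a, branch a), (x, branch x)) > 0"
    using c[OF B_isCont] Bp unfolding isCont_def by (rule order_tendstoD(1))
  moreover have "\<forall>\<^sub>F x in at a. x \<in> dom_a \<and> x \<noteq> a"
    using open_dom_a assms by (auto simp: eventually_at_topological)
  ultimately have "\<forall>\<^sub>F x in at a. - (A ((a, branch a), (x, branch x)) / B ((a, branch a), (x, branch x)))
      = (branch x - branch a) / (x - a)"
  proof eventually_elim
    case (elim x)
    have "(x - a) * A ((a, branch a), (x, branch x)) + (branch x - branch a) * B ((a, branch a), (x, branch x)) = 0"
      using incr[of x "branch x" a "branch a"] branch_zero[of x] a elim by simp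
    then show ?case using elim by (simp add: divide_simps) (simp add: algebra_simps)
  qed
  then show ?thesis
    unfolding has_field_derivative_iff by (rule Lim_transform_eventually[OF lim])
qed

lemma slope_cont: "continuous_on dom_a slope"
proof -
  have bc: "continuous_on dom_a branch"
    by (simp add: branch_isCont continuous_at_imp_continuous_on)
  have c: "continuous_on dom_a (\<lambda>a. C ((a, branch a), (a, branch a)))" if "continuous_on UNIV C"
    for C :: "(real \<times> real) \<times> (real \<times> real) \<Rightarrow> real"
    by (rule continuous_on_compose2[OF that]) (intro continuous_intros bc subset_UNIV)+
  have "B ((a, branch a), (a, branch a)) \<noteq> 0" if "a \<in> dom_a" for a
    using B_pos[of a "branch a"] branch_zero[OF that] that by (auto simp: dom_a_def)
  then show ?thesis
    unfolding slope_def by (intro continuous_intros c A_cont B_cont) auto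
qed

end

text \<open>The extra function \<open>g\<close> is meant for \<open>inv_into\<close>, which agrees
  with an explicit formula only on the set itself.\<close>

lemma C1_differentiable_onI:
  fixes f f' g :: "real \<Rightarrow> real"
  assumes "open S" "\<And>x. x \<in> S \<Longrightarrow> (f has_real_derivative f' x) (at x)"
    and "continuous_on S f'" "\<And>x. x \<in> S \<Longrightarrow> g x = f x"
  shows "g C1_differentiable_on S"
  unfolding C1_differentiable_on_def
proof (intro exI conjI ballI)
  fix x assume x: "x \<in> S"
  have "(g has_real_derivative f' x) (at x)"
    by (rule has_field_derivative_transform_within_open[OF assms(2)[OF x] assms(1) x]) (simp add: assms(4))
  then show "(g has_vector_derivative f' x) (at x)"
    by (simp add: has_real_derivative_iff_has_vector_derivative)
qed (rule assms(3))

section \<open>Reflection of the zero set into the four quadrants\<close>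

lemma pm_val_mult_self [simp]: "pm_val e * pm_val e = 1" "pm_val e * (pm_val e * x) = x"
  by (cases e; simp)+

lemma pm_halfline_iff: "x \<in> pm_halfline e \<longleftrightarrow> 0 \<le> pm_val e * x"
  by (cases e) (auto simp: pm_halfline_def)

lemma
  fixes D :: "real set"
  defines "I e \<equiv> {x. pm_val e * x \<in> D}"
  assumes "open D" "is_interval D" "\<not> bounded D" "D \<subseteq> {0..}"
  shows open_pm_reflect: "open (I e)" and interval_pm_reflect: "is_interval (I e)"
    and unbounded_pm_reflect: "\<not> bounded (I e)" and subset_pm_reflect: "I e \<subseteq> pm_halfline e"
proof -
  have I: "I e = D \<or> I e = uminus ` D"
  proof (cases e)
    case Minus
    have "x \<in> uminus ` D \<longleftrightarrow> - x \<in> D" for x :: real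
      by (metis image_iff minus_minus)
    then show ?thesis using Minus by (auto simp: I_def)
  qed (simp add: I_def)
  show "open (I e)" using I assms(2) by (metis open_negations)
  show "is_interval (I e)" using I assms(3) by (metis is_interval_minus_translation is_interval_neg_translationI is_interval_uminus)
  show "\<not> bounded (I e)" using I assms(4) by (metis bounded_uminus)
  show "I e \<subseteq> pm_halfline e" using assms(5) by (auto simp: I_def pm_halfline_iff)
qed

text \<open>Reflecting exactly one axis turns the decreasing branch into an increasing one,
  reflecting both or none leaves it decreasing; hence the disjunction.\<close>

lemma monotone_pm_reflect:
  assumes "\<And>a b. a \<in> D \<Longrightarrow> b \<in> D \<Longrightarrow> a < b \<Longrightarrow> f b < (f a :: real)"
  shows "strict_mono_on {x. pm_val e * x \<in> D} (\<lambda>x. pm_val e' * f (pm_val e * x))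
    \<or> strict_antimono_on {x. pm_val e * x \<in> D} (\<lambda>x. pm_val e' * f (pm_val e * x))"
  using assms by (cases e; cases e') (auto simp: monotone_on_def)

context increment_form
begin

lemma branch_reflected_DERIV:
  assumes "pm_val e * x \<in> dom_a"
  shows "((\<lambda>x. pm_val e' * branch (pm_val e * x)) has_real_derivative
      pm_val e' * (slope (pm_val e * x) * pm_val e)) (at x)"
  by (intro DERIV_cmult DERIV_chain2[where f = branch and g = "\<lambda>x. pm_val e * x"] branch_DERIV[OF assms])
    (auto intro!: derivative_eq_intros)

lemma slope_reflected_cont:
  "continuous_on {x. pm_val e * x \<in> dom_a} (\<lambda>x. pm_val e' * (slope (pm_val e * x) * pm_val e))"
  by (intro continuous_intros continuous_on_compose2[OF slope_cont]) auto

text \<open>The interval \<open>J\<close> and the inverse function are the domain and the branch of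
  the form with exchanged variables, so they inherit all properties of \<open>I\<close> and of the
  branch itself.\<close>

lemma hyperbolic_like_zero_set:
  assumes "{(x, y). 0 \<le> pm_val e1 * x \<and> 0 \<le> pm_val e2 * y \<and> F (pm_val e1 * x) (pm_val e2 * y) = 0} \<noteq> {}"
    (is "?S \<noteq> {}")
  shows "hyperbolic_like e1 e2 ?S"
proof -
  interpret sw: increment_form "\<lambda>a b. F b a" "\<lambda>((a, b), (a', b')). B ((b, a), (b', a'))"
    "\<lambda>((a, b), (a', b')). A ((b, a), (b', a'))"
    by (rule swap)
  define I where "I = {x. pm_val e1 * x \<in> dom_a}"
  define J where "J = {y. pm_val e2 * y \<in> sw.dom_a}"
  define \<phi> where "\<phi> = (\<lambda>x. pm_val e2 * branch (pm_val e1 * x))"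
  define \<psi> where "\<psi> = (\<lambda>y. pm_val e1 * sw.branch (pm_val e2 * y))"
  obtain a b where ab: "0 \<le> a" "0 \<le> b" "F a b = 0" using assms by auto
  then have ne: "dom_a \<noteq> {}" "sw.dom_a \<noteq> {}" by (auto simp: dom_a_def sw.dom_a_def)
  have sub: "dom_a \<subseteq> {0..}" "sw.dom_a \<subseteq> {0..}" by (auto simp: dom_a_def sw.dom_a_def)
  note I_props = open_dom_a interval_dom_a unbounded_dom_a[OF ne(1)] sub(1)
  note J_props = sw.open_dom_a sw.interval_dom_a sw.unbounded_dom_a[OF ne(2)] sub(2)
  have \<psi>\<phi>: "\<phi> x \<in> J \<and> \<psi> (\<phi> x) = x" if "x \<in> I" for x
  proof -
    have x: "pm_val e1 * x \<in> dom_a" using that by (simp add: I_def)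
    have x0: "0 \<le> pm_val e1 * x" using x by (auto simp: dom_a_def)
    note z = branch_zero[OF x]
    have "branch (pm_val e1 * x) \<in> sw.dom_a" using z x0 by (auto simp: sw.dom_a_def)
    moreover have "sw.branch (branch (pm_val e1 * x)) = pm_val e1 * x"
      using z x0 by (intro sw.branch_eq) auto
    ultimately show ?thesis by (simp add: J_def \<phi>_def \<psi>_def)
  qed
  have \<phi>\<psi>: "\<psi> y \<in> I \<and> \<phi> (\<psi> y) = y" if "y \<in> J" for y
  proof -
    have y: "pm_val e2 * y \<in> sw.dom_a" using that by (simp add: J_def)
    have y0: "0 \<le> pm_val e2 * y" using y by (auto simp: sw.dom_a_def)
    note z = sw.branch_zero[OF y]
    have "sw.branch (pm_val e2 * y) \<in> dom_a" using z y0 by (auto simp: dom_a_def)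
    moreover have "branch (sw.branch (pm_val e2 * y)) = pm_val e2 * y"
      using z y0 by (intro branch_eq) auto
    ultimately show ?thesis by (simp add: I_def \<phi>_def \<psi>_def)
  qed
  have bij: "bij_betw \<phi> I J"
    by (rule bij_betwI[where g = \<psi>]) (use \<psi>\<phi> \<phi>\<psi> in auto)
  have inv: "inv_into I \<phi> y = \<psi> y" if "y \<in> J" for y
    using \<phi>\<psi>[OF that] bij by (metis bij_betw_def inv_into_f_f)
  have "\<phi> C1_differentiable_on I"
    unfolding I_def \<phi>_def
    by (rule C1_differentiable_onI[OF open_pm_reflect[OF I_props] branch_reflected_DERIV slope_reflected_cont]) auto
  moreover have "inv_into I \<phi> C1_differentiable_on J"
    unfolding J_def
    by (rule C1_differentiable_onI[OF open_pm_reflect[OF J_props] sw.branch_reflected_DERIV sw.slope_reflected_cont])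
      (use inv in \<open>auto simp: J_def \<psi>_def\<close>)
  moreover have "strict_mono_on I \<phi> \<or> strict_antimono_on I \<phi>"
    unfolding I_def \<phi>_def by (rule monotone_pm_reflect) (rule branch_decreasing)
  moreover have "?S = {(a, \<phi> a) |a. a \<in> I}"
  proof (intro set_eqI iffI)
    fix z assume "z \<in> ?S"
    then obtain x y where z: "z = (x, y)" and h: "0 \<le> pm_val e1 * x" "0 \<le> pm_val e2 * y"
      "F (pm_val e1 * x) (pm_val e2 * y) = 0" by auto
    have "x \<in> I" using h by (auto simp: I_def dom_a_def)
    moreover have "\<phi> x = y" using branch_eq[OF h] by (simp add: \<phi>_def)
    ultimately show "z \<in> {(a, \<phi> a) |a. a \<in> I}" using z by auto
  next
    fix z assume "z \<in> {(a, \<phi> a) |a. a \<in> I}"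
    then obtain x where z: "z = (x, \<phi> x)" and x: "pm_val e1 * x \<in> dom_a" by (auto simp: I_def)
    have "0 \<le> pm_val e1 * x" using x by (auto simp: dom_a_def)
    then show "z \<in> ?S" using z branch_zero[OF x] by (simp add: \<phi>_def)
  qed
  moreover have "is_interval I" "open I" "\<not> bounded I" "I \<subseteq> pm_halfline e1"
    unfolding I_def by (intro interval_pm_reflect open_pm_reflect unbounded_pm_reflect subset_pm_reflect I_props)+
  moreover have "is_interval J" "open J" "\<not> bounded J" "J \<subseteq> pm_halfline e2"
    unfolding J_def by (intro interval_pm_reflect open_pm_reflect unbounded_pm_reflect subset_pm_reflect J_props)+
  ultimately show ?thesis
    unfolding hyperbolic_like_def using bij by blast
qed

end

section \<open>The energy identity and dependence on the parameters\<close>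

text \<open>The substitution \<open>a + \<tau> * (t - a)\<close> moves the variable upper limit into
  the integrand, which reduces the claim to parameter integrals over a fixed interval.\<close>

lemma continuous_on_primitive_param:
  fixes f :: "'a::t2_space \<Rightarrow> real \<Rightarrow> real"
  assumes ab: "a \<le> b" and f: "continuous_on (UNIV \<times> {a..b}) (\<lambda>(z, t). f z t)"
  shows "continuous_on (UNIV \<times> {a..b}) (\<lambda>(z, t). integral {a..t} (f z))"
proof -
  have eq: "integral (cbox 0 1) (\<lambda>\<tau>. (t - a) * f z (a + \<tau> * (t - a))) = integral {a..t} (f z)"
    if t: "t \<in> {a..b}" for z t
  proof -
    have fz: "continuous_on {a..b} (f z)"
    proof -
      have "continuous_on {a..b} (\<lambda>s. case (z, s) of (z, t) \<Rightarrow> f z t)"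
        by (rule continuous_on_compose2[OF f]) (auto intro!: continuous_intros)
      then show ?thesis by simp
    qed
    have inr: "a + \<tau> * (t - a) \<in> {a..b}" if "\<tau> \<in> {0..1}" for \<tau>
      using that t mult_left_le_one_le[of "t - a" \<tau>] by auto
    have "((\<lambda>\<tau>. (t - a) * f z (a + \<tau> * (t - a))) has_integral
        (integral {a..a + 1 * (t - a)} (f z) - integral {a..a + 0 * (t - a)} (f z))) {0..1}"
    proof (rule fundamental_theorem_of_calculus)
      fix \<tau> :: real assume \<tau>: "\<tau> \<in> {0..1}"
      have "((\<lambda>u. integral {a..u} (f z)) has_real_derivative f z (a + \<tau> * (t - a)))
          (at (a + \<tau> * (t - a)) within (\<lambda>\<tau>. a + \<tau> * (t - a)) ` {0..1})"
        by (rule DERIV_subset[OF integral_has_real_derivative[OF fz inr[OF \<tau>]]]) (use inr in auto)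
      moreover have "((\<lambda>\<tau>. a + \<tau> * (t - a)) has_real_derivative (t - a)) (at \<tau> within {0..1})"
        by (auto intro!: derivative_eq_intros)
      ultimately have "((\<lambda>\<tau>. integral {a..a + \<tau> * (t - a)} (f z)) has_real_derivative f z (a + \<tau> * (t - a)) * (t - a)) (at \<tau> within {0..1})"
        using DERIV_image_chain[of "\<lambda>u. integral {a..u} (f z)"] by (simp add: o_def)
      then show "((\<lambda>\<tau>. integral {a..a + \<tau> * (t - a)} (f z)) has_vector_derivative (t - a) * f z (a + \<tau> * (t - a))) (at \<tau> within {0..1})"
        by (simp add: has_real_derivative_iff_has_vector_derivative mult.commute)
    qed simp
    from integral_unique[OF this] show ?thesis by simp
  qed
  have "continuous_on (UNIV \<times> {a..b}) (\<lambda>w. integral (cbox 0 1) (\<lambda>\<tau>. (snd w - a) * f (fst w) (a + \<tau> * (snd w - a))))"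
  proof (rule integral_continuous_on_param)
    have inr: "a + \<tau> * (t - a) \<in> {a..b}" if "\<tau> \<in> {0..1}" "t \<in> {a..b}" for \<tau> t
      using that mult_left_le_one_le[of "t - a" \<tau>] by auto
    have "continuous_on ((UNIV \<times> {a..b}) \<times> cbox 0 1) (\<lambda>x. case (fst (fst x), a + snd x * (snd (fst x) - a)) of (z, t) \<Rightarrow> f z t)"
      by (rule continuous_on_compose2[OF f]) (use inr in \<open>auto intro!: continuous_intros\<close>)
    then show "continuous_on ((UNIV \<times> {a..b}) \<times> cbox 0 1) (\<lambda>(w, \<tau>). (snd w - a) * f (fst w) (a + \<tau> * (snd w - a)))"
      unfolding case_prod_unfold by (intro continuous_intros) simp
  qed
  then show ?thesis
  proof (rule continuous_on_eq)
    fix w :: "'a \<times> real" assume "w \<in> UNIV \<times> {a..b}"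
    then have "snd w \<in> {a..b}" by auto
    from eq[OF this, of "fst w"]
    show "integral (cbox 0 1) (\<lambda>\<tau>. (snd w - a) * f (fst w) (a + \<tau> * (snd w - a)))
        = (case w of (z, t) \<Rightarrow> integral {a..t} (f z))"
      by (simp only: case_prod_unfold)
  qed
qed

context neumann_data
begin

text \<open>At a zero the angle is a multiple of \<open>pi\<close>, and no multiple is taken twice.
  The angle is bounded, so only finitely many multiples are available.\<close>

lemma finite_angle_zeros:
  assumes f: "continuous_on {T1..T2} f" and g: "continuous_on {T1..T2} g" and sol: "angle_sol f g \<theta>"
  shows "finite {t \<in> {T1..T2}. sin (\<theta> t) = 0}" (is "finite ?Z")
    and "inj_on \<theta> {t \<in> {T1..T2}. sin (\<theta> t) = 0}"
proof -
  have ne: "\<theta> s \<noteq> \<theta> t" if st: "s \<in> ?Z" "t \<in> ?Z" "s < t" for s t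
  proof -
    obtain i :: int where i: "\<theta> s = i * pi"
      using st(1) by (auto simp: sin_zero_iff_int2)
    then show ?thesis
      using angle_above_multiple_pi[OF f g sol, of s t i] st by auto
  qed
  show inj: "inj_on \<theta> ?Z"
    by (rule linorder_inj_onI') (use ne in blast)
  have "bounded (\<theta> ` {T1..T2})"
    by (intro compact_imp_bounded compact_continuous_image angle_sol_cont[OF sol]) auto
  then obtain M where M: "\<And>t. t \<in> {T1..T2} \<Longrightarrow> \<bar>\<theta> t\<bar> \<le> M"
    by (metis bounded_iff imageI real_norm_def)
  have "\<theta> ` ?Z \<subseteq> (\<lambda>i::int. i * pi) ` {- \<lceil>M / pi\<rceil>..\<lceil>M / pi\<rceil>}"
  proof
    fix x assume "x \<in> \<theta> ` ?Z"
    then obtain t where t: "t \<in> {T1..T2}" "x = \<theta> t" "sin x = 0" by auto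
    then obtain i :: int where i: "x = i * pi" by (auto simp: sin_zero_iff_int2)
    have "\<bar>real_of_int i\<bar> * pi \<le> M" using M[OF t(1)] t(2) i by (simp add: abs_mult)
    then have "\<bar>real_of_int i\<bar> \<le> M / pi" by (simp add: pos_le_divide_eq)
    then have "\<bar>i\<bar> \<le> \<lceil>M / pi\<rceil>" by linarith
    then have "i \<in> {- \<lceil>M / pi\<rceil>..\<lceil>M / pi\<rceil>}" by (simp add: abs_le_iff)
    then show "x \<in> (\<lambda>i::int. i * pi) ` {- \<lceil>M / pi\<rceil>..\<lceil>M / pi\<rceil>}"
      unfolding i by (rule imageI)
  qed
  then have "finite (\<theta> ` ?Z)" by (rule finite_subset) simp
  then show "finite ?Z" using inj by (rule finite_imageD)
qed

text \<open>For \<open>u = r sin \<theta>\<close> and \<open>E = r\<^sup>2\<close> this is the energy identity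
  \<open>\<integral> f (u\<^sup>+)\<^sup>2 = \<integral> p ((u\<^sup>+)')\<^sup>2 + q (u\<^sup>+)\<^sup>2\<close>,
  obtained by integrating the derivative of \<open>p u' u\<^sup>+ = E cos \<theta> max 0 (sin \<theta>)\<close>.\<close>

lemma energy_pos:
  assumes f: "continuous_on {T1..T2} f" and g: "continuous_on {T1..T2} g" and sol: "angle_sol f g \<theta>"
    and E_cont: "continuous_on {T1..T2} E" and E_pos: "\<And>t. t \<in> {T1..T2} \<Longrightarrow> E t > 0"
    and E_der: "\<And>t. t \<in> {T1<..<T2} \<Longrightarrow> (E has_real_derivative
       - ((f t - q t - 1 / p t) * dspos (\<theta> t) - (g t - q t - 1 / p t) * dspos (- \<theta> t)) * E t) (at t)"
    and bc: "cos (\<theta> T1) = 0" "cos (\<theta> T2) = 0"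
    and t0: "T1 < t0" "t0 < T2" "sin (\<theta> t0) > 0" "cos (\<theta> t0) \<noteq> 0"
  shows "integral {T1..T2} (\<lambda>t. f t * (E t * spos (\<theta> t))) > 0"
proof -
  note th_cont = angle_sol_cont[OF sol]
  define W where "W = (\<lambda>t. E t * cos (\<theta> t) * max 0 (sin (\<theta> t)))"
  define Z where "Z = {t \<in> {T1..T2}. sin (\<theta> t) = 0}"
  \<comment> \<open>With \<open>E\<close> in the role of r^2 this is p u'^2 + q u^2 where
    \<open>u\<close> is positive, and 0 elsewhere. It jumps at the zeros, so its integrability is
    later deduced from the fundamental theorem.\<close>
  define P where "P = (\<lambda>t. if sin (\<theta> t) > 0 then E t * ((cos (\<theta> t))\<^sup>2 / p t + q t * (sin (\<theta> t))\<^sup>2) else 0)"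
  define R where "R = (\<lambda>t. f t * (E t * spos (\<theta> t)))"
  have "((\<lambda>t. P t - R t) has_integral (W T2 - W T1)) {T1..T2}"
  proof (rule fundamental_theorem_of_calculus_interior_strong)
    \<comment> \<open>\<open>W\<close> has a corner at each interior zero of \<open>u\<close>, hence
      the version of the fundamental theorem with a finite exceptional set.\<close>
    show "finite Z" unfolding Z_def by (rule finite_angle_zeros[OF f g sol])
    show "continuous_on {T1..T2} W"
      unfolding W_def by (intro continuous_intros th_cont E_cont)
    fix t assume t: "t \<in> {T1<..<T2} - Z"
    then have tin: "t \<in> {T1..T2}" "t \<in> {T1<..<T2}" and nz: "sin (\<theta> t) \<noteq> 0" by (auto simp: Z_def)
    have dth: "(\<theta> has_real_derivative rhs f g t (\<theta> t)) (at t)"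
      by (rule angle_solD_at[OF sol]) (use tin in auto)
    have st: "open {s \<in> {T1<..<T2}. \<theta> s \<in> U}" if "open U" for U
    proof -
      have "continuous_on {T1<..<T2} \<theta>" by (rule continuous_on_subset[OF th_cont]) auto
      then have "open (\<theta> -` U \<inter> {T1<..<T2})"
        using continuous_on_open_vimage[of "{T1<..<T2}" \<theta>] that by simp
      moreover have "\<theta> -` U \<inter> {T1<..<T2} = {s \<in> {T1<..<T2}. \<theta> s \<in> U}" by auto
      ultimately show ?thesis by simp
    qed
    show "(W has_vector_derivative P t - R t) (at t)"
    proof (cases "sin (\<theta> t) > 0")
      case True
      define s e where "s = sin (\<theta> t)" and "e = cos (\<theta> t)"
      define al where "al = f t - q t"
      define ip where "ip = 1 / p t"
      have se: "e\<^sup>2 + s\<^sup>2 = 1" by (simp add: s_def e_def)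
      have r: "rhs f g t (\<theta> t) = e\<^sup>2 * ip + al * s\<^sup>2"
        using True unfolding rhs_def s_def e_def al_def ip_def by (simp add: spos_def algebra_simps)
      have dE: "(E has_real_derivative - ((al - ip) * (2 * s * e)) * E t) (at t)"
        using E_der[OF tin(2)] True by (simp add: dspos_def s_def e_def al_def ip_def)
      have "((\<lambda>t. E t * cos (\<theta> t) * sin (\<theta> t)) has_real_derivative
          (- ((al - ip) * (2 * s * e)) * E t * e + E t * (- s * (e\<^sup>2 * ip + al * s\<^sup>2))) * s
           + E t * e * (e * (e\<^sup>2 * ip + al * s\<^sup>2))) (at t)"
      proof -
        have dc: "((\<lambda>t. cos (\<theta> t)) has_real_derivative - s * (e\<^sup>2 * ip + al * s\<^sup>2)) (at t)"
          and ds: "((\<lambda>t. sin (\<theta> t)) has_real_derivative e * (e\<^sup>2 * ip + al * s\<^sup>2)) (at t)"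
          unfolding s_def e_def
          by (rule DERIV_chain2[OF DERIV_cos dth[unfolded r s_def e_def]])
            (rule DERIV_chain2[OF DERIV_sin dth[unfolded r s_def e_def]])
        show ?thesis
          by (rule DERIV_cong[OF DERIV_mult[OF DERIV_mult[OF dE dc] ds]])
            (simp add: s_def[symmetric] e_def[symmetric])
      qed
      moreover have "(- ((al - ip) * (2 * s * e)) * E t * e + E t * (- s * (e\<^sup>2 * ip + al * s\<^sup>2))) * s
           + E t * e * (e * (e\<^sup>2 * ip + al * s\<^sup>2)) = E t * ((e\<^sup>2 + s\<^sup>2) * (e\<^sup>2 * ip - al * s\<^sup>2))"
        by (simp add: power2_eq_square algebra_simps)
      moreover have "E t * ((e\<^sup>2 + s\<^sup>2) * (e\<^sup>2 * ip - al * s\<^sup>2)) = P t - R t"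
        unfolding se P_def R_def using True
        by (simp add: spos_def s_def[symmetric] e_def[symmetric] al_def ip_def algebra_simps)
      ultimately have "((\<lambda>t. E t * cos (\<theta> t) * sin (\<theta> t)) has_real_derivative P t - R t) (at t)"
        by simp
      moreover have "open {s \<in> {T1<..<T2}. \<theta> s \<in> {x. 0 < sin x}}"
        by (intro st open_Collect_less continuous_intros)
      ultimately have "(W has_real_derivative P t - R t) (at t)"
        by (rule has_field_derivative_transform_within_open[where S = "{s \<in> {T1<..<T2}. \<theta> s \<in> {x. 0 < sin x}}"])
          (use True tin in \<open>auto simp: W_def\<close>)
      then show ?thesis by (simp add: has_real_derivative_iff_has_vector_derivative)
    next
      case False
      then have neg: "sin (\<theta> t) < 0" using nz by simp
      then have "P t - R t = 0" by (simp add: P_def R_def spos_def)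
      moreover have "open {s \<in> {T1<..<T2}. \<theta> s \<in> {x. sin x < 0}}"
        by (intro st open_Collect_less continuous_intros)
      then have "(W has_real_derivative 0) (at t)"
        by (rule has_field_derivative_transform_within_open[OF DERIV_const[of 0], where S = "{s \<in> {T1<..<T2}. \<theta> s \<in> {x. sin x < 0}}"])
          (use neg tin in \<open>auto simp: W_def\<close>)
      ultimately show ?thesis by (simp add: has_real_derivative_iff_has_vector_derivative)
    qed
  qed (use T in auto)
  then have int: "((\<lambda>t. P t - R t) has_integral 0) {T1..T2}"
    by (simp add: W_def bc)
  have R_cont: "continuous_on {T1..T2} R"
    unfolding R_def by (intro continuous_intros f E_cont th_cont)
  then have R_int: "R integrable_on {T1..T2}" by (rule integrable_continuous_real)
  have P_int: "P integrable_on {T1..T2}"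
    using integrable_add[OF has_integral_integrable[OF int] R_int] by simp
  have eq: "integral {T1..T2} R = integral {T1..T2} P"
    using integral_diff[OF P_int R_int] integral_unique[OF int] by simp
  have P_nn: "P t \<ge> 0" if "t \<in> {T1..T2}" for t
    using E_pos[OF that] p_pos[OF that] q_nonneg[OF that] by (simp add: P_def less_imp_le)
  \<comment> \<open>The kinetic part without the case distinction: it is continuous and positive at
    \<open>t0\<close>, and it bounds \<open>P\<close> from below on an interval to the right of
    \<open>t0\<close>.\<close>
  define \<rho> where "\<rho> = (\<lambda>t. E t * ((cos (\<theta> t))\<^sup>2 / p t))"
  have t0in: "t0 \<in> {T1..T2}" using t0 by simp
  have \<rho>0: "\<rho> t0 > 0" using E_pos[OF t0in] p_pos[OF t0in] t0 by (simp add: \<rho>_def)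
  have at0: "at t0 within {T1..T2} = at t0" using t0 by (simp add: at_within_Icc_at)
  have "p t \<noteq> 0" if "t \<in> {T1..T2}" for t using p_pos[OF that] by simp
  then have "continuous_on {T1..T2} \<rho>"
    unfolding \<rho>_def by (intro continuous_intros E_cont th_cont p_cont) auto
  then have "(\<rho> \<longlongrightarrow> \<rho> t0) (at t0)"
    unfolding continuous_on_def using t0in at0 by fastforce
  then have ev1: "\<forall>\<^sub>F t in at t0. \<rho> t > \<rho> t0 / 2"
    by (rule order_tendstoD(1)) (use \<rho>0 in simp)
  have "continuous_on {T1..T2} (\<lambda>t. sin (\<theta> t))" by (intro continuous_intros th_cont)
  then have "((\<lambda>t. sin (\<theta> t)) \<longlongrightarrow> sin (\<theta> t0)) (at t0)"
    unfolding continuous_on_def using t0in at0 by fastforce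
  then have ev2: "\<forall>\<^sub>F t in at t0. sin (\<theta> t) > 0"
    by (rule order_tendstoD(1)) (use t0 in simp)
  have "\<forall>\<^sub>F t in at t0. \<rho> t > \<rho> t0 / 2 \<and> sin (\<theta> t) > 0"
    using ev1 ev2 by eventually_elim simp
  then obtain d where d: "d > 0" "\<And>t. t \<noteq> t0 \<Longrightarrow> \<bar>t - t0\<bar> < d \<Longrightarrow> \<rho> t > \<rho> t0 / 2 \<and> sin (\<theta> t) > 0"
    unfolding eventually_at dist_real_def by blast
  define c where "c = min (t0 + d / 2) T2"
  have c: "t0 < c" "c \<le> T2" "c < t0 + d" using d(1) t0 by (auto simp: c_def)
  have sub: "{t0..c} \<subseteq> {T1..T2}" using t0 c by auto
  have Psub: "P integrable_on {t0..c}" by (rule integrable_on_subinterval[OF P_int sub])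
  have low: "\<rho> t0 / 2 \<le> P t" if t: "t \<in> {t0..c}" for t
  proof -
    have tin: "t \<in> {T1..T2}" using sub t by auto
    have "\<rho> t \<ge> \<rho> t0 / 2 \<and> sin (\<theta> t) > 0"
      using d(2)[of t] t c t0(3) \<rho>0 by (cases "t = t0") auto
    moreover have "0 \<le> E t * (q t * (sin (\<theta> t))\<^sup>2)"
      using E_pos[OF tin] q_nonneg[OF tin] by simp
    ultimately show ?thesis
      unfolding P_def \<rho>_def by (simp add: distrib_left)
  qed
  have "0 < \<rho> t0 / 2 * (c - t0)" using \<rho>0 c by simp
  also have "\<dots> = integral {t0..c} (\<lambda>_. \<rho> t0 / 2)" using c by simp
  also have "\<dots> \<le> integral {t0..c} P"
    by (rule integral_le) (use Psub low in auto)
  also have "\<dots> \<le> integral {T1..T2} P"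
    by (rule integral_subset_le[OF sub Psub P_int]) (use P_nn in auto)
  finally show ?thesis using eq by (simp add: R_def)
qed

end

lemma dspos_minus_pi: "dspos (x - pi) = - dspos (- x)" "dspos (- (x - pi)) = - dspos x"
  by (simp_all add: dspos_def)

section \<open>Increments of the final angle in the parameters\<close>

locale weighted_neumann = neumann_data +
  fixes m n :: "real \<Rightarrow> real"
  assumes m_cont: "continuous_on {T1..T2} m" and n_cont: "continuous_on {T1..T2} n"
begin

definition th :: "real \<times> real \<Rightarrow> real \<Rightarrow> real" where
  "th x = angle (\<lambda>t. fst x * m t) (\<lambda>t. snd x * n t)"

lemma fm_cont: "continuous_on {T1..T2} (\<lambda>t. a * m t)" and gn_cont: "continuous_on {T1..T2} (\<lambda>t. b * n t)"
  by (intro continuous_intros m_cont n_cont)+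

lemma th_T1: "th x T1 = pi / 2"
  and th_sol: "angle_sol (\<lambda>t. fst x * m t) (\<lambda>t. snd x * n t) (th x)"
  unfolding th_def by (rule angle_T1 angle_sol_angle, rule fm_cont, rule gn_cont)+

lemma th_cont: "continuous_on {T1..T2} (th x)"
  by (rule angle_sol_cont[OF th_sol])

text \<open>The coefficient of the linear equation for \<open>th y - th x\<close>. Its weights are
  taken at \<open>x\<close>, so the change of parameters appears only in the inhomogeneity, at the
  angle \<open>th y\<close>.\<close>

definition Dc :: "real \<times> real \<Rightarrow> real \<times> real \<Rightarrow> real \<Rightarrow> real" where
  "Dc x y t = (fst x * m t - q t - 1 / p t) * dd_spos (th x t) (th y t)
     - (snd x * n t - q t - 1 / p t) * dd_spos (- th x t) (- th y t)"

lemma th_diff_DERIV: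
  assumes "T1 < t" "t < T2"
  shows "((\<lambda>t. th y t - th x t) has_real_derivative Dc x y t * (th y t - th x t)
     + ((fst y - fst x) * (m t * spos (th y t)) + (snd y - snd x) * (n t * spos (- th y t)))) (at t)"
proof -
  have tin: "t \<in> {T1..T2}" using assms by simp
  have "((\<lambda>t. th y t - th x t) has_real_derivative
    rhs (\<lambda>t. fst y * m t) (\<lambda>t. snd y * n t) t (th y t) - rhs (\<lambda>t. fst x * m t) (\<lambda>t. snd x * n t) t (th x t)) (at t)"
    by (intro DERIV_diff angle_solD_at[OF th_sol] assms)
  moreover have "rhs (\<lambda>t. fst y * m t) (\<lambda>t. snd y * n t) t (th y t) - rhs (\<lambda>t. fst x * m t) (\<lambda>t. snd x * n t) t (th x t)
    = (rhs (\<lambda>t. fst x * m t) (\<lambda>t. snd x * n t) t (th y t) - rhs (\<lambda>t. fst x * m t) (\<lambda>t. snd x * n t) t (th x t))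
     + ((fst y - fst x) * (m t * spos (th y t)) + (snd y - snd x) * (n t * spos (- th y t)))"
    by (simp add: rhs_def algebra_simps)
  ultimately show ?thesis
    by (simp only: rhs_diff[OF tin] Dc_def)
qed

text \<open>Gronwall's inequality for the squared difference. The constant depends on
  \<open>x\<close> alone, because \<open>Dc x y\<close> contains the weights at \<open>x\<close> and
  divided differences that are bounded uniformly.\<close>

lemma th_lipschitz_param:
  obtains C where "C \<ge> 0" "\<And>y t. t \<in> {T1..T2} \<Longrightarrow> \<bar>th y t - th x t\<bar> \<le> C * dist y x"
proof -
  obtain K where K: "K \<ge> 0" and K': "\<And>t u v. t \<in> {T1..T2} \<Longrightarrow>
     \<bar>(fst x * m t - q t - 1 / p t) * dd_spos u v - (snd x * n t - q t - 1 / p t) * dd_spos (- u) (- v)\<bar> \<le> K"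
    by (rule rhs_lipschitz[OF fm_cont gn_cont, of "fst x" "snd x"], rule that)
  have Dc_le: "\<bar>Dc x y t\<bar> \<le> K" if "t \<in> {T1..T2}" for y t
    unfolding Dc_def by (rule K'[OF that])
  have "bounded ((\<lambda>t. \<bar>m t\<bar> + \<bar>n t\<bar>) ` {T1..T2})"
    by (intro compact_imp_bounded compact_continuous_image continuous_on_add continuous_on_rabs
      m_cont n_cont) auto
  then obtain M where "\<forall>v\<in>(\<lambda>t. \<bar>m t\<bar> + \<bar>n t\<bar>) ` {T1..T2}. norm v \<le> M"
    unfolding bounded_iff by blast
  then have M: "\<bar>m t\<bar> + \<bar>n t\<bar> \<le> M" if "t \<in> {T1..T2}" for t
    using that by fastforce
  have "0 \<le> \<bar>m T1\<bar> + \<bar>n T1\<bar>" by simp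
  also have "\<dots> \<le> M" using T by (intro M) simp
  finally have M0: "0 \<le> M" .
  \<comment> \<open>The part \<open>2 * K\<close> comes from the linear term, the 1 from splitting
    \<open>2 * (z s * k s)\<close> into squares.\<close>
  define L where "L = 2 * K + 1"
  define C where "C = sqrt (M\<^sup>2 * (T2 - T1) * exp (L * (T2 - T1)))"
  have C2: "C\<^sup>2 = M\<^sup>2 * (T2 - T1) * exp (L * (T2 - T1))" using T by (simp add: C_def)
  have C0: "C \<ge> 0" using T by (simp add: C_def)
  have "\<bar>th y t - th x t\<bar> \<le> C * dist y x" if t: "t \<in> {T1..T2}" for y t
  proof -
    define c where "c = M * dist y x"
    define z where "z = (\<lambda>s. th y s - th x s)"
    define k where "k = (\<lambda>s. (fst y - fst x) * (m s * spos (th y s)) + (snd y - snd x) * (n s * spos (- th y s)))"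
    have "(z t)\<^sup>2 \<le> ((z T1)\<^sup>2 + c\<^sup>2 * (t - T1)) * exp (L * (t - T1))"
    proof (rule gronwall_le[where y = "\<lambda>s. (z s)\<^sup>2" and y' = "\<lambda>s. 2 * z s * (Dc x y s * z s + k s)"])
      show "continuous_on {T1..t} (\<lambda>s. (z s)\<^sup>2)"
        unfolding z_def by (intro continuous_intros continuous_on_subset[OF th_cont]) (use t in auto)
      fix s assume s: "T1 < s" "s < t"
      then have sin: "s \<in> {T1..T2}" "T1 < s" "s < T2" using t by auto
      have dz: "(z has_real_derivative Dc x y s * z s + k s) (at s)"
        using th_diff_DERIV[OF sin(2,3)] by (simp add: z_def k_def)
      show "((\<lambda>s. (z s)\<^sup>2) has_real_derivative 2 * z s * (Dc x y s * z s + k s)) (at s)"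
        using DERIV_power[OF dz, of 2] by (simp add: mult_ac)
      have "\<bar>k s\<bar> \<le> \<bar>fst y - fst x\<bar> * (\<bar>m s\<bar> * spos (th y s)) + \<bar>snd y - snd x\<bar> * (\<bar>n s\<bar> * spos (- th y s))"
        unfolding k_def by (rule order_trans[OF abs_triangle_ineq]) (simp add: abs_mult spos_nonneg)
      also have "\<dots> \<le> dist y x * (\<bar>m s\<bar> * 1) + dist y x * (\<bar>n s\<bar> * 1)"
        using dist_fst_le[of y x] dist_snd_le[of y x]
        by (intro add_mono mult_mono spos_le_1 mult_nonneg_nonneg spos_nonneg order_refl)
          (auto simp: dist_real_def)
      also have "\<dots> = (\<bar>m s\<bar> + \<bar>n s\<bar>) * dist y x" by (simp add: algebra_simps)
      also have "\<dots> \<le> M * dist y x" using M[OF sin(1)] by (intro mult_right_mono) auto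
      finally have k: "\<bar>k s\<bar> \<le> c" by (simp add: c_def)
      have "z s * (Dc x y s * z s) \<le> K * (z s)\<^sup>2"
      proof -
        have "Dc x y s * (z s)\<^sup>2 \<le> K * (z s)\<^sup>2"
          by (rule mult_right_mono[OF order_trans[OF abs_ge_self Dc_le[OF sin(1)]]]) simp
        then show ?thesis by (simp add: power2_eq_square mult_ac)
      qed
      moreover have "2 * (z s * k s) \<le> (z s)\<^sup>2 + (k s)\<^sup>2"
        using sum_squares_bound[of "z s" "k s"] by (simp add: mult.assoc)
      moreover have "(k s)\<^sup>2 \<le> c\<^sup>2" using power_mono[OF k, of 2] by simp
      moreover have "2 * z s * (Dc x y s * z s + k s) = 2 * (z s * (Dc x y s * z s)) + 2 * (z s * k s)"
        by (simp add: algebra_simps)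
      moreover have "L * (z s)\<^sup>2 = 2 * (K * (z s)\<^sup>2) + (z s)\<^sup>2" by (simp add: L_def algebra_simps)
      ultimately show "2 * z s * (Dc x y s * z s + k s) \<le> L * (z s)\<^sup>2 + c\<^sup>2" by linarith
    qed (use t K in \<open>auto simp: L_def\<close>)
    also have "\<dots> = c\<^sup>2 * (t - T1) * exp (L * (t - T1))" by (simp add: z_def th_T1)
    also have "\<dots> \<le> c\<^sup>2 * (T2 - T1) * exp (L * (T2 - T1))"
    proof (rule mult_mono)
      show "c\<^sup>2 * (t - T1) \<le> c\<^sup>2 * (T2 - T1)" using t by (intro mult_left_mono) auto
      have "L * (t - T1) \<le> L * (T2 - T1)" using t K by (intro mult_left_mono) (auto simp: L_def)
      then show "exp (L * (t - T1)) \<le> exp (L * (T2 - T1))" by simp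
    qed (use T in auto)
    also have "\<dots> = (C * dist y x)\<^sup>2" by (simp add: power_mult_distrib C2 c_def mult_ac)
    finally have "(z t)\<^sup>2 \<le> (C * dist y x)\<^sup>2" .
    then have "\<bar>z t\<bar> \<le> \<bar>C * dist y x\<bar>" by (simp only: abs_le_square_iff)
    then show ?thesis using C0 by (simp add: z_def abs_mult)
  qed
  then show thesis by (rule that[OF C0])
qed

lemma th_jointly_cont: "continuous_on (UNIV \<times> {T1..T2}) (\<lambda>(x, t). th x t)"
  unfolding continuous_on_def
proof
  fix w :: "(real \<times> real) \<times> real" assume w: "w \<in> UNIV \<times> {T1..T2}"
  obtain x t where xt: "w = (x, t)" by (cases w)
  then have t: "t \<in> {T1..T2}" using w by auto
  obtain C where C: "\<And>y s. s \<in> {T1..T2} \<Longrightarrow> \<bar>th y s - th x s\<bar> \<le> C * dist y x"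
    using th_lipschitz_param by metis
  let ?F = "at (x, t) within UNIV \<times> {T1..T2}"
  have "continuous_on (UNIV \<times> {T1..T2}) (\<lambda>z. th x (snd z))"
    by (rule continuous_on_compose2[OF th_cont]) (auto intro!: continuous_intros)
  then have l1: "((\<lambda>z. th x (snd z)) \<longlongrightarrow> th x t) ?F"
    unfolding continuous_on_def using t by fastforce
  have l2: "((\<lambda>z. C * dist (fst z) x) \<longlongrightarrow> C * dist (fst (x, t)) x) ?F"
    by (intro tendsto_intros)
  have "((\<lambda>z. th (fst z) (snd z) - th x (snd z)) \<longlongrightarrow> 0) ?F"
  proof (rule Lim_null_comparison)
    show "\<forall>\<^sub>F z in ?F. norm (th (fst z) (snd z) - th x (snd z)) \<le> C * dist (fst z) x"
      unfolding eventually_at_filter by (rule always_eventually) (use C in auto)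
    show "((\<lambda>z. C * dist (fst z) x) \<longlongrightarrow> 0) ?F" using l2 by simp
  qed
  from tendsto_add[OF this l1] show "((\<lambda>(x, t). th x t) \<longlongrightarrow> (case w of (x, t) \<Rightarrow> th x t)) (at w within UNIV \<times> {T1..T2})"
    by (simp add: xt case_prod_unfold)
qed

lemma th_cont_comp:
  assumes "continuous_on S f" "continuous_on S g" "g ` S \<subseteq> {T1..T2}"
  shows "continuous_on S (\<lambda>z. th (f z) (g z))"
proof -
  have "continuous_on S (\<lambda>z. case (f z, g z) of (x, t) \<Rightarrow> th x t)"
    by (rule continuous_on_compose2[OF th_jointly_cont]) (use assms in \<open>auto intro!: continuous_intros\<close>)
  then show ?thesis by simp
qed

definition G :: "(real \<times> real) \<times> (real \<times> real) \<Rightarrow> real \<Rightarrow> real" where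
  "G z t = integral {T1..t} (Dc (fst z) (snd z))"

lemma Dc_cont: "continuous_on (UNIV \<times> {T1..T2}) (\<lambda>(z, t). Dc (fst z) (snd z) t)"
proof -
  have c: "continuous_on (UNIV \<times> {T1..T2}) (\<lambda>z::((real \<times> real) \<times> (real \<times> real)) \<times> real. w (snd z))" if "continuous_on {T1..T2} w" for w :: "real \<Rightarrow> real"
    by (rule continuous_on_compose2[OF that]) (auto intro!: continuous_intros)
  note c' = c[OF inv_p_cont]
  show ?thesis
    unfolding Dc_def case_prod_unfold
    by (intro continuous_intros c[OF m_cont] c[OF n_cont] c[OF q_cont] c' th_cont_comp) auto
qed

lemma G_cont: "continuous_on (UNIV \<times> {T1..T2}) (\<lambda>(z, t). G z t)"
  unfolding G_def by (rule continuous_on_primitive_param) (use T Dc_cont in auto)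

lemma Dc_cont_t: "continuous_on {T1..T2} (Dc x y)"
proof -
  have "continuous_on {T1..T2} (\<lambda>t. case ((x, y), t) of (z, t) \<Rightarrow> Dc (fst z) (snd z) t)"
    by (rule continuous_on_compose2[OF Dc_cont]) (auto intro!: continuous_intros)
  then show ?thesis by simp
qed

lemma G_DERIV: "t \<in> {T1..T2} \<Longrightarrow> (G (x, y) has_real_derivative Dc x y t) (at t within {T1..T2})"
  unfolding G_def by (simp add: integral_has_real_derivative Dc_cont_t)

text \<open>\<open>A\<close> and \<open>B\<close> are the coefficients from variation of constants:
  the exponential propagates a perturbation at time \<open>t\<close> to \<open>T2\<close>. On the
  diagonal they are the partial derivatives of the final angle.\<close>

definition A :: "(real \<times> real) \<times> (real \<times> real) \<Rightarrow> real" where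
  "A z = integral {T1..T2} (\<lambda>t. m t * (exp (G z T2 - G z t) * spos (th (snd z) t)))"

definition B :: "(real \<times> real) \<times> (real \<times> real) \<Rightarrow> real" where
  "B z = integral {T1..T2} (\<lambda>t. n t * (exp (G z T2 - G z t) * spos (- th (snd z) t)))"

lemma G_cont_comp:
  assumes "continuous_on S f" "continuous_on S g" "g ` S \<subseteq> {T1..T2}"
  shows "continuous_on S (\<lambda>z. G (f z) (g z))"
proof -
  have "continuous_on S (\<lambda>z. case (f z, g z) of (x, t) \<Rightarrow> G x t)"
    by (rule continuous_on_compose2[OF G_cont]) (use assms in \<open>auto intro!: continuous_intros\<close>)
  then show ?thesis by simp
qed

lemma A_cont: "continuous_on UNIV A" and B_cont: "continuous_on UNIV B"
proof -
  have c: "continuous_on (UNIV \<times> cbox T1 T2) (\<lambda>z::((real \<times> real) \<times> (real \<times> real)) \<times> real. w (snd z))" if "continuous_on {T1..T2} w" for w :: "real \<Rightarrow> real"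
    by (rule continuous_on_compose2[OF that]) (auto intro!: continuous_intros)
  have "continuous_on UNIV (\<lambda>z. integral (cbox T1 T2) ((\<lambda>z t. m t * (exp (G z T2 - G z t) * spos (th (snd z) t))) z))"
    by (rule integral_continuous_on_param, unfold case_prod_unfold)
      (intro continuous_intros c[OF m_cont] G_cont_comp th_cont_comp; use T in auto)
  then show "continuous_on UNIV A" unfolding A_def by simp
  have "continuous_on UNIV (\<lambda>z. integral (cbox T1 T2) ((\<lambda>z t. n t * (exp (G z T2 - G z t) * spos (- th (snd z) t))) z))"
    by (rule integral_continuous_on_param, unfold case_prod_unfold)
      (intro continuous_intros c[OF n_cont] G_cont_comp th_cont_comp; use T in auto)
  then show "continuous_on UNIV B" unfolding B_def by simp
qed

text \<open>Multiplication by \<open>E\<close>, which equals 1 at \<open>T2\<close>, removes the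
  linear term. The product vanishes at \<open>T1\<close>, where all angles are
  \<open>pi / 2\<close>.\<close>

lemma th_increment:
  "th y T2 - th x T2 = (fst y - fst x) * A (x, y) + (snd y - snd x) * B (x, y)"
proof -
  define E where "E = (\<lambda>t. exp (G (x, y) T2 - G (x, y) t))"
  have Gc: "continuous_on {T1..T2} (G (x, y))"
    using G_DERIV by (meson DERIV_continuous continuous_on_eq_continuous_within)
  have Ec: "continuous_on {T1..T2} E"
    unfolding E_def by (intro continuous_intros Gc)
  define kA kB where "kA = (\<lambda>t. m t * (E t * spos (th y t)))" and "kB = (\<lambda>t. n t * (E t * spos (- th y t)))"
  have ints: "kA integrable_on {T1..T2}" "kB integrable_on {T1..T2}"
    unfolding kA_def kB_def
    by (intro integrable_continuous_real continuous_intros m_cont n_cont Ec th_cont)+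
  define W where "W = (\<lambda>t. E t * (th y t - th x t))"
  have "((\<lambda>t. (fst y - fst x) * kA t + (snd y - snd x) * kB t) has_integral (W T2 - W T1)) {T1..T2}"
  proof (rule fundamental_theorem_of_calculus_interior)
    show "continuous_on {T1..T2} W" unfolding W_def by (intro continuous_intros Ec th_cont)
    fix t assume t: "t \<in> {T1<..<T2}"
    have "(G (x, y) has_real_derivative Dc x y t) (at t)"
      using G_DERIV[of t x y] t at_within_Icc_at[of T1 t T2] by auto
    then have dE: "(E has_real_derivative - Dc x y t * E t) (at t)"
      unfolding E_def by (auto intro!: derivative_eq_intros)
    have "(W has_real_derivative (fst y - fst x) * kA t + (snd y - snd x) * kB t) (at t)"
      unfolding W_def
      by (rule DERIV_cong[OF DERIV_mult[OF dE th_diff_DERIV]])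
        (use t in \<open>auto simp: kA_def kB_def algebra_simps\<close>)
    then show "(W has_vector_derivative (fst y - fst x) * kA t + (snd y - snd x) * kB t) (at t)"
      by (simp add: has_real_derivative_iff_has_vector_derivative)
  qed (use T in auto)
  moreover have "((\<lambda>t. (fst y - fst x) * kA t + (snd y - snd x) * kB t) has_integral
      ((fst y - fst x) * integral {T1..T2} kA + (snd y - snd x) * integral {T1..T2} kB)) {T1..T2}"
    by (intro has_integral_add has_integral_mult_right integrable_integral ints)
  ultimately have "W T2 - W T1 = (fst y - fst x) * integral {T1..T2} kA + (snd y - snd x) * integral {T1..T2} kB"
    by (rule has_integral_unique)
  moreover have "W T2 = th y T2 - th x T2" "W T1 = 0" by (simp_all add: W_def E_def th_T1)
  ultimately show ?thesis by (simp add: A_def B_def kA_def[symmetric] kB_def[symmetric] E_def kA_def kB_def)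
qed

lemma th_takes_value:
  assumes "pi / 2 < v" "v < th x T2"
  shows "\<exists>t. T1 < t \<and> t < T2 \<and> th x t = v"
proof -
  have "\<exists>t. T1 \<le> t \<and> t \<le> T2 \<and> th x t = v"
    by (rule IVT') (use assms T in \<open>auto simp: th_T1 th_cont\<close>)
  then obtain t where t: "T1 \<le> t" "t \<le> T2" "th x t = v" by auto
  moreover have "t \<noteq> T1" "t \<noteq> T2" using t assms by (auto simp: th_T1)
  ultimately show ?thesis by force
qed

lemma cos_half_pi_plus_multiple: "cos (pi / 2 + real k * pi) = 0"
  by (simp add: cos_add)

text \<open>On the diagonal \<open>E\<close> obeys the equation of r^2, so \<open>energy_pos\<close>
  applies to the angle itself for \<open>a * A\<close> and to the angle shifted by \<open>pi\<close>
  for \<open>b * B\<close>; nonnegativity of \<open>a\<close> and \<open>b\<close> then passes the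
  sign on to \<open>A\<close> and \<open>B\<close>.\<close>

lemma diagonal_pos:
  assumes ab: "a \<ge> 0" "b \<ge> 0" and k: "k \<ge> 1" and z: "th (a, b) T2 = pi / 2 + real k * pi"
  shows A_diagonal_pos: "A ((a, b), (a, b)) > 0" and B_diagonal_pos: "B ((a, b), (a, b)) > 0"
proof -
  define x where "x = (a, b)"
  define E where "E = (\<lambda>t. exp (G (x, x) T2 - G (x, x) t))"
  have Gc: "continuous_on {T1..T2} (G (x, x))"
    using G_DERIV by (meson DERIV_continuous continuous_on_eq_continuous_within)
  have Ec: "continuous_on {T1..T2} E"
    unfolding E_def by (intro continuous_intros Gc)
  have Ep: "E t > 0" for t by (simp add: E_def)
  have sol: "angle_sol (\<lambda>t. a * m t) (\<lambda>t. b * n t) (th x)" using th_sol[of x] by (simp add: x_def)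
  have dE: "(E has_real_derivative - Dc x x t * E t) (at t)" if t: "t \<in> {T1<..<T2}" for t
  proof -
    have "(G (x, x) has_real_derivative Dc x x t) (at t)"
      using G_DERIV[of t x x] t at_within_Icc_at[of T1 t T2] by auto
    then show ?thesis unfolding E_def by (auto intro!: derivative_eq_intros)
  qed
  have k1: "real k * pi \<ge> pi" using k by simp
  \<comment> \<open>At \<open>3 * pi / 4\<close> the solution is positive and not stationary, at
    \<open>pi / 4 + pi\<close> negative and not stationary. Both values are passed because the final
    angle is at least \<open>pi / 2 + pi\<close>.\<close>
  obtain t1 where t1: "T1 < t1" "t1 < T2" "th x t1 = 3 * pi / 4"
    using th_takes_value[of "3 * pi / 4" x] z k1 pi_gt_zero by (auto simp: x_def)
  obtain t2 where t2: "T1 < t2" "t2 < T2" "th x t2 = pi / 4 + pi"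
    using th_takes_value[of "pi / 4 + pi" x] z k1 pi_gt_zero by (auto simp: x_def)
  have bc: "cos (th x T1) = 0" "cos (th x T2) = 0"
    using z cos_half_pi_plus_multiple[of k] by (simp_all add: th_T1 x_def)
  have "integral {T1..T2} (\<lambda>t. a * m t * (E t * spos (th x t))) > 0"
  proof (rule energy_pos[OF fm_cont gn_cont sol Ec Ep _ bc t1(1,2)])
    show "(E has_real_derivative - ((a * m t - q t - 1 / p t) * dspos (th x t)
        - (b * n t - q t - 1 / p t) * dspos (- th x t)) * E t) (at t)" if "t \<in> {T1<..<T2}" for t
      using dE[OF that] by (simp add: Dc_def x_def)
    have "0 < 3 * pi / 4" "3 * pi / 4 < pi" by auto
    then show "sin (th x t1) > 0" unfolding t1(3) by (rule sin_gt_zero)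
    show "cos (th x t1) \<noteq> 0"
      using cos_monotone_0_pi[of "pi / 2" "3 * pi / 4"] unfolding t1(3) by simp
  qed
  then have "a * A (x, x) > 0"
    by (simp add: A_def E_def mult.assoc)
  then show "A ((a, b), (a, b)) > 0" using ab by (simp add: zero_less_mult_iff x_def)
  have "integral {T1..T2} (\<lambda>t. b * n t * (E t * spos (th x t - pi))) > 0"
  proof (rule energy_pos[OF gn_cont fm_cont angle_sol_shift_pi[OF sol] Ec Ep _ _ _ t2(1,2)])
    show "(E has_real_derivative - ((b * n t - q t - 1 / p t) * dspos (th x t - pi)
        - (a * m t - q t - 1 / p t) * dspos (- (th x t - pi))) * E t) (at t)" if "t \<in> {T1<..<T2}" for t
      unfolding dspos_minus_pi using dE[OF that] by (simp add: Dc_def x_def algebra_simps)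
    show "sin (th x t2 - pi) > 0" "cos (th x t2 - pi) \<noteq> 0" unfolding t2(3) by (simp_all add: sin_45 cos_45)
  qed (use bc in simp_all)
  then have "b * B (x, x) > 0"
    by (simp add: B_def E_def mult.assoc spos_minus_pi)
  then show "B ((a, b), (a, b)) > 0" using ab by (simp add: zero_less_mult_iff x_def)
qed

end

section \<open>Solutions in polar coordinates\<close>

text \<open>The system for \<open>u\<close> and \<open>v = p u'\<close> is Lipschitz since the
  positive part is, so the squared distance of two solutions satisfies a homogeneous Gronwall
  inequality. Using \<open>v\<close> avoids differentiating \<open>p\<close>, which is only
  continuous.\<close>

lemma uv_system_unique:
  fixes u v U V f g p q :: "real \<Rightarrow> real"
  assumes T: "T1 < T2"
    and cont: "continuous_on {T1..T2} u" "continuous_on {T1..T2} v" "continuous_on {T1..T2} U" "continuous_on {T1..T2} V"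
    and du: "\<And>t. T1 < t \<Longrightarrow> t < T2 \<Longrightarrow> (u has_real_derivative v t / p t) (at t)"
    and dv: "\<And>t. T1 < t \<Longrightarrow> t < T2 \<Longrightarrow> (v has_real_derivative q t * u t - f t * max (u t) 0 + g t * max (- u t) 0) (at t)"
    and dU: "\<And>t. T1 < t \<Longrightarrow> t < T2 \<Longrightarrow> (U has_real_derivative V t / p t) (at t)"
    and dV: "\<And>t. T1 < t \<Longrightarrow> t < T2 \<Longrightarrow> (V has_real_derivative q t * U t - f t * max (U t) 0 + g t * max (- U t) 0) (at t)"
    and K: "\<And>t. t \<in> {T1..T2} \<Longrightarrow> \<bar>1 / p t\<bar> + \<bar>q t\<bar> + \<bar>f t\<bar> + \<bar>g t\<bar> \<le> K"
    and init: "u T1 = U T1" "v T1 = V T1" and t: "t \<in> {T1..T2}"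
  shows "u t = U t \<and> v t = V t"
proof -
  have "0 \<le> \<bar>1 / p T1\<bar> + \<bar>q T1\<bar> + \<bar>f T1\<bar> + \<bar>g T1\<bar>" by simp
  also have "\<dots> \<le> K" using T by (intro K) simp
  finally have K0: "0 \<le> K" .
  define x z where "x = (\<lambda>s. u s - U s)" and "z = (\<lambda>s. v s - V s)"
  have "(x t)\<^sup>2 + (z t)\<^sup>2 \<le> ((x T1)\<^sup>2 + (z T1)\<^sup>2 + 0 * (t - T1)) * exp (K * (t - T1))"
  proof (rule gronwall_le[where y = "\<lambda>s. (x s)\<^sup>2 + (z s)\<^sup>2"])
    show "continuous_on {T1..t} (\<lambda>s. (x s)\<^sup>2 + (z s)\<^sup>2)"
      unfolding x_def z_def by (intro continuous_intros continuous_on_subset[OF cont(1)]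
        continuous_on_subset[OF cont(2)] continuous_on_subset[OF cont(3)] continuous_on_subset[OF cont(4)]) (use t in auto)
    fix s assume s: "T1 < s" "s < t"
    then have sin: "s \<in> {T1..T2}" "T1 < s" "s < T2" using t by auto
    define D where "D = q s * x s - f s * (max (u s) 0 - max (U s) 0) + g s * (max (- u s) 0 - max (- U s) 0)"
    have dx: "(x has_real_derivative z s / p s) (at s)"
      unfolding x_def z_def using DERIV_diff[OF du[OF sin(2,3)] dU[OF sin(2,3)]] by (simp add: diff_divide_distrib)
    have dz: "(z has_real_derivative D) (at s)"
      unfolding z_def D_def x_def using DERIV_diff[OF dv[OF sin(2,3)] dV[OF sin(2,3)]] by (simp add: algebra_simps)
    show "((\<lambda>s. (x s)\<^sup>2 + (z s)\<^sup>2) has_real_derivative 2 * (x s * (z s / p s)) + 2 * (z s * D)) (at s)"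
      using DERIV_add[OF DERIV_power[OF dx, of 2] DERIV_power[OF dz, of 2]] by (simp add: mult.commute)
    have "\<bar>z s * D + x s * (z s / p s)\<bar> \<le> K * (\<bar>x s\<bar> * \<bar>z s\<bar>)"
    proof -
      have "\<bar>D\<bar> \<le> \<bar>q s\<bar> * \<bar>x s\<bar> + \<bar>f s\<bar> * \<bar>max (u s) 0 - max (U s) 0\<bar> + \<bar>g s\<bar> * \<bar>max (- u s) 0 - max (- U s) 0\<bar>"
        unfolding D_def abs_mult[symmetric] by linarith
      also have "\<dots> \<le> \<bar>q s\<bar> * \<bar>x s\<bar> + \<bar>f s\<bar> * \<bar>x s\<bar> + \<bar>g s\<bar> * \<bar>x s\<bar>"
        by (intro add_mono mult_left_mono) (auto simp: x_def max_def)
      finally have D: "\<bar>D\<bar> \<le> (\<bar>q s\<bar> + \<bar>f s\<bar> + \<bar>g s\<bar>) * \<bar>x s\<bar>" by (simp add: algebra_simps)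
      have "\<bar>z s * D + x s * (z s / p s)\<bar> \<le> \<bar>z s\<bar> * \<bar>D\<bar> + \<bar>1 / p s\<bar> * (\<bar>x s\<bar> * \<bar>z s\<bar>)"
        by (rule order_trans[OF abs_triangle_ineq]) (simp add: abs_mult)
      also have "\<dots> \<le> \<bar>z s\<bar> * ((\<bar>q s\<bar> + \<bar>f s\<bar> + \<bar>g s\<bar>) * \<bar>x s\<bar>) + \<bar>1 / p s\<bar> * (\<bar>x s\<bar> * \<bar>z s\<bar>)"
        by (intro add_right_mono mult_left_mono D) simp
      also have "\<dots> = (\<bar>1 / p s\<bar> + \<bar>q s\<bar> + \<bar>f s\<bar> + \<bar>g s\<bar>) * (\<bar>x s\<bar> * \<bar>z s\<bar>)"
        by (simp add: algebra_simps)
      also have "\<dots> \<le> K * (\<bar>x s\<bar> * \<bar>z s\<bar>)"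
        by (intro mult_right_mono K sin(1)) simp
      finally show ?thesis .
    qed
    moreover have "K * (2 * (\<bar>x s\<bar> * \<bar>z s\<bar>)) \<le> K * ((x s)\<^sup>2 + (z s)\<^sup>2)"
      using sum_squares_bound[of "\<bar>x s\<bar>" "\<bar>z s\<bar>"] by (intro mult_left_mono K0) (simp add: mult.assoc)
    ultimately show "2 * (x s * (z s / p s)) + 2 * (z s * D) \<le> K * ((x s)\<^sup>2 + (z s)\<^sup>2) + 0"
      by (simp add: abs_le_iff)
  qed (use t K0 in auto)
  then have "(x t)\<^sup>2 + (z t)\<^sup>2 \<le> 0" by (simp add: x_def z_def init)
  then have "x t = 0 \<and> z t = 0" by (simp add: sum_power2_le_zero_iff)
  then show ?thesis by (simp add: x_def z_def)
qed

lemma solves_P_uminus: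
  assumes "solves_P T1 T2 p q m n a b u"
  shows "solves_P T1 T2 p q n m b a (\<lambda>t. - u t)"
proof -
  from assms obtain du dv where h:
    "\<And>t. t \<in> {T1..T2} \<Longrightarrow> (u has_real_derivative du t) (at t within {T1..T2})"
    "continuous_on {T1..T2} du"
    "\<And>t. t \<in> {T1<..<T2} \<Longrightarrow> ((\<lambda>s. p s * du s) has_real_derivative dv t) (at t)"
    "\<And>t. t \<in> {T1<..<T2} \<Longrightarrow> - dv t + q t * u t = a * m t * pm_part Plus u t - b * n t * pm_part Minus u t"
    "du T1 = 0" "du T2 = 0"
    unfolding solves_P_def by blast
  show ?thesis
    unfolding solves_P_def
  proof (rule exI[of _ "\<lambda>t. - du t"], rule exI[of _ "\<lambda>t. - dv t"], intro conjI ballI)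
    fix t
    show "((\<lambda>t. - u t) has_real_derivative - du t) (at t within {T1..T2})" if "t \<in> {T1..T2}"
      by (rule DERIV_minus[OF h(1)[OF that]])
    show "((\<lambda>s. p s * - du s) has_real_derivative - dv t) (at t)" if "t \<in> {T1<..<T2}"
      using DERIV_minus[OF h(3)[OF that]] by simp
    show "- (- dv t) + q t * - u t = b * n t * pm_part Plus (\<lambda>t. - u t) t - a * m t * pm_part Minus (\<lambda>t. - u t) t"
      if "t \<in> {T1<..<T2}"
      using h(4)[OF that] by (simp add: pm_part_def)
  qed (use h in \<open>auto intro!: continuous_intros\<close>)
qed

fun opp :: "pm \<Rightarrow> pm" where
  "opp Plus = Minus"
| "opp Minus = Plus"

lemma opp_eq_Plus: "opp s = Plus \<longleftrightarrow> s \<noteq> Plus" and opp_opp [simp]: "opp (opp s) = s"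
  by (cases s; simp)+

lemma C_set_swapD:
  assumes "(a, b) \<in> C_set T1 T2 p q m n s k"
  shows "(b, a) \<in> C_set T1 T2 p q n m (opp s) k"
proof -
  from assms obtain u where u: "solves_P T1 T2 p q m n a b u" "not_ident_zero T1 T2 u"
    "finite {t\<in>{T1<..<T2}. u t = 0}" "card {t\<in>{T1<..<T2}. u t = 0} = k"
    "case s of Plus \<Rightarrow> u T2 > 0 | Minus \<Rightarrow> u T2 < 0"
    by (auto simp: C_set_def)
  then show ?thesis
    unfolding C_set_def
    by (auto intro!: exI[of _ "\<lambda>t. - u t"] solves_P_uminus simp: not_ident_zero_def split: pm.splits)
qed

context weighted_neumann
begin

lemma th_pos: "t \<in> {T1..T2} \<Longrightarrow> th x t > 0"
proof -
  assume t: "t \<in> {T1..T2}"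
  have "th x T1 > 0" unfolding th_T1 by (rule pi_half_gt_zero)
  then show "th x t > 0"
    using angle_above_multiple_pi[OF fm_cont gn_cont th_sol, of T1 t 0 x] t by (cases "t = T1") auto
qed

text \<open>The multiples of \<open>pi\<close> met inside are exactly the first \<open>j\<close>
  positive ones: each is taken by continuity and only once, and a larger one would push the final
  angle above its value.\<close>

lemma th_zero_count:
  assumes "cos (th x T2) = 0"
  shows "\<exists>j::nat. th x T2 = pi / 2 + j * pi \<and> finite {t \<in> {T1<..<T2}. sin (th x t) = 0}
    \<and> card {t \<in> {T1<..<T2}. sin (th x t) = 0} = j \<and> sin (th x T2) = (- 1) ^ j"
proof -
  obtain i :: int where i: "th x T2 = i * pi + pi / 2"
    using assms by (auto simp: cos_zero_iff_int2)
  have "0 < (i + 1 / 2) * pi" using th_pos[of T2 x] T i by (simp add: algebra_simps)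
  then have "i \<ge> 0" by (simp add: zero_less_mult_iff)
  define j where "j = nat i"
  have j: "th x T2 = pi / 2 + real j * pi" using i \<open>i \<ge> 0\<close> by (simp add: j_def)
  define Z where "Z = {t \<in> {T1<..<T2}. sin (th x t) = 0}"
  have sub: "Z \<subseteq> {t \<in> {T1..T2}. sin (th x t) = 0}" by (auto simp: Z_def)
  have fin: "finite Z" by (rule finite_subset[OF sub finite_angle_zeros(1)[OF fm_cont gn_cont th_sol]])
  have inj: "inj_on (th x) Z" by (rule inj_on_subset[OF finite_angle_zeros(2)[OF fm_cont gn_cont th_sol] sub])
  have img: "th x ` Z = (\<lambda>i::nat. i * pi) ` {1..j}"
  proof (intro set_eqI iffI)
    fix y assume "y \<in> th x ` Z"
    then obtain t where t: "T1 < t" "t < T2" "y = th x t" "sin y = 0" by (auto simp: Z_def)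
    obtain l :: int where l: "y = l * pi" using t(4) by (auto simp: sin_zero_iff_int2)
    have "0 < l * pi" using th_pos[of t x] t l by simp
    then have l1: "l \<ge> 1" by (simp add: zero_less_mult_iff)
    have "th x T2 > l * pi"
      using angle_above_multiple_pi[OF fm_cont gn_cont th_sol, of t T2 l x] t l by simp
    then have "(real_of_int l) * pi < (real j + 1 / 2) * pi" using j by (simp add: algebra_simps)
    then have "real_of_int l < real j + 1 / 2" by simp
    then have "l \<le> int j" by linarith
    then show "y \<in> (\<lambda>i::nat. i * pi) ` {1..j}"
      using l l1 by (intro image_eqI[of _ _ "nat l"]) auto
  next
    fix y assume "y \<in> (\<lambda>i::nat. i * pi) ` {1..j}"
    then obtain l :: nat where l: "y = l * pi" "1 \<le> l" "l \<le> j" by auto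
    have "1 * pi \<le> real l * pi" "real l * pi \<le> real j * pi" using l by (intro mult_right_mono; simp)+
    then have "pi / 2 < y" "y < th x T2" unfolding l(1) j using pi_gt_zero by linarith+
    then obtain t where "T1 < t" "t < T2" "th x t = y" using th_takes_value by blast
    then have "t \<in> Z" by (simp add: Z_def l)
    with \<open>th x t = y\<close> show "y \<in> th x ` Z" by blast
  qed
  have "card Z = card (th x ` Z)" by (simp add: card_image inj)
  also have "\<dots> = j" unfolding img by (subst card_image) (auto simp: inj_on_def)
  finally have "card Z = j" .
  moreover have "sin (th x T2) = (- 1) ^ j" unfolding j by (simp add: sin_add)
  ultimately show ?thesis using j fin unfolding Z_def by blast
qed

text \<open>The radial equation is linear in the radius, so it is solved explicitly by an
  exponential, normalised to 1 at \<open>T1\<close>.\<close>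

definition radius :: "real \<times> real \<Rightarrow> real \<Rightarrow> real" where
  "radius x t = exp (integral {T1..t} (\<lambda>t. sin (th x t) * cos (th x t) * (1 / p t + q t)
      - fst x * m t * (max 0 (sin (th x t)) * cos (th x t)) + snd x * n t * (max 0 (- sin (th x t)) * cos (th x t))))"

lemma polar_solution:
  fixes x :: "real \<times> real"
  assumes t: "t \<in> {T1..T2}"
  defines "U \<equiv> \<lambda>t. radius x t * sin (th x t)" and "V \<equiv> \<lambda>t. radius x t * cos (th x t)"
  shows "(U has_real_derivative V t / p t) (at t within {T1..T2})"
    and "(V has_real_derivative q t * U t - fst x * m t * max (U t) 0 + snd x * n t * max (- U t) 0) (at t within {T1..T2})"
proof -
  define \<rho> where "\<rho> = (\<lambda>t. sin (th x t) * cos (th x t) * (1 / p t + q t)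
      - fst x * m t * (max 0 (sin (th x t)) * cos (th x t)) + snd x * n t * (max 0 (- sin (th x t)) * cos (th x t)))"
  have "continuous_on {T1..T2} \<rho>"
    unfolding \<rho>_def by (intro continuous_on_add continuous_on_diff continuous_on_mult continuous_on_max
      continuous_on_sin continuous_on_cos continuous_on_minus continuous_on_const th_cont inv_p_cont q_cont m_cont n_cont)
  then have "((\<lambda>t. integral {T1..t} \<rho>) has_real_derivative \<rho> t) (at t within {T1..T2})"
    using t by (rule integral_has_real_derivative)
  then have dr: "(radius x has_real_derivative radius x t * \<rho> t) (at t within {T1..T2})"
    unfolding radius_def[abs_def] \<rho>_def[symmetric] by (auto intro!: derivative_eq_intros)
  define s e where "s = sin (th x t)" and "e = cos (th x t)"
  define r where "r = radius x t"
  have r0: "r > 0" by (simp add: r_def radius_def)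
  define ip where "ip = 1 / p t"
  define R where "R = rhs (\<lambda>t. fst x * m t) (\<lambda>t. snd x * n t) t (th x t)"
  have dth: "(th x has_real_derivative R) (at t within {T1..T2})"
    using th_sol[of x] t unfolding angle_sol_def R_def by blast
  have ds: "((\<lambda>t. sin (th x t)) has_real_derivative e * R) (at t within {T1..T2})"
    and dc: "((\<lambda>t. cos (th x t)) has_real_derivative - s * R) (at t within {T1..T2})"
    unfolding s_def e_def
    by (rule DERIV_chain2[OF DERIV_sin dth]) (rule DERIV_chain2[OF DERIV_cos dth])
  define f g where "f = fst x * m t" and "g = snd x * n t"
  define sp sm where "sp = max 0 s" and "sm = max 0 (- s)"
  \<comment> \<open>Splitting the sine into two parts with product 0 reduces both derivative
    formulas to polynomial identities modulo \<open>e\<^sup>2 + s\<^sup>2 = 1\<close>.\<close>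
  have s_eq: "s = sp - sm" "sp * sm = 0" by (auto simp: sp_def sm_def)
  have R: "R = e\<^sup>2 * ip - q t * s\<^sup>2 + f * sp\<^sup>2 + g * sm\<^sup>2"
    by (simp add: R_def rhs_def ip_def s_def e_def spos_def sp_def sm_def f_def g_def)
  have \<rho>: "\<rho> t = s * e * (ip + q t) - f * (sp * e) + g * (sm * e)"
    by (simp add: \<rho>_def s_def e_def ip_def sp_def sm_def f_def g_def)
  have se: "e\<^sup>2 + s\<^sup>2 = 1" by (simp add: s_def e_def)
  have ss: "s * sp = sp\<^sup>2" "s * sm = - sm\<^sup>2" using s_eq(2) by (simp_all add: s_eq(1) power2_eq_square algebra_simps)
  have "r * \<rho> t * s + e * R * r = r * (e * ip)"
  proof -
    have "\<rho> t * s + e * R = e * ip * (e\<^sup>2 + s\<^sup>2) + e * (f * (sp\<^sup>2 - s * sp) + g * (sm\<^sup>2 + s * sm))"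
      unfolding \<rho> R by (simp add: power2_eq_square algebra_simps)
    then have "\<rho> t * s + e * R = e * ip" unfolding se ss by simp
    then show ?thesis by (metis distrib_left mult.commute mult.assoc)
  qed
  then show "(U has_real_derivative V t / p t) (at t within {T1..T2})"
    unfolding U_def V_def using DERIV_mult[OF dr ds]
    by (simp add: r_def[symmetric] s_def[symmetric] e_def[symmetric] ip_def)
  have "r * \<rho> t * e + - s * R * r = q t * (r * s) - f * (r * sp) + g * (r * sm)"
  proof -
    have "\<rho> t * e - s * R = s * e\<^sup>2 * q t + q t * s * s\<^sup>2 - f * (sp * e\<^sup>2 + (s * sp) * sp) + g * (sm * e\<^sup>2 - (s * sm) * sm)"
      unfolding \<rho> R by (simp add: power2_eq_square algebra_simps)
    also have "(s * sp) * sp = sp * s\<^sup>2"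
      by (auto simp: sp_def max_def power2_eq_square)
    also have "(s * sm) * sm = - (sm * s\<^sup>2)"
      by (auto simp: sm_def max_def power2_eq_square)
    finally have "\<rho> t * e - s * R = (e\<^sup>2 + s\<^sup>2) * (q t * s - f * sp + g * sm)"
      by (simp add: algebra_simps)
    then have "\<rho> t * e - s * R = q t * s - f * sp + g * sm" by (simp add: se)
    then have "r * (\<rho> t * e - s * R) = r * (q t * s - f * sp + g * sm)" by simp
    then show ?thesis by (simp add: algebra_simps)
  qed
  moreover have "max (r * s) 0 = r * sp" "max (- (r * s)) 0 = r * sm"
    using r0 by (auto simp: sp_def sm_def max_def mult_le_0_iff zero_le_mult_iff)
  ultimately show "(V has_real_derivative q t * U t - fst x * m t * max (U t) 0 + snd x * n t * max (- U t) 0) (at t within {T1..T2})"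
    unfolding U_def V_def using DERIV_mult[OF dr dc]
    by (simp add: r_def[symmetric] s_def[symmetric] e_def[symmetric] f_def[symmetric] g_def[symmetric])
qed

end

section \<open>The curves as level sets of the final angle\<close>

lemma neg_one_power_pos_iff: "(- 1 :: real) ^ k > 0 \<longleftrightarrow> even k" "(- 1 :: real) ^ k < 0 \<longleftrightarrow> odd k"
  by (cases "even k"; simp)+

context weighted_neumann
begin

lemma coefficients_bounded:
  "\<exists>K. \<forall>t\<in>{T1..T2}. \<bar>1 / p t\<bar> + \<bar>q t\<bar> + \<bar>a * m t\<bar> + \<bar>b * n t\<bar> \<le> K"
proof -
  have "bounded ((\<lambda>t. \<bar>1 / p t\<bar> + \<bar>q t\<bar> + \<bar>a * m t\<bar> + \<bar>b * n t\<bar>) ` {T1..T2})"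
    by (intro compact_imp_bounded compact_continuous_image continuous_on_add continuous_on_rabs
      inv_p_cont q_cont fm_cont gn_cont) auto
  then obtain K where "\<forall>v\<in>(\<lambda>t. \<bar>1 / p t\<bar> + \<bar>q t\<bar> + \<bar>a * m t\<bar> + \<bar>b * n t\<bar>) ` {T1..T2}. norm v \<le> K"
    unfolding bounded_iff by blast
  then show ?thesis by (intro exI[of _ K]) fastforce
qed

lemma solves_P_polar:
  assumes sol: "solves_P T1 T2 p q m n a b u" and pos: "u T1 \<ge> 0" and t: "t \<in> {T1..T2}"
  shows "u t = u T1 * radius (a, b) t * sin (th (a, b) t)"
    and "cos (th (a, b) T2) = 0 \<or> u T1 = 0"
proof -
  from sol obtain du dv where h:
    "\<And>t. t \<in> {T1..T2} \<Longrightarrow> (u has_real_derivative du t) (at t within {T1..T2})"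
    "continuous_on {T1..T2} du"
    "\<And>t. t \<in> {T1<..<T2} \<Longrightarrow> ((\<lambda>s. p s * du s) has_real_derivative dv t) (at t)"
    "\<And>t. t \<in> {T1<..<T2} \<Longrightarrow> - dv t + q t * u t = a * m t * pm_part Plus u t - b * n t * pm_part Minus u t"
    "du T1 = 0" "du T2 = 0"
    unfolding solves_P_def by blast
  let ?x = "(a, b)"
  define c where "c = u T1"
  have c0: "c \<ge> 0" using pos by (simp add: c_def)
  define U V where "U = (\<lambda>t. c * (radius ?x t * sin (th ?x t)))" and "V = (\<lambda>t. c * (radius ?x t * cos (th ?x t)))"
  have dU: "(U has_real_derivative V t / p t) (at t within {T1..T2})" if "t \<in> {T1..T2}" for t
    unfolding U_def V_def using DERIV_cmult[OF polar_solution(1)[OF that, of ?x], of c] by simp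
  have mx: "max (c * y) 0 = c * max y 0" "max (- (c * y)) 0 = c * max (- y) 0" for y
    using c0 by (simp_all add: max_mult_distrib_left)
  have dV: "(V has_real_derivative q t * U t - a * m t * max (U t) 0 + b * n t * max (- U t) 0) (at t within {T1..T2})" if "t \<in> {T1..T2}" for t
    unfolding U_def V_def mx using DERIV_cmult[OF polar_solution(2)[OF that, of ?x], of c] by (simp add: algebra_simps)
  obtain K where K: "\<And>t. t \<in> {T1..T2} \<Longrightarrow> \<bar>1 / p t\<bar> + \<bar>q t\<bar> + \<bar>a * m t\<bar> + \<bar>b * n t\<bar> \<le> K"
    using coefficients_bounded[of a b] by blast
  have uc: "continuous_on {T1..T2} u"
    using h(1) by (meson DERIV_continuous continuous_on_eq_continuous_within)
  have Uc: "continuous_on {T1..T2} U"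
    using dU by (meson DERIV_continuous continuous_on_eq_continuous_within)
  have Vc: "continuous_on {T1..T2} V"
    using dV by (meson DERIV_continuous continuous_on_eq_continuous_within)
  have at: "at t within {T1..T2} = at t" if "T1 < t" "t < T2" for t
    using that by (rule at_within_Icc_at)
  have eq: "u t = U t \<and> p t * du t = V t" if t: "t \<in> {T1..T2}" for t
  proof (rule uv_system_unique[OF T uc _ Uc Vc _ _ _ _ K _ _ t, where v = "\<lambda>t. p t * du t"])
    show "continuous_on {T1..T2} (\<lambda>t. p t * du t)" by (intro continuous_intros p_cont h(2))
    fix s assume s: "T1 < s" "s < T2"
    then have sin: "s \<in> {T1..T2}" "s \<in> {T1<..<T2}" by auto
    show "(u has_real_derivative p s * du s / p s) (at s)"
      using h(1)[OF sin(1)] p_pos[OF sin(1)] at[OF s] by simp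
    show "((\<lambda>t. p t * du t) has_real_derivative q s * u s - a * m s * max (u s) 0 + b * n s * max (- u s) 0) (at s)"
      using h(3)[OF sin(2)] h(4)[OF sin(2)] by (simp add: pm_part_def algebra_simps)
    show "(U has_real_derivative V s / p s) (at s)" using dU[OF sin(1)] at[OF s] by simp
    show "(V has_real_derivative q s * U s - a * m s * max (U s) 0 + b * n s * max (- U s) 0) (at s)"
      using dV[OF sin(1)] at[OF s] by simp
  next
    show "u T1 = U T1" by (simp add: U_def th_T1 radius_def c_def)
    show "p T1 * du T1 = V T1" by (simp add: V_def th_T1 h(5))
  qed
  show "u t = u T1 * radius ?x t * sin (th ?x t)" using eq[OF t] by (simp add: U_def c_def)
  have "V T2 = 0" using eq[of T2] T h(6) by simp
  then show "cos (th ?x T2) = 0 \<or> u T1 = 0" by (auto simp: V_def c_def radius_def)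
qed

lemma solves_P_angle:
  assumes sol: "solves_P T1 T2 p q m n a b u" and pos: "u T1 > 0"
    and k: "card {t\<in>{T1<..<T2}. u t = 0} = k" and s: "case s of Plus \<Rightarrow> u T2 > 0 | Minus \<Rightarrow> u T2 < 0"
  shows "(s = Plus \<longleftrightarrow> even k) \<and> th (a, b) T2 = pi / 2 + real k * pi"
proof -
  note u = solves_P_polar[OF sol less_imp_le[OF pos]]
  have T2in: "T2 \<in> {T1..T2}" using T by simp
  have rp: "u T1 * radius (a, b) t > 0" for t using pos by (simp add: radius_def)
  obtain j :: nat where j: "th (a, b) T2 = pi / 2 + real j * pi"
    "card {t \<in> {T1<..<T2}. sin (th (a, b) t) = 0} = j" "sin (th (a, b) T2) = (- 1) ^ j"
  proof -
    have "cos (th (a, b) T2) = 0" using u(2)[OF T2in] pos by simp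
    from th_zero_count[OF this] show thesis using that by blast
  qed
  have "{t\<in>{T1<..<T2}. u t = 0} = {t \<in> {T1<..<T2}. sin (th (a, b) t) = 0}"
  proof -
    have "u t = 0 \<longleftrightarrow> sin (th (a, b) t) = 0" if "t \<in> {T1<..<T2}" for t
    proof -
      have "t \<in> {T1..T2}" using that by simp
      from u(1)[OF this] rp[of t] show ?thesis by auto
    qed
    then show ?thesis by blast
  qed
  then have "k = j" using j k by simp
  moreover have "u T2 > 0 \<longleftrightarrow> even j" "u T2 < 0 \<longleftrightarrow> odd j"
  proof -
    have "c * y > 0 \<longleftrightarrow> y > 0" "c * y < 0 \<longleftrightarrow> y < 0" if "c > 0" for c y :: real
      using that by (auto simp: zero_less_mult_iff mult_less_0_iff)
    from this[OF rp] show "u T2 > 0 \<longleftrightarrow> even j" "u T2 < 0 \<longleftrightarrow> odd j"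
      unfolding u(1)[OF T2in] j(3) by (simp_all add: neg_one_power_pos_iff)
  qed
  ultimately show ?thesis using s j(1) by (cases s) auto
qed

lemma C_set_of_angle:
  assumes th: "th (a, b) T2 = pi / 2 + real k * pi" and s: "s = Plus \<longleftrightarrow> even k"
  shows "(a, b) \<in> C_set T1 T2 p q m n s k"
proof -
  let ?x = "(a, b)"
  define U V where "U = (\<lambda>t. radius ?x t * sin (th ?x t))" and "V = (\<lambda>t. radius ?x t * cos (th ?x t))"
  have dU: "(U has_real_derivative V t / p t) (at t within {T1..T2})" if "t \<in> {T1..T2}" for t
    unfolding U_def V_def by (rule polar_solution(1)[OF that])
  have dV: "(V has_real_derivative q t * U t - a * m t * max (U t) 0 + b * n t * max (- U t) 0) (at t within {T1..T2})" if "t \<in> {T1..T2}" for t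
    unfolding U_def V_def using polar_solution(2)[OF that, of ?x] by simp
  have cos0: "cos (th ?x T2) = 0" unfolding th by (rule cos_half_pi_plus_multiple)
  obtain j :: nat where j: "th ?x T2 = pi / 2 + real j * pi" "finite {t \<in> {T1<..<T2}. sin (th ?x t) = 0}"
    "card {t \<in> {T1<..<T2}. sin (th ?x t) = 0} = j" "sin (th ?x T2) = (- 1) ^ j"
    using th_zero_count[OF cos0] by blast
  have "j = k" using th j(1) by simp
  have rp: "radius ?x t > 0" for t by (simp add: radius_def)
  have Vc: "continuous_on {T1..T2} V"
    using dV by (meson DERIV_continuous continuous_on_eq_continuous_within)
  have pz: "p t \<noteq> 0" if "t \<in> {T1..T2}" for t using p_pos[OF that] by simp
  have "solves_P T1 T2 p q m n a b U"
    unfolding solves_P_def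
  proof (rule exI[of _ "\<lambda>t. V t / p t"],
      rule exI[of _ "\<lambda>t. q t * U t - a * m t * max (U t) 0 + b * n t * max (- U t) 0"], intro conjI ballI)
    show "continuous_on {T1..T2} (\<lambda>t. V t / p t)"
      by (intro continuous_on_divide Vc p_cont) (use pz in blast)
    fix t
    show "(U has_real_derivative V t / p t) (at t within {T1..T2})" if "t \<in> {T1..T2}" by (rule dU[OF that])
    show "((\<lambda>s. p s * (V s / p s)) has_real_derivative
        q t * U t - a * m t * max (U t) 0 + b * n t * max (- U t) 0) (at t)" if t: "t \<in> {T1<..<T2}"
    proof (rule has_field_derivative_transform_within_open[where S = "{T1<..<T2}"])
      show "(V has_real_derivative q t * U t - a * m t * max (U t) 0 + b * n t * max (- U t) 0) (at t)"
        using dV[of t] t at_within_Icc_at[of T1 t T2] by auto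
      show "V s = p s * (V s / p s)" if "s \<in> {T1<..<T2}" for s using pz[of s] that by simp
    qed (use t in auto)
    show "- (q t * U t - a * m t * max (U t) 0 + b * n t * max (- U t) 0) + q t * U t
       = a * m t * pm_part Plus U t - b * n t * pm_part Minus U t"
      by (simp add: pm_part_def)
  qed (simp_all add: V_def th_T1 cos0)
  moreover have "not_ident_zero T1 T2 U"
    unfolding not_ident_zero_def using T by (intro bexI[of _ T1]) (simp_all add: U_def th_T1 radius_def)
  moreover have Z: "{t\<in>{T1<..<T2}. U t = 0} = {t \<in> {T1<..<T2}. sin (th ?x t) = 0}"
  proof -
    have "U t = 0 \<longleftrightarrow> sin (th ?x t) = 0" for t using rp[of t] by (simp add: U_def)
    then show ?thesis by simp
  qed
  moreover have "finite {t\<in>{T1<..<T2}. U t = 0}" "card {t\<in>{T1<..<T2}. U t = 0} = k"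
    unfolding Z using j(2,3) \<open>j = k\<close> by simp_all
  moreover have "U T2 > 0 \<longleftrightarrow> even k" "U T2 < 0 \<longleftrightarrow> odd k"
    using rp[of T2] j(4) \<open>j = k\<close>
    by (simp_all add: U_def zero_less_mult_iff mult_less_0_iff neg_one_power_pos_iff)
  then have "case s of Plus \<Rightarrow> U T2 > 0 | Minus \<Rightarrow> U T2 < 0"
    using s by (cases s) simp_all
  ultimately show ?thesis
    unfolding C_set_def mem_Collect_eq prod.case by blast
qed

lemma swapped: "weighted_neumann T1 T2 p q n m"
  by unfold_locales (rule n_cont m_cont)+

text \<open>A nontrivial solution does not vanish at \<open>T1\<close>. If it starts positive, its
  final sign is fixed by the parity of \<open>k\<close>; in the other case \<open>- u\<close> starts
  positive and solves the problem with exchanged weights.\<close>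

lemma C_set_iff:
  "(a, b) \<in> C_set T1 T2 p q m n s k \<longleftrightarrow>
    (if s = Plus \<longleftrightarrow> even k then th (a, b) T2 = pi / 2 + real k * pi
     else weighted_neumann.th T1 T2 p q n m (b, a) T2 = pi / 2 + real k * pi)"
proof -
  interpret sw: weighted_neumann T1 T2 p q n m by (rule swapped)
  show ?thesis
  proof
    assume "(a, b) \<in> C_set T1 T2 p q m n s k"
    then obtain u where u: "solves_P T1 T2 p q m n a b u" "not_ident_zero T1 T2 u"
      "card {t\<in>{T1<..<T2}. u t = 0} = k" "case s of Plus \<Rightarrow> u T2 > 0 | Minus \<Rightarrow> u T2 < 0"
      unfolding C_set_def mem_Collect_eq prod.case by blast
    have "u T1 \<noteq> 0"
    proof
      assume 0: "u T1 = 0"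
      have "u t = 0" if "t \<in> {T1..T2}" for t
        using solves_P_polar(1)[OF u(1) _ that] 0 by simp
      then show False using u(2) by (auto simp: not_ident_zero_def)
    qed
    then consider "u T1 > 0" | "u T1 < 0" by linarith
    then show "if s = Plus \<longleftrightarrow> even k then th (a, b) T2 = pi / 2 + real k * pi
        else sw.th (b, a) T2 = pi / 2 + real k * pi"
    proof cases
      case 1
      show ?thesis using solves_P_angle[OF u(1) 1 u(3,4)] by simp
    next
      case 2
      have "(opp s = Plus \<longleftrightarrow> even k) \<and> sw.th (b, a) T2 = pi / 2 + real k * pi"
      proof (rule sw.solves_P_angle[OF solves_P_uminus[OF u(1)]])
        show "case opp s of Plus \<Rightarrow> - u T2 > 0 | Minus \<Rightarrow> - u T2 < 0"
          using u(4) by (cases s) simp_all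
      qed (use 2 u(3) in simp_all)
      then have "\<not> (s = Plus \<longleftrightarrow> even k)" "sw.th (b, a) T2 = pi / 2 + real k * pi"
        unfolding opp_eq_Plus by blast+
      then show ?thesis by (simp only: if_False)
    qed
  next
    assume r: "if s = Plus \<longleftrightarrow> even k then th (a, b) T2 = pi / 2 + real k * pi
        else sw.th (b, a) T2 = pi / 2 + real k * pi"
    show "(a, b) \<in> C_set T1 T2 p q m n s k"
    proof (cases "s = Plus \<longleftrightarrow> even k")
      case True
      then show ?thesis using r C_set_of_angle by simp
    next
      case False
      then have "(b, a) \<in> C_set T1 T2 p q n m (opp s) k"
        using r by (intro sw.C_set_of_angle) (simp_all add: opp_eq_Plus)
      from C_set_swapD[OF this] show ?thesis by simp
    qed
  qed
qed

text \<open>\<open>Suc k\<close> zeros bound \<open>Suc (Suc k)\<close> arches, so points of both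
  kinds occur and both parameters are nonzero. The hypothesis is an inequality so that its
  contrapositive bounds the angle on the axes.\<close>

lemma alternates_of_th:
  assumes "a \<ge> 0" "b \<ge> 0" "th (a, b) T2 \<ge> pi / 2 + real (Suc k) * pi"
  shows "a > 0" "b > 0" "alternates T2 m n (Suc (Suc k)) T1"
proof -
  have alt: "alternates T2 (\<lambda>t. a * m t) (\<lambda>t. b * n t) (Suc (Suc k)) T1"
    using th_sol[of "(a, b)"] T assms(3)
    by (intro alternates_of_angle[OF fm_cont gn_cont, where \<theta> = "th (a, b)"]) (auto simp: th_T1 add.commute)
  show "alternates T2 m n (Suc (Suc k)) T1" by (rule alternates_scaleD[OF assms(1,2) alt])
  from alt obtain x y where "a * m x > 0" "b * n y > 0" unfolding alternates.simps by blast
  then show "a > 0" "b > 0" using assms(1,2) by (auto simp: zero_less_mult_iff)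
qed

lemma th_value_iff_alternates:
  "(\<exists>a\<ge>0. \<exists>b\<ge>0. th (a, b) T2 = pi / 2 + real (Suc k) * pi) \<longleftrightarrow> alternates T2 m n (Suc (Suc k)) T1"
proof
  assume "\<exists>a\<ge>0. \<exists>b\<ge>0. th (a, b) T2 = pi / 2 + real (Suc k) * pi"
  then show "alternates T2 m n (Suc (Suc k)) T1" using alternates_of_th(3) by force
next
  assume "alternates T2 m n (Suc (Suc k)) T1"
  then obtain L where L: "L \<ge> 0" "\<And>\<theta>. angle_sol (\<lambda>t. L * m t) (\<lambda>t. L * n t) \<theta> \<Longrightarrow> \<theta> T1 \<ge> 0 \<Longrightarrow> \<theta> T2 \<ge> real (Suc (Suc k)) * pi"
    using large_weights_angle[OF m_cont n_cont, of "Suc (Suc k)" T1] T by auto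
  \<comment> \<open>One point per arch completes even the last arch, which overshoots the target by
    \<open>pi / 2\<close>; the exact value is then found on the diagonal between
    \<open>(0, 0)\<close> and \<open>(L, L)\<close>.\<close>
  have "th (L, L) T2 \<ge> real (Suc (Suc k)) * pi"
    using L(2)[of "th (L, L)"] th_sol[of "(L, L)"] by (simp add: th_T1)
  then have hi: "th (L, L) T2 \<ge> pi / 2 + real (Suc k) * pi"
  proof -
    have "real (Suc (Suc k)) * pi = pi + real (Suc k) * pi" by (simp add: algebra_simps)
    then show ?thesis using \<open>th (L, L) T2 \<ge> real (Suc (Suc k)) * pi\<close> pi_gt_zero by linarith
  qed
  \<comment> \<open>A larger value at the origin would, by \<open>alternates_of_th\<close>, make the
    parameter 0 positive.\<close>
  have lo: "th (0, 0) T2 \<le> pi / 2 + real (Suc k) * pi"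
    using alternates_of_th(1)[of 0 0 k] by force
  have "\<exists>x. 0 \<le> x \<and> x \<le> L \<and> th (x, x) T2 = pi / 2 + real (Suc k) * pi"
    by (rule IVT') (use hi lo L(1) T in \<open>auto intro!: th_cont_comp continuous_intros\<close>)
  then show "\<exists>a\<ge>0. \<exists>b\<ge>0. th (a, b) T2 = pi / 2 + real (Suc k) * pi" by blast
qed

lemma increment_form_th:
  "increment_form (\<lambda>a b. th (a, b) T2 - (pi / 2 + real (Suc k) * pi)) A B"
proof
  show "continuous_on UNIV A" "continuous_on UNIV B" by (rule A_cont B_cont)+
  fix a b a' b' :: real
  show "th (a', b') T2 - (pi / 2 + real (Suc k) * pi) - (th (a, b) T2 - (pi / 2 + real (Suc k) * pi))
      = (a' - a) * A ((a, b), (a', b')) + (b' - b) * B ((a, b), (a', b'))"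
    using th_increment[of "(a', b')" "(a, b)"] by simp
  show "A ((a, b), (a, b)) > 0" "B ((a, b), (a, b)) > 0"
    if "a \<ge> 0" "b \<ge> 0" "th (a, b) T2 - (pi / 2 + real (Suc k) * pi) = 0"
    using diagonal_pos[OF that(1,2), of "Suc k"] that(3) by simp_all
  show "th (a, 0) T2 - (pi / 2 + real (Suc k) * pi) < 0" if "a \<ge> 0"
    using alternates_of_th(2)[of a 0 k] that by force
  show "th (0, b) T2 - (pi / 2 + real (Suc k) * pi) < 0" if "b \<ge> 0"
    using alternates_of_th(1)[of 0 b k] that by force
qed

end

section \<open>Counting the curves\<close>

lemma alternates_drop_last: "alternates T w w' (Suc n) c \<Longrightarrow> alternates T w w' n c"
proof (induction n arbitrary: w w' c)
  case (Suc n)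
  from Suc.prems obtain x where x: "x > c" "x < T" "w x > 0" "alternates T w' w (Suc n) x"
    unfolding alternates.simps(2)[of T w w' "Suc n" c] by blast
  have "alternates T w' w n x" by (rule Suc.IH[OF x(4)])
  then show ?case unfolding alternates.simps(2)[of T w w' n c] using x(1,2,3) by blast
qed simp

lemma alternates_drop_first:
  assumes "alternates T w w' (Suc n) c" shows "alternates T w' w n c"
proof -
  from assms obtain x where x: "x > c" "alternates T w' w n x"
    unfolding alternates.simps by blast
  show ?thesis by (rule alternates_mono[OF x(2)]) (use x(1) in simp)
qed

lemma pos_near_left:
  fixes w :: "real \<Rightarrow> real"
  assumes "continuous_on {T1..T2} w" "T1 \<le> c" "c < x" "x \<le> T2" "w x > 0"
  shows "\<exists>y. c < y \<and> y < x \<and> w y > 0"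
proof -
  have "continuous_on {c..x} w" by (rule continuous_on_subset[OF assms(1)]) (use assms in auto)
  then have "(w \<longlongrightarrow> w x) (at_left x)"
    using assms(3) by (simp add: continuous_on_Icc_at_leftD)
  then have "\<forall>\<^sub>F y in at_left x. w y > 0" using assms(5) by (rule order_tendstoD(1))
  moreover have "\<forall>\<^sub>F y in at_left x. c < y" using assms(3) by (rule eventually_at_left_real[THEN eventually_mono]) simp
  moreover have "\<forall>\<^sub>F y in at_left x. y < x" by (simp add: eventually_at_filter)
  ultimately have "\<forall>\<^sub>F y in at_left x. c < y \<and> y < x \<and> w y > 0" by eventually_elim simp
  then show ?thesis by (rule eventually_happens'[rotated]) simp
qed

lemma pos_near_right:
  fixes w :: "real \<Rightarrow> real"
  assumes "continuous_on {T1..T2} w" "T1 < T2" "w T1 > 0"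
  shows "\<exists>y. T1 < y \<and> y < T2 \<and> w y > 0"
proof -
  have "(w \<longlongrightarrow> w T1) (at_right T1)"
    using assms by (simp add: continuous_on_Icc_at_rightD)
  then have "\<forall>\<^sub>F y in at_right T1. w y > 0" using assms(3) by (rule order_tendstoD(1))
  moreover have "\<forall>\<^sub>F y in at_right T1. T1 < y \<and> y < T2"
    using eventually_at_right_real[OF assms(2)] by eventually_elim simp
  ultimately have "\<forall>\<^sub>F y in at_right T1. T1 < y \<and> y < T2 \<and> w y > 0" by eventually_elim simp
  then show ?thesis by (rule eventually_happens'[rotated]) simp
qed

text \<open>The sign hypothesis allows positivity at an end point, the alternation does not;
  continuity moves the point inside.\<close>

lemma alternates_1:
  fixes w :: "real \<Rightarrow> real"
  assumes "continuous_on {T1..T2} w" "T1 < T2" "x \<in> {T1..T2}" "w x > 0"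
  shows "alternates T2 w w' (Suc 0) T1"
proof -
  have "\<exists>y. T1 < y \<and> y < T2 \<and> w y > 0"
  proof (cases "x = T1")
    case True
    then show ?thesis using pos_near_right assms by blast
  next
    case False
    then obtain y where "T1 < y" "y < x" "w y > 0"
      using pos_near_left[OF assms(1), of T1 x] assms by auto
    then show ?thesis using assms(3) by (intro exI[of _ y]) auto
  qed
  then show ?thesis by auto
qed

text \<open>If both orders of signs admit \<open>n\<close> points, the one whose first point comes later can be
  prolonged to the left; continuity separates coinciding first points.\<close>

lemma alternates_extend:
  assumes w: "continuous_on {T1..T2} w" and w': "continuous_on {T1..T2} w'"
    and a: "alternates T2 w w' (Suc n) T1" and b: "alternates T2 w' w (Suc n) T1"
  shows "alternates T2 w w' (Suc (Suc n)) T1 \<or> alternates T2 w' w (Suc (Suc n)) T1"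
proof -
  obtain x where x: "x > T1" "x < T2" "w x > 0" "alternates T2 w' w n x"
    using a unfolding alternates.simps by blast
  obtain y where y: "y > T1" "y < T2" "w' y > 0" "alternates T2 w w' n y"
    using b unfolding alternates.simps by blast
  show ?thesis
  proof (cases "y < x")
    case True
    have "alternates T2 w w' (Suc n) y"
      unfolding alternates.simps(2)[of T2 w w' n y] using True x by blast
    then have "alternates T2 w' w (Suc (Suc n)) T1"
      unfolding alternates.simps(2)[of T2 w' w "Suc n" T1] using y by blast
    then show ?thesis ..
  next
    case False
    obtain z where z: "T1 < z" "z < x" "w z > 0"
      using pos_near_left[OF w, of T1 x] x by auto
    have "z < y" "z < T2" using z False x by auto
    then have "alternates T2 w' w (Suc n) z"
      unfolding alternates.simps(2)[of T2 w' w n z] using y by blast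
    then have "alternates T2 w w' (Suc (Suc n)) T1"
      unfolding alternates.simps(2)[of T2 w w' "Suc n" T1] using z \<open>z < T2\<close> by blast
    then show ?thesis ..
  qed
qed

text \<open>At the least index \<open>N\<close> where not both properties hold, extension from
  \<open>N - 1\<close> provides one of them. Either property at \<open>N + 1\<close> would give both
  at \<open>N\<close>, by dropping the last or the first point, so nothing survives beyond
  \<open>N\<close>.\<close>

lemma dichotomy:
  fixes c d :: "nat \<Rightarrow> bool"
  assumes dl: "\<And>n. c (Suc n) \<Longrightarrow> c n" "\<And>n. d (Suc n) \<Longrightarrow> d n"
    and df: "\<And>n. c (Suc n) \<Longrightarrow> d n" "\<And>n. d (Suc n) \<Longrightarrow> c n"
    and ext: "\<And>n. c n \<Longrightarrow> d n \<Longrightarrow> c (Suc n) \<or> d (Suc n)" and base: "c 0" "d 0"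
  shows "(\<forall>k\<ge>1. c k \<and> d k) \<or>
    (\<exists>k0. (\<forall>k. 1 \<le> k \<and> k \<le> k0 \<longrightarrow> c k \<and> d k) \<and> (c (k0 + 1) \<noteq> d (k0 + 1)) \<and>
      (\<forall>k\<ge>k0 + 2. \<not> c k \<and> \<not> d k))"
proof (cases "\<forall>k. c k \<and> d k")
  case False
  define N where "N = (LEAST k. \<not> (c k \<and> d k))"
  have N: "\<not> (c N \<and> d N)" unfolding N_def by (rule LeastI_ex) (use False in blast)
  have less: "c k \<and> d k" if "k < N" for k using not_less_Least[OF that[unfolded N_def]] by blast
  obtain k0 where k0: "N = Suc k0" using N base by (cases N) auto
  have one: "c N \<or> d N" unfolding k0 using ext[of k0] less[of k0] k0 by simp
  have "\<not> c k \<and> \<not> d k" if "k \<ge> Suc N" for k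
    using that
  proof (induction rule: dec_induct)
    case base
    show ?case using N dl(1)[of N] df(1)[of N] dl(2)[of N] df(2)[of N] by blast
  next
    case (step k)
    then show ?case using dl(1)[of k] dl(2)[of k] by blast
  qed
  moreover have "\<forall>k. 1 \<le> k \<and> k \<le> k0 \<longrightarrow> c k \<and> d k" using less k0 by simp
  moreover have "c (k0 + 1) \<noteq> d (k0 + 1)" using N one k0 by auto
  ultimately show ?thesis using k0 by (intro disjI2 exI[of _ k0]) auto
qed blast

text \<open>Full pairs up to \<open>k0\<close> and a single index at \<open>k0 + 1\<close> make
  \<open>2 * k0 + 1\<close>; oddness includes that the number is not zero.\<close>

lemma infinite_or_odd_card:
  fixes P :: "pm \<Rightarrow> nat \<Rightarrow> bool"
  assumes "(\<forall>k\<ge>1. P Plus k \<and> P Minus k) \<or>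
    (\<exists>k0. (\<forall>k. 1 \<le> k \<and> k \<le> k0 \<longrightarrow> P Plus k \<and> P Minus k) \<and> (P Plus (k0 + 1) \<noteq> P Minus (k0 + 1)) \<and>
      (\<forall>k\<ge>k0 + 2. \<not> P Plus k \<and> \<not> P Minus k))"
  shows "infinite {(s, k). 1 \<le> k \<and> P s k} \<or> odd (card {(s, k). 1 \<le> k \<and> P s k})"
  using assms
proof
  assume all: "\<forall>k\<ge>1. P Plus k \<and> P Minus k"
  have "infinite (range (\<lambda>k. (Plus, Suc k)))"
    by (rule range_inj_infinite) (auto simp: inj_on_def)
  moreover have "range (\<lambda>k. (Plus, Suc k)) \<subseteq> {(s, k). 1 \<le> k \<and> P s k}" using all by auto
  ultimately show ?thesis using infinite_super by blast
next
  assume "\<exists>k0. (\<forall>k. 1 \<le> k \<and> k \<le> k0 \<longrightarrow> P Plus k \<and> P Minus k) \<and> (P Plus (k0 + 1) \<noteq> P Minus (k0 + 1)) \<and>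
      (\<forall>k\<ge>k0 + 2. \<not> P Plus k \<and> \<not> P Minus k)"
  then obtain k0 where k0: "\<And>k. 1 \<le> k \<Longrightarrow> k \<le> k0 \<Longrightarrow> P Plus k \<and> P Minus k"
    "P Plus (k0 + 1) \<noteq> P Minus (k0 + 1)" "\<And>k. k \<ge> k0 + 2 \<Longrightarrow> \<not> P Plus k \<and> \<not> P Minus k"
    by blast
  define s0 where "s0 = (if P Plus (k0 + 1) then Plus else Minus)"
  have s0: "P s (k0 + 1) \<longleftrightarrow> s = s0" for s
    using k0(2) by (cases s) (auto simp: s0_def)
  have Pk: "P s k" if "1 \<le> k" "k \<le> k0" for s k using k0(1)[OF that] by (cases s) auto
  have nP: "\<not> P s k" if "k \<ge> k0 + 2" for s k using k0(3)[OF that] by (cases s) auto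
  have "{(s, k). 1 \<le> k \<and> P s k} = insert (s0, k0 + 1) ({Plus, Minus} \<times> {1..k0})"
  proof (intro set_eqI iffI)
    fix z assume "z \<in> {(s, k). 1 \<le> k \<and> P s k}"
    then obtain s k where z: "z = (s, k)" "1 \<le> k" "P s k" by auto
    consider "k \<le> k0" | "k = k0 + 1" | "k \<ge> k0 + 2" by linarith
    then show "z \<in> insert (s0, k0 + 1) ({Plus, Minus} \<times> {1..k0})"
      by cases (use z s0 nP in \<open>cases s; auto\<close>)+
  next
    fix z assume "z \<in> insert (s0, k0 + 1) ({Plus, Minus} \<times> {1..k0})"
    then show "z \<in> {(s, k). 1 \<le> k \<and> P s k}" using s0[of s0] Pk by auto
  qed
  then have "card {(s, k). 1 \<le> k \<and> P s k} = Suc (2 * k0)"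
    by (simp add: card_cartesian_product)
  then show ?thesis by simp
qed

section \<open>The dichotomy in a given quadrant\<close>

lemma pm_part_pos: "not_ident_zero T1 T2 (pm_part e w) \<longleftrightarrow> (\<exists>t\<in>{T1..T2}. pm_val e * w t > 0)"
proof -
  have "pm_part e w t \<noteq> 0 \<longleftrightarrow> pm_val e * w t > 0" for t
    unfolding pm_part_def by linarith
  then show ?thesis by (simp only: not_ident_zero_def)
qed

context weighted_neumann
begin

text \<open>Only the products \<open>a * m\<close> and \<open>b * n\<close> enter the problem, so a
  sign can be moved from the parameter to the weight.\<close>

lemma C_set_pm_val:
  "(a, b) \<in> C_set T1 T2 p q m n s k \<longleftrightarrow>
   (pm_val e1 * a, pm_val e2 * b) \<in> C_set T1 T2 p q (\<lambda>t. pm_val e1 * m t) (\<lambda>t. pm_val e2 * n t) s k"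
proof -
  have eq: "pm_val e * a * (pm_val e * w) = a * w" for e a w by (cases e) auto
  show ?thesis unfolding C_set_def solves_P_def mem_Collect_eq prod.case eq ..
qed

lemma C_set_in_quadrant:
  fixes e1 e2 :: pm and s :: pm and k :: nat
  assumes k: "k \<ge> 1"
  defines "S \<equiv> C_set T1 T2 p q m n s k \<inter> quadrant e1 e2"
    and "M \<equiv> \<lambda>t. pm_val e1 * m t" and "N \<equiv> \<lambda>t. pm_val e2 * n t"
  shows "S \<noteq> {} \<longleftrightarrow> (if s = Plus \<longleftrightarrow> even k then alternates T2 M N (Suc k) T1 else alternates T2 N M (Suc k) T1)"
    and "S \<noteq> {} \<Longrightarrow> hyperbolic_like e1 e2 S"
proof -
  interpret MN: weighted_neumann T1 T2 p q M N
    by unfold_locales (auto simp: M_def N_def intro: fm_cont gn_cont)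
  interpret NM: weighted_neumann T1 T2 p q N M by (rule MN.swapped)
  obtain k' where k': "k = Suc k'" using k by (cases k) auto
  \<comment> \<open>The membership criterion after reflection. In the exchanged case the arguments
    are swapped as well, so that \<open>a\<close> always multiplies \<open>M\<close>.\<close>
  define F where "F = (\<lambda>a b. (if s = Plus \<longleftrightarrow> even k then MN.th (a, b) T2 else NM.th (b, a) T2) - (pi / 2 + real (Suc k') * pi))"
  have C_iff: "(x, y) \<in> C_set T1 T2 p q m n s k \<longleftrightarrow> F (pm_val e1 * x) (pm_val e2 * y) = 0" for x y
    unfolding C_set_pm_val[of x y s k e1 e2] M_def[symmetric] N_def[symmetric] MN.C_set_iff F_def
      k'[symmetric] right_minus_eq
    by (cases "s = Plus \<longleftrightarrow> even k") simp_all
  have S: "S = {(x, y). 0 \<le> pm_val e1 * x \<and> 0 \<le> pm_val e2 * y \<and> F (pm_val e1 * x) (pm_val e2 * y) = 0}"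
    unfolding S_def quadrant_def using C_iff by (auto simp: pm_halfline_iff)
  have Fex: "S \<noteq> {} \<longleftrightarrow> (\<exists>a\<ge>0. \<exists>b\<ge>0. F a b = 0)"
  proof
    assume "\<exists>a\<ge>0. \<exists>b\<ge>0. F a b = 0"
    then obtain a b where "a \<ge> 0" "b \<ge> 0" "F a b = 0" by blast
    then have "(pm_val e1 * a, pm_val e2 * b) \<in> S" by (simp add: S)
    then show "S \<noteq> {}" by blast
  qed (use S in auto)
  show "S \<noteq> {} \<longleftrightarrow> (if s = Plus \<longleftrightarrow> even k then alternates T2 M N (Suc k) T1 else alternates T2 N M (Suc k) T1)"
  proof (cases "s = Plus \<longleftrightarrow> even k")
    case True
    have "S \<noteq> {} \<longleftrightarrow> (\<exists>a\<ge>0. \<exists>b\<ge>0. MN.th (a, b) T2 = pi / 2 + real (Suc k') * pi)"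
      unfolding Fex F_def if_P[OF True] by simp
    then show ?thesis unfolding MN.th_value_iff_alternates unfolding if_P[OF True] k'[symmetric] .
  next
    case False
    have "S \<noteq> {} \<longleftrightarrow> (\<exists>b\<ge>0. \<exists>a\<ge>0. NM.th (b, a) T2 = pi / 2 + real (Suc k') * pi)"
      unfolding Fex F_def if_not_P[OF False] by auto
    then show ?thesis unfolding NM.th_value_iff_alternates unfolding if_not_P[OF False] k'[symmetric] .
  qed
  have "\<exists>A B. increment_form F A B"
  proof (cases "s = Plus \<longleftrightarrow> even k")
    case True
    then show ?thesis unfolding F_def using MN.increment_form_th[of k'] by auto
  next
    case False
    show ?thesis unfolding F_def if_not_P[OF False]
      using increment_form.swap[OF NM.increment_form_th[of k']] by blast
  qed
  then obtain A B where "increment_form F A B" by blast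
  then interpret increment_form F A B .
  show "hyperbolic_like e1 e2 S" if "S \<noteq> {}"
    using hyperbolic_like_zero_set[of e1 e2] that unfolding S by blast
qed

text \<open>For each \<open>k\<close> the two statements \<open>P Plus k\<close> and
  \<open>P Minus k\<close> are \<open>c k\<close> and \<open>d k\<close> in an order that depends on
  parity. The dichotomy is symmetric in the two and therefore carries over.\<close>

lemma C_set_dichotomy:
  assumes "not_ident_zero T1 T2 (pm_part e1 m)" "not_ident_zero T1 T2 (pm_part e2 n)"
  defines "P \<equiv> \<lambda>s k. C_set T1 T2 p q m n s k \<inter> quadrant e1 e2 \<noteq> {}"
  shows "(\<forall>k\<ge>1. P Plus k \<and> P Minus k) \<or>
    (\<exists>k0. (\<forall>k. 1 \<le> k \<and> k \<le> k0 \<longrightarrow> P Plus k \<and> P Minus k) \<and> (P Plus (k0 + 1) \<noteq> P Minus (k0 + 1)) \<and>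
      (\<forall>k\<ge>k0 + 2. \<not> P Plus k \<and> \<not> P Minus k))"
proof -
  define M where "M = (\<lambda>t. pm_val e1 * m t)"
  define N where "N = (\<lambda>t. pm_val e2 * n t)"
  define c where "c = (\<lambda>k. alternates T2 M N (Suc k) T1)"
  define d where "d = (\<lambda>k. alternates T2 N M (Suc k) T1)"
  have Mc: "continuous_on {T1..T2} M" and Nc: "continuous_on {T1..T2} N"
    unfolding M_def N_def by (rule fm_cont gn_cont)+
  have P: "P s k \<longleftrightarrow> (if s = Plus \<longleftrightarrow> even k then c k else d k)" if "k \<ge> 1" for s k
    unfolding P_def c_def d_def M_def N_def by (rule C_set_in_quadrant(1)[OF that])
  have both: "(P Plus k \<and> P Minus k \<longleftrightarrow> c k \<and> d k) \<and> (P Plus k \<noteq> P Minus k \<longleftrightarrow> c k \<noteq> d k)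
      \<and> (\<not> P Plus k \<and> \<not> P Minus k \<longleftrightarrow> \<not> c k \<and> \<not> d k)" if "k \<ge> 1" for k
    using P[OF that, of Plus] P[OF that, of Minus] by (cases "even k") auto
  have "(\<forall>k\<ge>1. c k \<and> d k) \<or>
    (\<exists>k0. (\<forall>k. 1 \<le> k \<and> k \<le> k0 \<longrightarrow> c k \<and> d k) \<and> (c (k0 + 1) \<noteq> d (k0 + 1)) \<and>
      (\<forall>k\<ge>k0 + 2. \<not> c k \<and> \<not> d k))"
  proof (rule dichotomy)
    show "c n" "d n" if "c (Suc n)" for n
      using that unfolding c_def d_def by (fact alternates_drop_last, fact alternates_drop_first)
    show "d n" "c n" if "d (Suc n)" for n
      using that unfolding c_def d_def by (fact alternates_drop_last, fact alternates_drop_first)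
    show "c (Suc n) \<or> d (Suc n)" if "c n" "d n" for n
      using that unfolding c_def d_def by (rule alternates_extend[OF Mc Nc])
    \<comment> \<open>One point each: this is exactly the hypothesis that the parts of
      \<open>m\<close> and \<open>n\<close> selected by the signs do not vanish identically.\<close>
    show "c 0" "d 0"
      using assms(1,2) unfolding c_def d_def pm_part_pos M_def[symmetric] N_def[symmetric]
      by (auto simp del: alternates.simps simp: M_def N_def intro: alternates_1[OF Mc T, unfolded M_def N_def] alternates_1[OF Nc T, unfolded M_def N_def])
  qed
  then show ?thesis
  proof
    assume "\<forall>k\<ge>1. c k \<and> d k"
    then show ?thesis using both by blast
  next
    assume "\<exists>k0. (\<forall>k. 1 \<le> k \<and> k \<le> k0 \<longrightarrow> c k \<and> d k) \<and> (c (k0 + 1) \<noteq> d (k0 + 1)) \<and>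
      (\<forall>k\<ge>k0 + 2. \<not> c k \<and> \<not> d k)"
    then obtain k0 where k0: "\<And>k. 1 \<le> k \<Longrightarrow> k \<le> k0 \<Longrightarrow> c k \<and> d k" "c (k0 + 1) \<noteq> d (k0 + 1)"
      "\<And>k. k \<ge> k0 + 2 \<Longrightarrow> \<not> c k \<and> \<not> d k" by blast
    have "P Plus k \<and> P Minus k" if "1 \<le> k" "k \<le> k0" for k
      using both[OF that(1)] k0(1)[OF that] by blast
    moreover have "P Plus (k0 + 1) \<noteq> P Minus (k0 + 1)"
      using both[of "k0 + 1"] k0(2) by simp
    moreover have "\<not> P Plus k \<and> \<not> P Minus k" if "k \<ge> k0 + 2" for k
      using both[of k] k0(3)[OF that] that by simp
    ultimately show ?thesis by blast
  qed
qed

end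

theorem mainTheorem4:
  fixes T1 T2 :: real and p q m n :: "real \<Rightarrow> real"
  assumes "T1 < T2"
    and "continuous_on {T1..T2} p" and "continuous_on {T1..T2} q"
    and "continuous_on {T1..T2} m" and "continuous_on {T1..T2} n"
    and "\<forall>t\<in>{T1..T2}. p t > 0" and "\<forall>t\<in>{T1..T2}. q t \<ge> 0"
    and "not_ident_zero T1 T2 m" and "not_ident_zero T1 T2 n"
  shows "(\<forall>e1 e2. not_ident_zero T1 T2 (pm_part e1 m) \<and> not_ident_zero T1 T2 (pm_part e2 n) \<longrightarrow>
           (let Q = quadrant e1 e2;
                C_gt = (\<lambda>k. C_set T1 T2 p q m n Plus k \<inter> Q);
                C_lt = (\<lambda>k. C_set T1 T2 p q m n Minus k \<inter> Q)
            in (\<forall>k\<ge>1. C_gt k \<noteq> {} \<and> C_lt k \<noteq> {}) \<or>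
               (\<exists>k0::nat.
                  (\<forall>k. 1 \<le> k \<and> k \<le> k0 \<longrightarrow> C_gt k \<noteq> {} \<and> C_lt k \<noteq> {}) \<and>
                  (C_gt (k0 + 1) \<noteq> {} \<and> C_lt (k0 + 1) = {} \<or>
                   C_gt (k0 + 1) = {} \<and> C_lt (k0 + 1) \<noteq> {}) \<and>
                  (\<forall>k\<ge>k0 + 2. C_gt k = {} \<and> C_lt k = {}))))
       \<and> ((\<forall>e. not_ident_zero T1 T2 (pm_part e m) \<and> not_ident_zero T1 T2 (pm_part e n)) \<longrightarrow>
           (\<forall>e1 e2.
              let Q = quadrant e1 e2;
                  I = curve_indices T1 T2 p q m n Q
              in Sigma_star T1 T2 p q m n \<inter> Q = (\<Union>(s, k)\<in>I. C_set T1 T2 p q m n s k \<inter> Q) \<and>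
                 (\<forall>(s, k)\<in>I. hyperbolic_like e1 e2 (C_set T1 T2 p q m n s k \<inter> Q)) \<and>
                 (infinite I \<or> odd (card I))))"
proof -
  interpret weighted_neumann T1 T2 p q m n
    by unfold_locales (use assms in auto)
  let ?C = "C_set T1 T2 p q m n"
  show ?thesis
    unfolding Let_def
  proof (intro conjI allI impI)
    fix e1 e2
    assume h: "not_ident_zero T1 T2 (pm_part e1 m) \<and> not_ident_zero T1 T2 (pm_part e2 n)"
    have xor: "(A \<noteq> {} \<and> B = {} \<or> A = {} \<and> B \<noteq> {}) \<longleftrightarrow> ((A \<noteq> {}) \<noteq> (B \<noteq> {}))" for A B :: "(real \<times> real) set"
      by blast
    show "(\<forall>k\<ge>1. ?C Plus k \<inter> quadrant e1 e2 \<noteq> {} \<and> ?C Minus k \<inter> quadrant e1 e2 \<noteq> {}) \<or>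
      (\<exists>k0. (\<forall>k. 1 \<le> k \<and> k \<le> k0 \<longrightarrow> ?C Plus k \<inter> quadrant e1 e2 \<noteq> {} \<and> ?C Minus k \<inter> quadrant e1 e2 \<noteq> {}) \<and>
        (?C Plus (k0 + 1) \<inter> quadrant e1 e2 \<noteq> {} \<and> ?C Minus (k0 + 1) \<inter> quadrant e1 e2 = {} \<or>
         ?C Plus (k0 + 1) \<inter> quadrant e1 e2 = {} \<and> ?C Minus (k0 + 1) \<inter> quadrant e1 e2 \<noteq> {}) \<and>
        (\<forall>k\<ge>k0 + 2. ?C Plus k \<inter> quadrant e1 e2 = {} \<and> ?C Minus k \<inter> quadrant e1 e2 = {}))"
      unfolding xor using C_set_dichotomy[of e1 e2] h unfolding not_not by blast
  next
    fix e1 e2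
    let ?Q = "quadrant e1 e2"
    show "Sigma_star T1 T2 p q m n \<inter> ?Q = (\<Union>(s, k)\<in>curve_indices T1 T2 p q m n ?Q. ?C s k \<inter> ?Q)"
    proof (intro set_eqI iffI)
      fix z assume z: "z \<in> Sigma_star T1 T2 p q m n \<inter> ?Q"
      then obtain s k where "1 \<le> k" "z \<in> ?C s k" "z \<in> ?Q" unfolding Sigma_star_def by blast
      then show "z \<in> (\<Union>(s, k)\<in>curve_indices T1 T2 p q m n ?Q. ?C s k \<inter> ?Q)"
        unfolding curve_indices_def by blast
    next
      fix z assume "z \<in> (\<Union>(s, k)\<in>curve_indices T1 T2 p q m n ?Q. ?C s k \<inter> ?Q)"
      then obtain s k where "1 \<le> k" "z \<in> ?C s k" "z \<in> ?Q" unfolding curve_indices_def by blast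
      then show "z \<in> Sigma_star T1 T2 p q m n \<inter> ?Q"
        unfolding Sigma_star_def by (cases s) auto
    qed
    show "\<forall>(s, k)\<in>curve_indices T1 T2 p q m n ?Q. hyperbolic_like e1 e2 (?C s k \<inter> ?Q)"
      unfolding curve_indices_def using C_set_in_quadrant(2) by blast
    assume h: "\<forall>e. not_ident_zero T1 T2 (pm_part e m) \<and> not_ident_zero T1 T2 (pm_part e n)"
    show "infinite (curve_indices T1 T2 p q m n ?Q) \<or> odd (card (curve_indices T1 T2 p q m n ?Q))"
      unfolding curve_indices_def
      by (rule infinite_or_odd_card[OF C_set_dichotomy]) (use h in blast)+
  qed
qed

end
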